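(* Let $(A,b)$ be an explicit $s$-stage Runge--Kutta (RK) method with $c_s=1$, let $c=Ae$, and let $a=(a_{s1},\dots,a_{s,s-1},0)^T$ be the last row of $A$ written as a column vector. Write $c^2$ for the componentwise square of $c$. 1. The RKRLS method associated with $(A,b)$ has order $1$ if and only if the RK method $(A,b)$ has order $1$. 2. The RKRLS method has order $2$ if and only if the RK method $(A,b)$ has order $2$. 3. The RKRLS method has order $3$ if and only if the RK method $(A,b)$ has order $3$ and either $b_1=0$ or else $a^Tc=1/2$. 4. The RKRLS method has order $4$ if and only if the RK method $(A,b)$ has order $4$ and at least one of the following conditions is satisfied: (i) $(b^TA)_1=0$ and $b_1=0$; (ii) $a^Tc=1/2$ (the method $(A,a)$ has order 2) and $b_1=0$; (iii) $a^Tc=1/2$ and $a^TAc=1/6$ and $a^Tc^2=1/3$ (the method $(A,a)$ has order 3). 5. Let the RK method $(A,b)$ have order $p\ge5$. If $b_1=0$ and $(b^TA)_1=0$ and $a^Tc=1/2$, then the RKRLS method has order $\ge 5$.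
   Context: An explicit $s$-stage Runge--Kutta (RK) method $(A,b)$ is given by a strictly lower triangular real matrix $A=(a_{ij})_{1\le i,j\le s}$ and $b\in\mathbb{R}^s$, with nodes $c=Ae$, $e=(1,\dots,1)^T\in\mathbb{R}^s$ (so $c_1=0$). One step of size $h$ for $y'=f(t,y)$ from $(t_n,y_n)$ is $y_{n+1}=y_n+h\sum_{i=1}^s b_i f_{n,i}$, where $f_{n,i}=f\big(t_n+c_ih,\;y_n+h\sum_{j<i}a_{ij}f_{n,j}\big)$ for $i=1,\dots,s$. The same formulas define the RK step for coefficients with any number of stages. The associated RKRLS method (RK method reusing the last stage, assuming $c_s=1$) uses the same formulas except that in every step after the first one the first stage is replaced by the last stage of the previous step: $f_{n,1}:=f_{n-1,s}$ for $n\ge1$, while $f_{0,1}=f(t_0,y_0)$. An RK method has (local) order $p$ if, for every initial value problem with sufficiently smooth $f$, its error after one step of size $h$ from exact data is $\mathcal{O}(h^{p+1})$ as $h\to0$ ("order $p$" means order at least $p$); equivalently, its coefficients satisfy the Butcher order conditions for all rooted trees with at most $p$ vertices. Let $e_1=(1,0,\dots,0)^T\in\mathbb{R}^s$, $M=e_1(a-b)^T$ and $E=eb^T+M$. For $n\ge 2$, $n$ consecutive steps of size $h$ of the RKRLS method are one step of size $H=nh$ of the $ns$-stage RK method $(\widehat A^{(n)},\widehat b^{(n)})$, called the $n$-step composed method, where $\widehat b^{(n)}=\frac1n(b^T,\dots,b^T)^T\in\mathbb{R}^{ns}$ and $\widehat A^{(n)}$ is $\frac1n$ times the $n\times n$ block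 lower triangular matrix with $s\times s$ blocks: $A$ in each diagonal block, $E$ in each block of the first block subdiagonal, $eb^T$ in every block below that, and $0$ above the diagonal. Definition: the RKRLS method has (local) order $p$ if, for every $n\ge2$, the $n$-step composed method $(\widehat A^{(n)},\widehat b^{(n)})$ has local order $p$. *)

theory Defs
  imports
    "HOL-Analysis.Analysis"
    "HOL-Library.Landau_Symbols"
    "Jordan_Normal_Form.Matrix"
begin

unbundle no vec_syntax
unbundle no inner_syntax

text \<open>
  The dimension of an initial value problem has to be quantified inside the notion of order, so
  the space of \<open>d\<close>-vectors cannot be a type. It is represented by \<^typ>\<open>nat \<Rightarrow> real\<close>, of which only the
  coordinates below \<open>d\<close> are relevant. For a function that depends on these coordinates only,
  continuity in the product topology is the usual continuity of a function of \<open>d\<close> real variables.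
\<close>

definition depends_on_first :: "nat \<Rightarrow> ((nat \<Rightarrow> real) \<Rightarrow> real) \<Rightarrow> bool" where
  "depends_on_first d g \<longleftrightarrow> (\<forall>x y. (\<forall>i<d. x i = y i) \<longrightarrow> g x = g y)"

primrec C_diff :: "nat \<Rightarrow> nat \<Rightarrow> ((nat \<Rightarrow> real) \<Rightarrow> real) \<Rightarrow> bool" where
  "C_diff d 0 g \<longleftrightarrow> depends_on_first d g \<and> continuous_on UNIV g"
| "C_diff d (Suc k) g \<longleftrightarrow> depends_on_first d g \<and> continuous_on UNIV g \<and>
     (\<forall>i<d. \<exists>g'. C_diff d k g' \<and>
        (\<forall>x. ((\<lambda>u. g (x(i := u))) has_real_derivative g' x) (at (x i))))"

definition smooth :: "nat \<Rightarrow> ((nat \<Rightarrow> real) \<Rightarrow> real) \<Rightarrow> bool" where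
  "smooth d g \<longleftrightarrow> (\<forall>k. C_diff d k g)"

text \<open>
  Joint smoothness of \<open>f\<close> in the time and the \<open>d\<close> state variables: the time is prepended to the state
  as the coordinate \<open>0\<close>.
\<close>

definition smooth_rhs :: "nat \<Rightarrow> (real \<Rightarrow> (nat \<Rightarrow> real) \<Rightarrow> (nat \<Rightarrow> real)) \<Rightarrow> bool" where
  "smooth_rhs d f \<longleftrightarrow> (\<forall>k<d. smooth (Suc d) (\<lambda>x. f (x 0) (\<lambda>i. x (Suc i)) k))"

definition solves_ivp ::
  "nat \<Rightarrow> (real \<Rightarrow> (nat \<Rightarrow> real) \<Rightarrow> (nat \<Rightarrow> real)) \<Rightarrow> real \<Rightarrow> (nat \<Rightarrow> real) \<Rightarrow> real
    \<Rightarrow> (real \<Rightarrow> nat \<Rightarrow> real) \<Rightarrow> bool" where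
  "solves_ivp d f t0 y0 T y \<longleftrightarrow>
     (\<forall>k<d. y t0 k = y0 k \<and>
       (\<forall>t\<in>{t0..T}. ((\<lambda>u. y u k) has_real_derivative f t (y t) k) (at t within {t0..T})))"

definition explicit_rk :: "nat \<Rightarrow> real mat \<Rightarrow> real vec \<Rightarrow> bool" where
  "explicit_rk s A b \<longleftrightarrow> A \<in> carrier_mat s s \<and> b \<in> carrier_vec s \<and>
     (\<forall>i<s. \<forall>j<s. i \<le> j \<longrightarrow> A $$ (i, j) = 0)"

abbreviation ones :: "nat \<Rightarrow> real vec" where
  "ones s \<equiv> vec s (\<lambda>_. 1)"

definition nodes :: "real mat \<Rightarrow> real vec" where
  "nodes A = A *\<^sub>v ones (dim_col A)"

fun rk_stage ::
  "real mat \<Rightarrow> (real \<Rightarrow> (nat \<Rightarrow> real) \<Rightarrow> (nat \<Rightarrow> real)) \<Rightarrow> real \<Rightarrow> (nat \<Rightarrow> real) \<Rightarrow> real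
    \<Rightarrow> nat \<Rightarrow> (nat \<Rightarrow> real)" where
  "rk_stage A f t0 y0 h i =
     f (t0 + nodes A $ i * h)
       (\<lambda>k. y0 k + h * (\<Sum>j<i. A $$ (i, j) * rk_stage A f t0 y0 h j k))"

declare rk_stage.simps [simp del]

definition rk_step ::
  "real mat \<Rightarrow> real vec \<Rightarrow> (real \<Rightarrow> (nat \<Rightarrow> real) \<Rightarrow> (nat \<Rightarrow> real)) \<Rightarrow> real \<Rightarrow> (nat \<Rightarrow> real) \<Rightarrow> real
    \<Rightarrow> (nat \<Rightarrow> real)" where
  "rk_step A b f t0 y0 h =
     (\<lambda>k. y0 k + h * (\<Sum>i<dim_vec b. b $ i * rk_stage A f t0 y0 h i k))"

text \<open>
  Order \<open>p\<close> means order at least \<open>p\<close>. The limit is \<open>h \<rightarrow> 0\<close> with \<open>h > 0\<close>, so an exact solution on some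
  interval \<open>[t0, T]\<close> to the right of \<open>t0\<close> suffices.
\<close>

definition rk_order :: "real mat \<Rightarrow> real vec \<Rightarrow> nat \<Rightarrow> bool" where
  "rk_order A b p \<longleftrightarrow>
     (\<forall>d f t0 y0 T y. smooth_rhs d f \<and> t0 < T \<and> solves_ivp d f t0 y0 T y \<longrightarrow>
       (\<forall>k<d. (\<lambda>h. y (t0 + h) k - rk_step A b f t0 y0 h k) \<in> O[at_right 0](\<lambda>h. h ^ (p + 1))))"

definition outer_prod :: "real vec \<Rightarrow> real vec \<Rightarrow> real mat" where
  "outer_prod u v = mat (dim_vec u) (dim_vec v) (\<lambda>(i, j). u $ i * v $ j)"

definition last_row :: "real mat \<Rightarrow> real vec" where
  "last_row A = row A (dim_row A - 1)"

text \<open>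
  The first row of \<open>reuse_E A b\<close> is the last row of \<open>A\<close>: in the composed method the first stage of a
  step then repeats the last stage of the preceding step. The other rows are \<open>b\<close>.
\<close>

definition reuse_M :: "real mat \<Rightarrow> real vec \<Rightarrow> real mat" where
  "reuse_M A b = outer_prod (unit_vec (dim_vec b) 0) (last_row A - b)"

definition reuse_E :: "real mat \<Rightarrow> real vec \<Rightarrow> real mat" where
  "reuse_E A b = outer_prod (ones (dim_vec b)) b + reuse_M A b"

definition composed_block :: "real mat \<Rightarrow> real vec \<Rightarrow> nat \<Rightarrow> nat \<Rightarrow> real mat" where
  "composed_block A b k l =
     (if k = l then A
      else if k = l + 1 then reuse_E A b
      else if k > l + 1 then outer_prod (ones (dim_vec b)) b
      else 0\<^sub>m (dim_vec b) (dim_vec b))"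

definition composed_A :: "nat \<Rightarrow> real mat \<Rightarrow> real vec \<Rightarrow> real mat" where
  "composed_A n A b =
     (let s = dim_vec b in
      mat (n * s) (n * s)
        (\<lambda>(i, j). 1 / real n * composed_block A b (i div s) (j div s) $$ (i mod s, j mod s)))"

definition composed_b :: "nat \<Rightarrow> real vec \<Rightarrow> real vec" where
  "composed_b n b = (let s = dim_vec b in vec (n * s) (\<lambda>i. 1 / real n * b $ (i mod s)))"

definition rkrls_order :: "real mat \<Rightarrow> real vec \<Rightarrow> nat \<Rightarrow> bool" where
  "rkrls_order A b p \<longleftrightarrow> (\<forall>n\<ge>2. rk_order (composed_A n A b) (composed_b n b) p)"

end

theory Submission imports Defs begin

text \<open>
  The composed method is followed step by step. In \<open>n\<close> steps of size \<open>h\<close> it produces pairs \<open>(Y\<^sub>k, G\<^sub>k)\<close>: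
  the approximation at \<open>t\<^sub>k = t0 + k h\<close> and the value that serves as first stage of the next step. A plain
  step has \<open>G\<^sub>k = f t\<^sub>k Y\<^sub>k\<close>; here \<open>G\<^sub>k = f t\<^sub>k Z\<^sub>k\<close>, where \<open>Z\<^sub>k\<close> is the result of the preceding step with the
  weights \<open>a\<close> (the last row of \<open>A\<close>) in place of \<open>b\<close> (\<open>composed_step_eq_reuse_chain\<close>).
  
  Two exponents control the effect of this replacement. If \<open>(A, a)\<close> has order \<open>r \<le> p\<close>, where \<open>p\<close> is the order of \<open>(A, b)\<close>, then
  \<open>G\<^sub>k - f t\<^sub>k Y\<^sub>k = O(h\<^bsup>r+1\<^esup>)\<close>. An error in the first stage enters the update with a factor \<open>h\<^sup>m\<close>, where \<open>m = 1\<close> in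
  general, \<open>m = 2\<close> if \<open>b\<^sub>1 = 0\<close>, and \<open>m = 3\<close> if also \<open>(b\<^sup>T A)\<^sub>1 = 0\<close>
  (\<open>restart_step_first_stage_diff\<close>). So the reuse adds \<open>O(h\<^bsup>m+r+1\<^esup>)\<close> per step, and a method of order
  \<open>p \<le> m + r\<close> keeps its order (\<open>reuse_order_sufficient\<close>). Each sufficient condition of the theorem is such a choice of \<open>m\<close> and \<open>r\<close>;
  that \<open>a\<^sup>T c = 1/2\<close> gives \<open>r = 2\<close> and the three conditions on \<open>a\<close> give \<open>r = 3\<close> is the classical expansion
  up to third order (\<open>order_conditions_sufficient\<close>).
  
  For the converse, let the underlying method have order \<open>p - 1\<close> with \<open>r < p \<le> m + r + 1\<close>. Compare three composed steps from \<open>t0\<close> with two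
  composed steps that start on the exact solution at \<open>t0 + h\<close>. Both are accurate at \<open>t0 + 3h\<close> up to \<open>O(h\<^bsup>p+1\<^esup>)\<close>,
  and the reused values in their last steps agree well enough to cancel. What remains is the local error of one plain step
  from \<open>t0 + h\<close>, which is therefore \<open>O(h\<^bsup>p+1\<^esup>)\<close> (\<open>rk_order_of_reuse_order\<close>). The conditions
  on \<open>a\<close> and \<open>b\<close> come from the systems \<open>u' = t\<^sup>q, v' = u, w' = v\<close>, started at \<open>0\<close>, on which the effect of the reuse in the
  second step is an explicit monomial in \<open>h\<close> (\<open>reuse_order_tower_conditions\<close>).
  
  Order is defined for one initial value at a time, but both arguments use steps that start at \<open>t0 + k h\<close>, which moves
  with \<open>h\<close>. The needed uniformity follows from smoothness: the local error has a Taylor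
  expansion in \<open>h\<close> whose coefficients are continuous in the starting time and whose remainder is uniform; order \<open>p\<close> makes the
  coefficients up to \<open>h\<^sup>p\<close> vanish for every starting time (\<open>local_error_expansion\<close>).
\<close>

section \<open>Mean values and linearisation of functions of finitely many coordinates\<close>

lemma C_diff_depends: "C_diff d k g \<Longrightarrow> depends_on_first d g"
  by (cases k) auto

lemma C_diff_cont: "C_diff d k g \<Longrightarrow> continuous_on UNIV g"
  by (cases k) auto

lemma C_diff_partials:
  assumes "C_diff d (Suc k) g"
  obtains G where "\<And>i. i < d \<Longrightarrow> C_diff d k (G i)"
    "\<And>i x. i < d \<Longrightarrow> ((\<lambda>u. g (x(i := u))) has_real_derivative G i x) (at (x i))"
proof -
  have "\<forall>i\<in>{..<d}. \<exists>g'. C_diff d k g' \<and>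
        (\<forall>x. ((\<lambda>u. g (x(i := u))) has_real_derivative g' x) (at (x i)))"
    using assms by simp
  then obtain G where "\<forall>i\<in>{..<d}. C_diff d k (G i) \<and>
        (\<forall>x. ((\<lambda>u. g (x(i := u))) has_real_derivative G i x) (at (x i)))"
    by (rule bchoice[THEN exE])
  thus ?thesis by (intro that[of G]) auto
qed

text \<open>
  Continuity in the product topology only asks for convergence of the coordinates below \<open>d\<close>, as the other
  coordinates may be replaced by those of the limit.
\<close>

lemma C_diff_tendsto:
  assumes "C_diff d k g" and lim: "\<And>i. i < d \<Longrightarrow> ((\<lambda>h. x h i) \<longlongrightarrow> x0 i) F"
  shows "((\<lambda>h. g (x h)) \<longlongrightarrow> g x0) F"
proof -
  define x' where "x' = (\<lambda>h i. if i < d then x h i else x0 i)"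
  have "isCont g x0"
    using C_diff_cont[OF assms(1)] by (simp add: continuous_on_eq_continuous_at)
  moreover have "(x' \<longlongrightarrow> x0) F"
  proof -
    have "limitin (product_topology (\<lambda>i. euclidean) UNIV) x' x0 F"
    proof -
      have "limitin euclidean (\<lambda>h. x' h i) (x0 i) F" for i
        by (cases "i < d") (auto simp: x'_def lim)
      thus ?thesis by (simp add: limitin_componentwise)
    qed
    thus ?thesis by (simp only: euclidean_product_topology limitin_canonical_iff)
  qed
  ultimately have "((\<lambda>h. g (x' h)) \<longlongrightarrow> g x0) F"
    by (rule isCont_tendsto_compose)
  moreover have "g (x' h) = g (x h)" for h
    using C_diff_depends[OF assms(1)] by (auto simp: depends_on_first_def x'_def)
  ultimately show ?thesis by simp
qed

lemma real_mean_value: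
  fixes f f' :: "real \<Rightarrow> real"
  assumes "\<And>u. (f has_real_derivative f' u) (at u)"
  obtains z where "min a b \<le> z" "z \<le> max a b" "f b - f a = f' z * (b - a)"
proof (cases a b rule: linorder_cases)
  case less
  from MVT2[OF this, of f f'] assms obtain z where "a < z" "z < b" "f b - f a = (b - a) * f' z"
    by blast
  thus ?thesis by (intro that[of z]) (auto simp: mult.commute)
next
  case equal
  thus ?thesis by (intro that[of a]) auto
next
  case greater
  from MVT2[OF this, of f f'] assms obtain z where "b < z" "z < a" "f a - f b = (a - b) * f' z"
    by blast
  thus ?thesis by (intro that[of z]) (auto simp: algebra_simps)
qed

text \<open>
  Pass from \<open>x'\<close> to \<open>x\<close> by exchanging one coordinate at a time and apply the one-dimensional mean value theorem to
  every exchange. The intermediate points lie coordinatewise between \<open>x'\<close> and \<open>x\<close>, so they inherit every limit and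
  every bound that these two share.
\<close>

lemma partial_mean_value:
  fixes x x' :: "nat \<Rightarrow> real"
  assumes dep: "depends_on_first d g"
    and der: "\<And>i x. i < d \<Longrightarrow> ((\<lambda>u. g (x(i := u))) has_real_derivative G i x) (at (x i))"
  obtains \<xi> where "\<And>i j. min (x j) (x' j) \<le> \<xi> i j" "\<And>i j. \<xi> i j \<le> max (x j) (x' j)"
    "g x - g x' = (\<Sum>i<d. G i (\<xi> i) * (x i - x' i))"
proof -
  define z where "z m = (\<lambda>j. if j < m then x j else x' j)" for m
  have ex: "\<exists>u. min (x' m) (x m) \<le> u \<and> u \<le> max (x' m) (x m) \<and>
      g (z (Suc m)) - g (z m) = G m ((z m)(m := u)) * (x m - x' m)" if "m < d" for m
  proof -
    have "((\<lambda>u. g ((z m)(m := u))) has_real_derivative G m ((z m)(m := u))) (at u)" for u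
      using der[OF that, of "(z m)(m := u)"] by simp
    then obtain u where u: "min (x' m) (x m) \<le> u" "u \<le> max (x' m) (x m)"
       "g ((z m)(m := x m)) - g ((z m)(m := x' m)) = G m ((z m)(m := u)) * (x m - x' m)"
      using real_mean_value[of "\<lambda>u. g ((z m)(m := u))" "\<lambda>u. G m ((z m)(m := u))" "x' m" "x m"]
      by blast
    have "(z m)(m := x m) = z (Suc m)" "(z m)(m := x' m) = z m"
      by (auto simp: z_def fun_eq_iff less_Suc_eq)
    with u show ?thesis by auto
  qed
  then obtain u where u: "\<And>m. m < d \<Longrightarrow> min (x' m) (x m) \<le> u m \<and> u m \<le> max (x' m) (x m) \<and>
      g (z (Suc m)) - g (z m) = G m ((z m)(m := u m)) * (x m - x' m)" by metis
  define \<xi> where "\<xi> m = (if m < d then (z m)(m := u m) else x)" for m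
  have ends: "g x = g (z d)" "g x' = g (z 0)"
    using dep by (auto simp: depends_on_first_def z_def)
  have "g x - g x' = (\<Sum>m<d. g (z (Suc m)) - g (z m))"
    unfolding ends by (rule sum_lessThan_telescope[symmetric])
  also have "\<dots> = (\<Sum>m<d. G m (\<xi> m) * (x m - x' m))"
    by (rule sum.cong) (use u in \<open>auto simp: \<xi>_def\<close>)
  finally have eq: "g x - g x' = (\<Sum>m<d. G m (\<xi> m) * (x m - x' m))" .
  have "min (x j) (x' j) \<le> \<xi> i j \<and> \<xi> i j \<le> max (x j) (x' j)" for i j
    using u[of i] by (auto simp: \<xi>_def z_def min.commute max.commute)
  thus ?thesis using eq by (intro that[of \<xi>]) auto
qed

text \<open>
  The intermediate points, chosen as functions of a parameter, so that limits can be taken.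
\<close>

lemma partial_mean_value_family:
  fixes x x' :: "real \<Rightarrow> nat \<Rightarrow> real"
  assumes dep: "depends_on_first d g"
    and der: "\<And>i x. i < d \<Longrightarrow> ((\<lambda>u. g (x(i := u))) has_real_derivative G i x) (at (x i))"
  obtains \<xi> where "\<And>h i j. min (x h j) (x' h j) \<le> \<xi> h i j" "\<And>h i j. \<xi> h i j \<le> max (x h j) (x' h j)"
    "\<And>h. g (x h) - g (x' h) = (\<Sum>i<d. G i (\<xi> h i) * (x h i - x' h i))"
proof -
  have "\<forall>h. \<exists>\<xi>. (\<forall>i j. min (x h j) (x' h j) \<le> \<xi> i j \<and> \<xi> i j \<le> max (x h j) (x' h j)) \<and>
     g (x h) - g (x' h) = (\<Sum>i<d. G i (\<xi> i) * (x h i - x' h i))"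
  proof
    fix h
    show "\<exists>\<xi>. (\<forall>i j. min (x h j) (x' h j) \<le> \<xi> i j \<and> \<xi> i j \<le> max (x h j) (x' h j)) \<and>
     g (x h) - g (x' h) = (\<Sum>i<d. G i (\<xi> i) * (x h i - x' h i))"
    proof (rule partial_mean_value[OF dep der, of "x h" "x' h"])
      fix \<xi> assume "\<And>i j. min (x h j) (x' h j) \<le> \<xi> i j" "\<And>i j. \<xi> i j \<le> max (x h j) (x' h j)"
        "g (x h) - g (x' h) = (\<Sum>i<d. G i (\<xi> i) * (x h i - x' h i))"
      thus ?thesis by (intro exI[of _ \<xi>] conjI allI) assumption+
    qed
  qed
  then obtain \<xi> where "\<forall>h. (\<forall>i j. min (x h j) (x' h j) \<le> \<xi> h i j \<and> \<xi> h i j \<le> max (x h j) (x' h j)) \<and>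
     g (x h) - g (x' h) = (\<Sum>i<d. G i (\<xi> h i) * (x h i - x' h i))"
    by (rule choice[THEN exE])
  thus ?thesis by (intro that[of \<xi>]) auto
qed

lemma tendsto_between:
  fixes a b c :: "'a \<Rightarrow> real"
  assumes "(a \<longlongrightarrow> l) F" "(b \<longlongrightarrow> l) F" "\<And>h. min (a h) (b h) \<le> c h" "\<And>h. c h \<le> max (a h) (b h)"
  shows "(c \<longlongrightarrow> l) F"
proof (rule tendsto_sandwich)
  show "((\<lambda>h. min (a h) (b h)) \<longlongrightarrow> l) F" using tendsto_min[OF assms(1,2)] by simp
  show "((\<lambda>h. max (a h) (b h)) \<longlongrightarrow> l) F" using tendsto_max[OF assms(1,2)] by simp
qed (use assms in auto)

lemma tendsto_imp_bounded_bigo: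
  fixes f :: "'a \<Rightarrow> real"
  assumes "(f \<longlongrightarrow> l) F"
  shows "f \<in> O[F](\<lambda>_. 1)"
  using bigoI_tendsto[of f "\<lambda>_. 1" l F] assms by simp

lemma C_diff_diff_bigo:
  fixes \<phi> :: "real \<Rightarrow> real"
  assumes g: "C_diff d (Suc k) g"
    and "\<And>i. i < d \<Longrightarrow> ((\<lambda>h. x h i) \<longlongrightarrow> x0 i) F"
    and "\<And>i. i < d \<Longrightarrow> ((\<lambda>h. x' h i) \<longlongrightarrow> x0 i) F"
    and diff: "\<And>i. i < d \<Longrightarrow> (\<lambda>h. x h i - x' h i) \<in> O[F](\<phi>)"
  shows "(\<lambda>h. g (x h) - g (x' h)) \<in> O[F](\<phi>)"
proof -
  obtain G where G: "\<And>i. i < d \<Longrightarrow> C_diff d k (G i)"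
    and der: "\<And>i x. i < d \<Longrightarrow> ((\<lambda>u. g (x(i := u))) has_real_derivative G i x) (at (x i))"
    using C_diff_partials[OF g] by blast
  obtain \<xi> where \<xi>: "\<And>h i j. min (x h j) (x' h j) \<le> \<xi> h i j" "\<And>h i j. \<xi> h i j \<le> max (x h j) (x' h j)"
    and eq: "\<And>h. g (x h) - g (x' h) = (\<Sum>i<d. G i (\<xi> h i) * (x h i - x' h i))"
    using partial_mean_value_family[OF C_diff_depends[OF g] der, of x x'] by blast
  have "(\<lambda>h. G i (\<xi> h i)) \<in> O[F](\<lambda>_. 1)" if "i < d" for i
    by (rule tendsto_imp_bounded_bigo[OF C_diff_tendsto[OF G[OF that]]])
       (rule tendsto_between[OF assms(2,3) \<xi>])
  hence "(\<lambda>h. G i (\<xi> h i) * (x h i - x' h i)) \<in> O[F](\<phi>)" if "i < d" for i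
    using landau_o.big.mult[of _ F "\<lambda>_. 1" _ \<phi>] diff that by fastforce
  thus ?thesis unfolding eq by (intro big_sum_in_bigo) auto
qed

lemma bigo_between:
  fixes a b c :: "'a \<Rightarrow> real"
  assumes "(\<lambda>h. a h - l) \<in> O[F](\<phi>)" "(\<lambda>h. b h - l) \<in> O[F](\<phi>)"
    "\<And>h. min (a h) (b h) \<le> c h" "\<And>h. c h \<le> max (a h) (b h)"
  shows "(\<lambda>h. c h - l) \<in> O[F](\<phi>)"
proof -
  have "(\<lambda>h. \<bar>a h - l\<bar> + \<bar>b h - l\<bar>) \<in> O[F](\<phi>)"
    by (intro sum_in_bigo) (use assms in auto)
  moreover have "\<bar>c h - l\<bar> \<le> \<bar>a h - l\<bar> + \<bar>b h - l\<bar>" for h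
    using assms(3,4)[of h] by linarith
  hence "(\<lambda>h. c h - l) \<in> O[F](\<lambda>h. \<bar>a h - l\<bar> + \<bar>b h - l\<bar>)"
    by (intro landau_o.bigI[of 1]) auto
  ultimately show ?thesis by (rule landau_o.big_trans[rotated])
qed

text \<open>
  In the mean value formula the partial derivatives are taken at points within \<open>O(\<psi>)\<close> of \<open>x0\<close>; as they are Lipschitz,
  freezing them at \<open>x0\<close> costs a further factor \<open>\<psi>\<close>. The coefficients \<open>J\<close> depend only on \<open>x0\<close>, which
  allows errors in different stages to cancel.
\<close>

lemma C_diff_linearisation_bigo:
  assumes g: "C_diff d (Suc (Suc k)) g"
  obtains J where "\<forall>x x' \<phi> \<psi> F.
      (\<forall>i<d. (\<lambda>h. x h i - x0 i) \<in> O[F](\<psi>)) \<longrightarrow> (\<forall>i<d. (\<lambda>h. x' h i - x0 i) \<in> O[F](\<psi>)) \<longrightarrow>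
      (\<forall>i<d. (\<lambda>h. x h i - x' h i) \<in> O[F](\<phi>)) \<longrightarrow> (\<psi> \<longlongrightarrow> 0) F \<longrightarrow>
      (\<lambda>h::real. g (x h) - g (x' h) - (\<Sum>i<d. J i * (x h i - x' h i))) \<in> O[F](\<lambda>h. \<psi> h * \<phi> h)"
proof -
  obtain G where G: "\<And>i. i < d \<Longrightarrow> C_diff d (Suc k) (G i)"
    and der: "\<And>i x. i < d \<Longrightarrow> ((\<lambda>u. g (x(i := u))) has_real_derivative G i x) (at (x i))"
    using C_diff_partials[OF g] by blast
  show ?thesis
  proof (rule that[of "\<lambda>i. G i x0"], intro allI impI)
    fix x x' :: "real \<Rightarrow> nat \<Rightarrow> real" and F :: "real filter" and \<phi> \<psi> :: "real \<Rightarrow> real"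
    assume *: "\<forall>i<d. (\<lambda>h. x h i - x0 i) \<in> O[F](\<psi>)" "\<forall>i<d. (\<lambda>h. x' h i - x0 i) \<in> O[F](\<psi>)"
      "\<forall>i<d. (\<lambda>h. x h i - x' h i) \<in> O[F](\<phi>)" and lim: "(\<psi> \<longlongrightarrow> 0) F"
    note x = *(1)[rule_format] and x' = *(2)[rule_format] and diff = *(3)[rule_format]
    obtain \<xi> where \<xi>: "\<And>h i j. min (x h j) (x' h j) \<le> \<xi> h i j" "\<And>h i j. \<xi> h i j \<le> max (x h j) (x' h j)"
      and eq: "\<And>h. g (x h) - g (x' h) = (\<Sum>i<d. G i (\<xi> h i) * (x h i - x' h i))"
      using partial_mean_value_family[OF C_diff_depends[OF g] der, of x x'] by blast
    have \<xi>0: "(\<lambda>h. \<xi> h i j - x0 j) \<in> O[F](\<psi>)" if "j < d" for i j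
      by (rule bigo_between[OF x x' \<xi>]) (use that in auto)
    have "\<psi> \<in> o[F](\<lambda>_. 1)" using lim by (intro smalloI_tendsto) auto
    hence "(\<lambda>h. \<xi> h i j - x0 j) \<in> o[F](\<lambda>_. 1)" if "j < d" for i j
      using \<xi>0[OF that] landau_o.big_small_trans by blast
    hence \<xi>lim: "((\<lambda>h. \<xi> h i j) \<longlongrightarrow> x0 j) F" if "j < d" for i j
      using smalloD_tendsto that LIM_zero_cancel by fastforce
    have "(\<lambda>h. G i (\<xi> h i) - G i x0) \<in> O[F](\<psi>)" if "i < d" for i
      by (rule C_diff_diff_bigo[OF G[OF that] \<xi>lim tendsto_const \<xi>0])
    hence "(\<lambda>h. (G i (\<xi> h i) - G i x0) * (x h i - x' h i)) \<in> O[F](\<lambda>h. \<psi> h * \<phi> h)" if "i < d" for i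
      using diff that by (intro landau_o.big.mult) auto
    hence "(\<lambda>h. \<Sum>i<d. (G i (\<xi> h i) - G i x0) * (x h i - x' h i)) \<in> O[F](\<lambda>h. \<psi> h * \<phi> h)"
      by (intro big_sum_in_bigo) auto
    thus "(\<lambda>h. g (x h) - g (x' h) - (\<Sum>i<d. G i x0 * (x h i - x' h i))) \<in> O[F](\<lambda>h. \<psi> h * \<phi> h)"
      unfolding eq by (simp add: left_diff_distrib sum_subtractf)
  qed
qed

text \<open>
  Only partial derivatives are available, so the chain rule is read off the mean value formula.
\<close>

lemma C_diff_chain_rule:
  assumes g: "depends_on_first d g"
    and G: "\<And>i. i < d \<Longrightarrow> C_diff d k (G i)"
    and der: "\<And>i x. i < d \<Longrightarrow> ((\<lambda>u. g (x(i := u))) has_real_derivative G i x) (at (x i))"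
    and x: "\<And>i. i < d \<Longrightarrow> ((\<lambda>h. x h i) has_real_derivative x' i) (at h0 within I)"
  shows "((\<lambda>h. g (x h)) has_real_derivative (\<Sum>i<d. G i (x h0) * x' i)) (at h0 within I)"
proof -
  obtain \<xi> where \<xi>: "\<And>h i j. min (x h j) (x h0 j) \<le> \<xi> h i j" "\<And>h i j. \<xi> h i j \<le> max (x h j) (x h0 j)"
    and eq: "\<And>h. g (x h) - g (x h0) = (\<Sum>i<d. G i (\<xi> h i) * (x h i - x h0 i))"
    using partial_mean_value_family[OF g der, of x "\<lambda>_. x h0"] by blast
  have xlim: "((\<lambda>h. x h j) \<longlongrightarrow> x h0 j) (at h0 within I)" if "j < d" for j
    using DERIV_continuous[OF x[OF that]] by (simp add: continuous_within)
  have "((\<lambda>h. G i (\<xi> h i)) \<longlongrightarrow> G i (x h0)) (at h0 within I)" if "i < d" for i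
    by (rule C_diff_tendsto[OF G[OF that]]) (rule tendsto_between[OF xlim tendsto_const \<xi>])
  moreover have "((\<lambda>h. (x h i - x h0 i) / (h - h0)) \<longlongrightarrow> x' i) (at h0 within I)" if "i < d" for i
    using x[OF that] by (simp add: has_field_derivative_iff)
  ultimately have "((\<lambda>h. \<Sum>i<d. G i (\<xi> h i) * ((x h i - x h0 i) / (h - h0))) \<longlongrightarrow>
      (\<Sum>i<d. G i (x h0) * x' i)) (at h0 within I)"
    by (intro tendsto_sum tendsto_mult) auto
  thus ?thesis unfolding has_field_derivative_iff eq by (simp add: sum_divide_distrib)
qed

section \<open>Functions that are smooth in the step size, uniformly in the starting time\<close>

text \<open>
  For a function \<open>\<phi> t h\<close> of the starting time and the step size, derivatives are taken in \<open>h\<close> only, but all of them are jointly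
  continuous. That is what makes Taylor remainders in \<open>h\<close> uniform in \<open>t\<close>. Derivatives are relative to \<open>I\<close>, since a solution
  is known only to the right of its starting time.
\<close>

primrec step_smooth :: "real set \<Rightarrow> real set \<Rightarrow> nat \<Rightarrow> (real \<Rightarrow> real \<Rightarrow> real) \<Rightarrow> bool" where
  "step_smooth S I 0 \<phi> \<longleftrightarrow> continuous_on (S \<times> I) (\<lambda>p. \<phi> (fst p) (snd p))"
| "step_smooth S I (Suc k) \<phi> \<longleftrightarrow> continuous_on (S \<times> I) (\<lambda>p. \<phi> (fst p) (snd p)) \<and>
     (\<exists>\<phi>'. step_smooth S I k \<phi>' \<and>
        (\<forall>t\<in>S. \<forall>h\<in>I. (\<phi> t has_real_derivative \<phi>' t h) (at h within I)))"

lemma step_smooth_cont: "step_smooth S I k \<phi> \<Longrightarrow> continuous_on (S \<times> I) (\<lambda>p. \<phi> (fst p) (snd p))"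
  by (cases k) auto

lemma step_smoothI:
  assumes "continuous_on (S \<times> I) (\<lambda>p. \<phi> (fst p) (snd p))" "step_smooth S I k \<phi>'"
    "\<And>t h. t \<in> S \<Longrightarrow> h \<in> I \<Longrightarrow> ((\<lambda>h. \<phi> t h) has_real_derivative \<phi>' t h) (at h within I)"
  shows "step_smooth S I (Suc k) \<phi>"
  using assms by auto

lemma step_smoothE:
  assumes "step_smooth S I (Suc k) \<phi>"
  obtains \<phi>' where "step_smooth S I k \<phi>'"
    "\<And>t h. t \<in> S \<Longrightarrow> h \<in> I \<Longrightarrow> ((\<lambda>h. \<phi> t h) has_real_derivative \<phi>' t h) (at h within I)"
  using assms by auto

lemma step_smooth_SucD: "step_smooth S I (Suc k) \<phi> \<Longrightarrow> step_smooth S I k \<phi>"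
proof (induction k arbitrary: \<phi>)
  case (Suc k)
  obtain \<phi>' where "step_smooth S I (Suc k) \<phi>'"
     "\<And>t h. t \<in> S \<Longrightarrow> h \<in> I \<Longrightarrow> ((\<lambda>h. \<phi> t h) has_real_derivative \<phi>' t h) (at h within I)"
    using step_smoothE[OF Suc.prems] by blast
  thus ?case using Suc.IH[of \<phi>'] step_smooth_cont[OF Suc.prems] by (intro step_smoothI) auto
qed auto

lemma step_smooth_const: "continuous_on S c \<Longrightarrow> step_smooth S I k (\<lambda>t h. c t)"
proof (induction k arbitrary: c)
  case 0
  have "continuous_on (S \<times> I) (\<lambda>p. c (fst p))"
    by (rule continuous_on_compose2[OF 0 continuous_on_fst[OF continuous_on_id]]) auto
  thus ?case by simp
next
  case (Suc k)
  show ?case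
  proof (rule step_smoothI)
    show "continuous_on (S \<times> I) (\<lambda>p. c (fst p))"
      by (rule continuous_on_compose2[OF Suc.prems continuous_on_fst[OF continuous_on_id]]) auto
    show "step_smooth S I k (\<lambda>t h. 0)" using Suc.IH[of "\<lambda>_. 0"] by simp
  qed auto
qed

lemma step_smooth_step: "step_smooth S I k (\<lambda>t h. h)"
proof (cases k)
  case (Suc k')
  show ?thesis unfolding Suc
    by (rule step_smoothI[where \<phi>' = "\<lambda>_ _. 1"])
       (auto intro!: continuous_intros step_smooth_const[of S "\<lambda>_. 1"])
qed (auto intro!: continuous_intros)

lemma step_smooth_add:
  "step_smooth S I k \<phi> \<Longrightarrow> step_smooth S I k \<psi> \<Longrightarrow> step_smooth S I k (\<lambda>t h. \<phi> t h + \<psi> t h)"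
proof (induction k arbitrary: \<phi> \<psi>)
  case (Suc k)
  obtain \<phi>' where \<phi>': "step_smooth S I k \<phi>'"
     "\<And>t h. t \<in> S \<Longrightarrow> h \<in> I \<Longrightarrow> ((\<lambda>h. \<phi> t h) has_real_derivative \<phi>' t h) (at h within I)"
    using step_smoothE[OF Suc.prems(1)] by blast
  obtain \<psi>' where \<psi>': "step_smooth S I k \<psi>'"
     "\<And>t h. t \<in> S \<Longrightarrow> h \<in> I \<Longrightarrow> ((\<lambda>h. \<psi> t h) has_real_derivative \<psi>' t h) (at h within I)"
    using step_smoothE[OF Suc.prems(2)] by blast
  show ?case
  proof (rule step_smoothI)
    show "step_smooth S I k (\<lambda>t h. \<phi>' t h + \<psi>' t h)" by (rule Suc.IH) fact+
    show "continuous_on (S \<times> I) (\<lambda>p. \<phi> (fst p) (snd p) + \<psi> (fst p) (snd p))"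
      by (intro continuous_on_add step_smooth_cont[OF Suc.prems(1)] step_smooth_cont[OF Suc.prems(2)])
  qed (rule DERIV_add[OF \<phi>'(2) \<psi>'(2)])
qed (auto intro: continuous_on_add)

lemma step_smooth_mult:
  "step_smooth S I k \<phi> \<Longrightarrow> step_smooth S I k \<psi> \<Longrightarrow> step_smooth S I k (\<lambda>t h. \<phi> t h * \<psi> t h)"
proof (induction k arbitrary: \<phi> \<psi>)
  case (Suc k)
  obtain \<phi>' where \<phi>': "step_smooth S I k \<phi>'"
     "\<And>t h. t \<in> S \<Longrightarrow> h \<in> I \<Longrightarrow> ((\<lambda>h. \<phi> t h) has_real_derivative \<phi>' t h) (at h within I)"
    using step_smoothE[OF Suc.prems(1)] by blast
  obtain \<psi>' where \<psi>': "step_smooth S I k \<psi>'"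
     "\<And>t h. t \<in> S \<Longrightarrow> h \<in> I \<Longrightarrow> ((\<lambda>h. \<psi> t h) has_real_derivative \<psi>' t h) (at h within I)"
    using step_smoothE[OF Suc.prems(2)] by blast
  show ?case
  proof (rule step_smoothI)
    show "step_smooth S I k (\<lambda>t h. \<phi>' t h * \<psi> t h + \<psi>' t h * \<phi> t h)"
      by (intro step_smooth_add Suc.IH) (fact \<phi>'(1) \<psi>'(1) step_smooth_SucD[OF Suc.prems(1)]
          step_smooth_SucD[OF Suc.prems(2)])+
    show "continuous_on (S \<times> I) (\<lambda>p. \<phi> (fst p) (snd p) * \<psi> (fst p) (snd p))"
      by (intro continuous_on_mult step_smooth_cont[OF Suc.prems(1)] step_smooth_cont[OF Suc.prems(2)])
  qed (rule DERIV_mult[OF \<phi>'(2) \<psi>'(2)])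
qed (auto intro: continuous_on_mult)

lemma step_smooth_sum:
  "finite M \<Longrightarrow> (\<And>m. m \<in> M \<Longrightarrow> step_smooth S I k (\<phi> m)) \<Longrightarrow> step_smooth S I k (\<lambda>t h. \<Sum>m\<in>M. \<phi> m t h)"
  by (induction M rule: finite_induct)
     (auto intro: step_smooth_add step_smooth_const[of S "\<lambda>_. 0"])

lemma step_smooth_cmult:
  "step_smooth S I k \<phi> \<Longrightarrow> step_smooth S I k (\<lambda>t h. c * \<phi> t h)"
  by (intro step_smooth_mult step_smooth_const) auto

lemma continuous_on_C_diff_compose:
  assumes "C_diff d k g" "\<And>i. i < d \<Longrightarrow> step_smooth S I n (\<lambda>t h. x t h i)"
  shows "continuous_on (S \<times> I) (\<lambda>p. g (x (fst p) (snd p)))"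
  unfolding continuous_on_def
proof (intro ballI)
  fix p assume p: "p \<in> S \<times> I"
  show "((\<lambda>p. g (x (fst p) (snd p))) \<longlongrightarrow> g (x (fst p) (snd p))) (at p within S \<times> I)"
    by (rule C_diff_tendsto[OF assms(1)])
       (use step_smooth_cont[OF assms(2)] p in \<open>auto simp: continuous_on_def\<close>)
qed

lemma step_smooth_compose:
  "C_diff d k g \<Longrightarrow> (\<And>i. i < d \<Longrightarrow> step_smooth S I k (\<lambda>t h. x t h i)) \<Longrightarrow>
     step_smooth S I k (\<lambda>t h. g (x t h))"
proof (induction k arbitrary: g)
  case 0
  thus ?case using continuous_on_C_diff_compose[of d 0 g S I 0 x] by simp
next
  case (Suc k)
  have cont: "continuous_on (S \<times> I) (\<lambda>p. g (x (fst p) (snd p)))"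
    by (rule continuous_on_C_diff_compose[OF Suc.prems])
  obtain G where G: "\<And>i. i < d \<Longrightarrow> C_diff d k (G i)"
    and der: "\<And>i x. i < d \<Longrightarrow> ((\<lambda>u. g (x(i := u))) has_real_derivative G i x) (at (x i))"
    using C_diff_partials[OF Suc.prems(1)] by blast
  have "\<forall>i. \<exists>\<phi>'. i < d \<longrightarrow> step_smooth S I k \<phi>' \<and>
     (\<forall>t\<in>S. \<forall>h\<in>I. ((\<lambda>h. x t h i) has_real_derivative \<phi>' t h) (at h within I))"
    using Suc.prems(2) by fastforce
  then obtain x' where "\<forall>i. i < d \<longrightarrow> step_smooth S I k (x' i) \<and>
     (\<forall>t\<in>S. \<forall>h\<in>I. ((\<lambda>h. x t h i) has_real_derivative x' i t h) (at h within I))"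
    by (rule choice[THEN exE])
  hence x': "\<And>i. i < d \<Longrightarrow> step_smooth S I k (x' i)"
     "\<And>i t h. i < d \<Longrightarrow> t \<in> S \<Longrightarrow> h \<in> I \<Longrightarrow> ((\<lambda>h. x t h i) has_real_derivative x' i t h) (at h within I)"
    by auto
  show ?case
  proof (rule step_smoothI[OF cont])
    show "step_smooth S I k (\<lambda>t h. \<Sum>i<d. G i (x t h) * x' i t h)"
    proof (rule step_smooth_sum)
      fix i assume "i \<in> {..<d}"
      hence i: "i < d" by simp
      show "step_smooth S I k (\<lambda>t h. G i (x t h) * x' i t h)"
        by (rule step_smooth_mult[OF Suc.IH[OF G[OF i]] x'(1)[OF i]])
           (rule step_smooth_SucD[OF Suc.prems(2)])
    qed simp
    fix t h assume "t \<in> S" "h \<in> I"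
    thus "((\<lambda>h. g (x t h)) has_real_derivative (\<Sum>i<d. G i (x t h) * x' i t h)) (at h within I)"
      by (intro C_diff_chain_rule[OF C_diff_depends[OF Suc.prems(1)] G der] x'(2))
  qed
qed

lemma deriv_bound_imp_power_bound:
  fixes \<phi> \<phi>' :: "real \<Rightarrow> real"
  assumes "l \<le> 0" "0 \<le> u" and h: "h \<in> {l..u}"
    and der: "\<And>h. h \<in> {l..u} \<Longrightarrow> (\<phi> has_real_derivative \<phi>' h) (at h within {l..u})"
    and bound: "\<And>h. h \<in> {l..u} \<Longrightarrow> \<bar>\<phi>' h\<bar> \<le> K * \<bar>h\<bar> ^ p"
  shows "\<bar>\<phi> h - \<phi> 0\<bar> \<le> K * \<bar>h\<bar> ^ Suc p"
proof -
  have K: "K \<ge> 0" if "h \<noteq> 0"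
    using order_trans[OF abs_ge_zero bound[OF h]] that
      zero_le_mult_iff[of K "\<bar>h\<bar> ^ p"] zero_less_power[of "\<bar>h\<bar>" p] by linarith
  have sub: "closed_segment 0 h \<subseteq> {l..u}"
    using assms(1,2) h by (auto simp: closed_segment_eq_real_ivl split: if_splits)
  have "norm (\<phi> h - \<phi> 0) \<le> (K * \<bar>h\<bar> ^ p) * norm (h - 0)"
  proof (cases "h = 0")
    case False
    show ?thesis
    proof (rule field_differentiable_bound[of "closed_segment 0 h"])
      fix z assume z: "z \<in> closed_segment 0 h"
      thus "(\<phi> has_real_derivative \<phi>' z) (at z within closed_segment 0 h)"
        using DERIV_subset[OF der sub] sub by blast
      have "\<bar>z\<bar> \<le> \<bar>h\<bar>" using z by (auto simp: closed_segment_eq_real_ivl split: if_splits)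
      hence "K * \<bar>z\<bar> ^ p \<le> K * \<bar>h\<bar> ^ p" by (intro mult_left_mono power_mono K False) auto
      with bound[of z] z sub show "norm (\<phi>' z) \<le> K * \<bar>h\<bar> ^ p" by fastforce
    qed auto
  qed auto
  thus ?thesis by (simp add: mult_ac)
qed

text \<open>
  Expand the derivative and integrate: each coefficient of \<open>\<phi>\<close> but the constant one is a coefficient of \<open>\<phi>'\<close> divided by
  its index. The coefficients are left unspecified because only their continuity in \<open>t\<close> matters.
\<close>

lemma step_smooth_taylor:
  assumes "compact S" "l \<le> 0" "0 \<le> u" "step_smooth S {l..u} p \<phi>"
  shows "\<exists>\<gamma> K. (\<forall>j. continuous_on S (\<gamma> j)) \<and>
     (\<forall>t\<in>S. \<forall>h\<in>{l..u}. \<bar>\<phi> t h - (\<Sum>j<p. \<gamma> j t * h ^ j)\<bar> \<le> K * \<bar>h\<bar> ^ p)"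
  using assms(4)
proof (induction p arbitrary: \<phi>)
  case 0
  have "compact (S \<times> {l..u})" using assms(1) by (intro compact_Times) auto
  hence "bounded ((\<lambda>p. \<phi> (fst p) (snd p)) ` (S \<times> {l..u}))"
    using 0 by (intro compact_imp_bounded compact_continuous_image) auto
  then obtain K where "\<And>t h. t \<in> S \<Longrightarrow> h \<in> {l..u} \<Longrightarrow> \<bar>\<phi> t h\<bar> \<le> K"
    by (force simp: bounded_iff)
  thus ?case by (intro exI[of _ "\<lambda>_ _. 0"] exI[of _ K]) auto
next
  case (Suc p)
  obtain \<phi>' where \<phi>': "step_smooth S {l..u} p \<phi>'"
     "\<And>t h. t \<in> S \<Longrightarrow> h \<in> {l..u} \<Longrightarrow> ((\<lambda>h. \<phi> t h) has_real_derivative \<phi>' t h) (at h within {l..u})"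
    using step_smoothE[OF Suc.prems] by blast
  from Suc.IH[OF \<phi>'(1)] obtain \<gamma> K where \<gamma>: "\<And>j. continuous_on S (\<gamma> j)"
     "\<And>t h. t \<in> S \<Longrightarrow> h \<in> {l..u} \<Longrightarrow> \<bar>\<phi>' t h - (\<Sum>j<p. \<gamma> j t * h ^ j)\<bar> \<le> K * \<bar>h\<bar> ^ p"
    by blast
  define \<Gamma> where "\<Gamma> j t = (case j of 0 \<Rightarrow> \<phi> t 0 | Suc i \<Rightarrow> \<gamma> i t / real (Suc i))" for j t
  have "continuous_on S (\<Gamma> j)" for j
  proof (cases j)
    case 0
    have "continuous_on S (\<lambda>t. \<phi> (fst (t, 0 :: real)) (snd (t :: real, 0)))"
      by (rule continuous_on_compose2[OF step_smooth_cont[OF Suc.prems], where f = "\<lambda>t. (t, 0)"])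
         (use assms(2,3) in \<open>auto intro!: continuous_intros\<close>)
    thus ?thesis by (simp add: 0 \<Gamma>_def[abs_def])
  next
    case (Suc i)
    show ?thesis unfolding Suc \<Gamma>_def by (simp add: \<gamma>(1) continuous_on_divide)
  qed
  moreover have "\<bar>\<phi> t h - (\<Sum>j<Suc p. \<Gamma> j t * h ^ j)\<bar> \<le> K * \<bar>h\<bar> ^ Suc p"
    if t: "t \<in> S" and h: "h \<in> {l..u}" for t h
  proof -
    define \<psi> where "\<psi> h = \<phi> t h - (\<Sum>j<p. \<gamma> j t / real (Suc j) * h ^ Suc j)" for h
    have "(\<psi> has_real_derivative \<phi>' t h - (\<Sum>j<p. \<gamma> j t * h ^ j)) (at h within {l..u})"
      if "h \<in> {l..u}" for h
    proof -
      have "((\<lambda>h. \<gamma> j t / real (Suc j) * h ^ Suc j) has_real_derivative \<gamma> j t * h ^ j)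
          (at h within {l..u})" for j
        by (rule derivative_eq_intros refl)+ (simp add: field_simps del: of_nat_Suc)
      thus ?thesis unfolding \<psi>_def[abs_def]
        by (intro DERIV_diff \<phi>'(2) t that DERIV_sum)
    qed
    from deriv_bound_imp_power_bound[OF assms(2,3) h this \<gamma>(2)[OF t]]
    have "\<bar>\<psi> h - \<psi> 0\<bar> \<le> K * \<bar>h\<bar> ^ Suc p" by simp
    also have "\<psi> h - \<psi> 0 = \<phi> t h - (\<Sum>j<Suc p. \<Gamma> j t * h ^ j)"
      unfolding sum.lessThan_Suc_shift by (simp add: \<psi>_def \<Gamma>_def del: of_nat_Suc)
    finally show ?thesis .
  qed
  ultimately show ?case by blast
qed

text \<open>
  The constant coefficient is the limit at \<open>0\<close>; cancel it, divide by \<open>h\<close>, and repeat.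
\<close>

lemma poly_bigo_zero:
  fixes a :: "nat \<Rightarrow> real"
  assumes "(\<lambda>h. \<Sum>j<p. a j * h ^ j) \<in> O[at_right 0](\<lambda>h. h ^ p)"
  shows "j < p \<Longrightarrow> a j = 0"
  using assms
proof (induction p arbitrary: a j)
  case (Suc p)
  let ?s = "\<lambda>h. \<Sum>j<Suc p. a j * h ^ j"
  have lim: "(?s \<longlongrightarrow> ?s 0) (at_right 0)"
    by (intro tendsto_intros)
  have "(\<lambda>h::real. h ^ Suc p) \<in> o[at_right 0](\<lambda>_. 1)"
    by (intro smalloI_tendsto) (auto intro!: tendsto_eq_intros)
  with Suc.prems(2) have "?s \<in> o[at_right 0](\<lambda>_. 1)" using landau_o.big_small_trans by blast
  hence "(?s \<longlongrightarrow> 0) (at_right 0)" using smalloD_tendsto by fastforce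
  with lim have "?s 0 = 0" using tendsto_unique trivial_limit_at_right_real by blast
  hence a0: "a 0 = 0" by (simp add: sum.lessThan_Suc_shift del: sum.lessThan_Suc)
  have "?s = (\<lambda>h. h * (\<Sum>j<p. a (Suc j) * h ^ j))"
    unfolding sum.lessThan_Suc_shift a0 by (simp add: sum_distrib_left mult_ac)
  with Suc.prems(2) have "(\<lambda>h. h * (\<Sum>j<p. a (Suc j) * h ^ j)) \<in> O[at_right 0](\<lambda>h. h * h ^ p)"
    by simp
  moreover have "eventually (\<lambda>h::real. h \<noteq> 0) (at_right 0)"
    by (simp add: eventually_at_filter)
  ultimately have "(\<lambda>h. \<Sum>j<p. a (Suc j) * h ^ j) \<in> O[at_right 0](\<lambda>h. h ^ p)"
    by (subst (asm) landau_o.big.mult_cancel_left) auto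
  from Suc.IH[OF _ this] a0 Suc.prems(1) show ?case by (cases j) auto
qed auto

section \<open>Local errors with a moving starting time\<close>

lemma step_smooth_rhs:
  assumes f: "smooth_rhs d f" and k: "k < d" and \<tau>: "step_smooth S I n \<tau>"
    and u: "\<And>j. j < d \<Longrightarrow> step_smooth S I n (\<lambda>t h. u t h j)"
  shows "step_smooth S I n (\<lambda>t h. f (\<tau> t h) (u t h) k)"
proof -
  have "C_diff (Suc d) n (\<lambda>x. f (x 0) (\<lambda>i. x (Suc i)) k)"
    using f k by (auto simp: smooth_rhs_def smooth_def)
  moreover have "step_smooth S I n (\<lambda>t h. case_nat (\<tau> t h) (u t h) i)" if "i < Suc d" for i
    using that \<tau> u by (cases i) auto
  ultimately have "step_smooth S I n (\<lambda>t h. (\<lambda>x. f (x 0) (\<lambda>i. x (Suc i)) k) (case_nat (\<tau> t h) (u t h)))"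
    by (rule step_smooth_compose)
  thus ?thesis by simp
qed

lemma solves_ivp_restart:
  assumes "solves_ivp d f t0 y0 T y" "t0 \<le> t" "t \<le> T"
  shows "solves_ivp d f t (y t) T y"
  using assms unfolding solves_ivp_def
  by (auto intro!: DERIV_subset[of _ _ _ "{t0..T}" "{t..T}"])

lemma solution_continuous:
  assumes "solves_ivp d f t0 y0 T y" "k < d"
  shows "continuous_on {t0..T} (\<lambda>u. y u k)"
  unfolding continuous_on_eq_continuous_within
  using assms DERIV_continuous unfolding solves_ivp_def by blast

text \<open>
  The equation itself yields the regularity: if \<open>y\<close> has \<open>n\<close> derivatives, so has \<open>f t (y t)\<close>, which is its derivative.
\<close>

lemma solution_step_smooth:
  assumes f: "smooth_rhs d f" and y: "solves_ivp d f t0 y0 T y" and "t0 \<le> a" "b + \<tau> \<le> T"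
    and "k < d"
  shows "step_smooth {a..b} {0..\<tau>} n (\<lambda>t h. y (t + h) k)"
  using \<open>k < d\<close>
proof (induction n arbitrary: k)
  case 0
  have "continuous_on ({a..b} \<times> {0..\<tau>}) (\<lambda>p. y (fst p + snd p) k)"
    by (rule continuous_on_compose2[OF solution_continuous[OF y 0]])
       (use assms in \<open>auto intro!: continuous_on_add continuous_on_fst continuous_on_snd continuous_on_id\<close>)
  thus ?case by simp
next
  case (Suc n)
  have time: "step_smooth {a..b} {0..\<tau>} n (\<lambda>t h. t + h)"
    by (rule step_smooth_add[OF step_smooth_const step_smooth_step]) (rule continuous_on_id)
  show ?case
  proof (rule step_smoothI)
    show "continuous_on ({a..b} \<times> {0..\<tau>}) (\<lambda>p. y (fst p + snd p) k)"
      using step_smooth_cont[OF Suc.IH[OF Suc.prems]] .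
    show "step_smooth {a..b} {0..\<tau>} n (\<lambda>t h. f (t + h) (y (t + h)) k)"
      by (rule step_smooth_rhs[OF f Suc.prems time Suc.IH])
    fix t h assume th: "t \<in> {a..b}" "h \<in> {0..\<tau>}"
    hence "t + h \<in> {t0..T}" using assms by auto
    hence "((\<lambda>u. y u k) has_real_derivative f (t + h) (y (t + h)) k) (at (t + h) within {t0..T})"
      using y Suc.prems unfolding solves_ivp_def by blast
    hence "((\<lambda>u. y u k) has_real_derivative f (t + h) (y (t + h)) k)
        (at (t + h) within (\<lambda>h. t + h) ` {0..\<tau>})"
      by (rule DERIV_subset) (use assms th in auto)
    moreover have "((\<lambda>h. t + h) has_real_derivative 1) (at h within {0..\<tau>})"
      by (auto intro!: derivative_eq_intros)
    ultimately have "((\<lambda>u. y u k) \<circ> (\<lambda>h. t + h) has_real_derivative f (t + h) (y (t + h)) k * 1)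
        (at h within {0..\<tau>})"
      by (rule DERIV_image_chain)
    thus "((\<lambda>h. y (t + h) k) has_real_derivative f (t + h) (y (t + h)) k) (at h within {0..\<tau>})"
      by (simp add: o_def)
  qed
qed

lemma rk_stage_step_smooth:
  assumes f: "smooth_rhs d f" and y: "\<And>j. j < d \<Longrightarrow> continuous_on S (\<lambda>t. y t j)"
    and "k < d"
  shows "step_smooth S I n (\<lambda>t h. rk_stage A f t (y t) h i k)"
  using \<open>k < d\<close>
proof (induction i arbitrary: k rule: less_induct)
  case (less i)
  have time: "step_smooth S I n (\<lambda>t h. t + nodes A $ i * h)"
    by (rule step_smooth_add[OF step_smooth_const step_smooth_cmult[OF step_smooth_step]])
       (rule continuous_on_id)
  have "step_smooth S I n (\<lambda>t h. y t k + h * (\<Sum>j<i. A $$ (i, j) * rk_stage A f t (y t) h j k))"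
    if "k < d" for k
    by (rule step_smooth_add[OF step_smooth_const[OF y[OF that]]
          step_smooth_mult[OF step_smooth_step step_smooth_sum]])
       (auto intro!: step_smooth_cmult less.IH that)
  from step_smooth_rhs[OF f less.prems time this]
  have "step_smooth S I n (\<lambda>t h. f (t + nodes A $ i * h)
       (\<lambda>k. y t k + h * (\<Sum>j<i. A $$ (i, j) * rk_stage A f t (y t) h j k)) k)" .
  thus ?case unfolding rk_stage.simps[of A f _ _ _ i] .
qed

lemma local_error_step_smooth:
  assumes f: "smooth_rhs d f" and y: "solves_ivp d f t0 y0 T y" and "t0 \<le> a" "b + \<tau> \<le> T" "0 \<le> \<tau>"
    and "k < d"
  shows "step_smooth {a..b} {0..\<tau>} n (\<lambda>t h. y (t + h) k - rk_step A w f t (y t) h k)"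
proof -
  have cont: "continuous_on {a..b} (\<lambda>t. y t j)" if "j < d" for j
    by (rule continuous_on_subset[OF solution_continuous[OF y that]]) (use assms in auto)
  have "step_smooth {a..b} {0..\<tau>} n (\<lambda>t h. h * (\<Sum>i<dim_vec w. w $ i * rk_stage A f t (y t) h i k))"
    by (rule step_smooth_mult[OF step_smooth_step step_smooth_sum])
       (auto intro!: step_smooth_cmult rk_stage_step_smooth[OF f cont \<open>k < d\<close>])
  from step_smooth_add[OF step_smooth_const[OF cont[OF \<open>k < d\<close>]] this]
  have "step_smooth {a..b} {0..\<tau>} n (\<lambda>t h. rk_step A w f t (y t) h k)"
    by (simp add: rk_step_def)
  from step_smooth_add[OF solution_step_smooth[OF f y] step_smooth_cmult[OF this, of "-1"]] assms
  show ?thesis by simp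
qed

lemma bigo_power_mono: "m \<le> n \<Longrightarrow> (\<lambda>h::real. h ^ n) \<in> O[at_right 0](\<lambda>h. h ^ m)"
proof (rule landau_o.bigI[of 1])
  assume "m \<le> n"
  have "0 < (1::real)" by simp
  from eventually_at_right_real[OF this]
  show "\<forall>\<^sub>F h in at_right (0::real). norm (h ^ n) \<le> 1 * norm (h ^ m)"
    by eventually_elim (use \<open>m \<le> n\<close> in \<open>auto intro: power_decreasing\<close>)
qed simp

lemma bigo_power_trans: "f \<in> O[at_right 0](\<lambda>h::real. h ^ n) \<Longrightarrow> m \<le> n \<Longrightarrow> f \<in> O[at_right 0](\<lambda>h. h ^ m)"
  using bigo_power_mono landau_o.big_trans by blast

lemma rk_order_mono:
  assumes "rk_order A b p" "q \<le> p"
  shows "rk_order A b q"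
  unfolding rk_order_def
proof (intro allI impI, elim conjE)
  fix d f t0 y0 T y k
  assume "smooth_rhs d f" "t0 < T" "solves_ivp d f t0 y0 T y" "k < d"
  hence "(\<lambda>h. y (t0 + h) k - rk_step A b f t0 y0 h k) \<in> O[at_right 0](\<lambda>h. h ^ (p + 1))"
    using assms(1) unfolding rk_order_def by blast
  thus "(\<lambda>h. y (t0 + h) k - rk_step A b f t0 y0 h k) \<in> O[at_right 0](\<lambda>h. h ^ (q + 1))"
    by (rule bigo_power_trans) (use assms(2) in simp)
qed

text \<open>
  At each starting time \<open>t\<close> near \<open>t0\<close> the solution solves an initial value problem of its own, so order \<open>p\<close> annihilates the
  coefficients of \<open>h\<^sup>j\<close> with \<open>j \<le> p\<close> for all these \<open>t\<close>, while the remainder is bounded by compactness.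
  Half of the time interval is used for starting times, the other half for steps.
\<close>

lemma local_error_expansion:
  assumes order: "rk_order A w p" and f: "smooth_rhs d f" and y: "solves_ivp d f t0 y0 T y"
    and "t0 < T" and "k < d" and "p + 1 \<le> q"
  obtains \<gamma> K \<tau> where "\<tau> > 0" "\<forall>j. continuous_on {t0..t0 + \<tau>} (\<gamma> j)"
    "\<forall>t\<in>{t0..t0 + \<tau>}. \<forall>j<p+1. \<gamma> j t = 0"
    "\<forall>t\<in>{t0..t0 + \<tau>}. \<forall>h\<in>{0..\<tau>}.
       \<bar>y (t + h) k - rk_step A w f t (y t) h k - (\<Sum>j<q. \<gamma> j t * h ^ j)\<bar> \<le> K * \<bar>h\<bar> ^ q"
proof -
  define \<tau> where "\<tau> = (T - t0) / 2"
  have \<tau>: "\<tau> > 0" "t0 + \<tau> + \<tau> \<le> T" using \<open>t0 < T\<close> by (auto simp: \<tau>_def)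
  define \<phi> where "\<phi> t h = y (t + h) k - rk_step A w f t (y t) h k" for t h
  have "step_smooth {t0..t0 + \<tau>} {0..\<tau>} q \<phi>" unfolding \<phi>_def[abs_def]
    by (rule local_error_step_smooth[OF f y]) (use \<tau> \<open>k < d\<close> in auto)
  from step_smooth_taylor[OF compact_Icc order_refl less_imp_le[OF \<tau>(1)] this]
  obtain \<gamma> K where cont: "\<forall>j. continuous_on {t0..t0 + \<tau>} (\<gamma> j)"
    and bound: "\<forall>t\<in>{t0..t0 + \<tau>}. \<forall>h\<in>{0..\<tau>}. \<bar>\<phi> t h - (\<Sum>j<q. \<gamma> j t * h ^ j)\<bar> \<le> K * \<bar>h\<bar> ^ q"
    by blast
  have "\<gamma> j t = 0" if t: "t \<in> {t0..t0 + \<tau>}" and j: "j < p + 1" for j t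
  proof -
    have "(\<lambda>h. \<phi> t h - (\<Sum>j<q. \<gamma> j t * h ^ j)) \<in> O[at_right 0](\<lambda>h. h ^ q)"
    proof (rule landau_o.bigI[of "\<bar>K\<bar> + 1"])
      show "\<forall>\<^sub>F h in at_right 0. norm (\<phi> t h - (\<Sum>j<q. \<gamma> j t * h ^ j)) \<le> (\<bar>K\<bar> + 1) * norm (h ^ q)"
        using eventually_at_right_real[OF \<tau>(1)]
      proof eventually_elim
        case (elim h)
        hence "norm (\<phi> t h - (\<Sum>j<q. \<gamma> j t * h ^ j)) \<le> K * \<bar>h\<bar> ^ q"
          using bound t by auto
        also have "\<dots> \<le> (\<bar>K\<bar> + 1) * \<bar>h\<bar> ^ q" by (intro mult_right_mono) auto
        finally show ?case by (simp add: power_abs)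
      qed
    qed auto
    hence "(\<lambda>h. \<phi> t h - (\<Sum>j<q. \<gamma> j t * h ^ j)) \<in> O[at_right 0](\<lambda>h. h ^ (p + 1))"
      using bigo_power_trans assms(6) by blast
    moreover have "\<phi> t \<in> O[at_right 0](\<lambda>h. h ^ (p + 1))"
    proof -
      have "solves_ivp d f t (y t) T y" "t < T"
        using solves_ivp_restart[OF y] t \<tau> by auto
      thus ?thesis using order f \<open>k < d\<close> unfolding rk_order_def \<phi>_def[abs_def] by blast
    qed
    ultimately have "(\<lambda>h. \<phi> t h - (\<phi> t h - (\<Sum>j<q. \<gamma> j t * h ^ j))) \<in> O[at_right 0](\<lambda>h. h ^ (p + 1))"
      by (rule sum_in_bigo(2)[rotated])
    hence *: "(\<lambda>h. \<Sum>j<q. \<gamma> j t * h ^ j) \<in> O[at_right 0](\<lambda>h. h ^ (p + 1))" by simp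
    have rest: "(\<lambda>h. \<Sum>j=p+1..<q. \<gamma> j t * h ^ j) \<in> O[at_right 0](\<lambda>h. h ^ (p + 1))"
      by (intro big_sum_in_bigo) (use bigo_power_mono[of "p + 1"] in \<open>auto simp del: power_Suc\<close>)
    have "(\<Sum>j<q. \<gamma> j t * h ^ j) - (\<Sum>j=p+1..<q. \<gamma> j t * h ^ j) = (\<Sum>j<p+1. \<gamma> j t * h ^ j)" for h
      using sum.atLeastLessThan_concat[of 0 "p + 1" q "\<lambda>j. \<gamma> j t * h ^ j"] assms(6)
      unfolding lessThan_atLeast0 by linarith
    with sum_in_bigo(2)[OF * rest]
    have "(\<lambda>h. \<Sum>j<p+1. \<gamma> j t * h ^ j) \<in> O[at_right 0](\<lambda>h. h ^ (p + 1))" by (simp only:)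
    from poly_bigo_zero[OF this j] show ?thesis .
  qed
  hence "\<forall>t\<in>{t0..t0 + \<tau>}. \<forall>j<p+1. \<gamma> j t = 0" by blast
  from that[OF \<tau>(1) cont this bound[unfolded \<phi>_def]] show ?thesis .
qed

text \<open>
  This is the form in which order is applied below: the starting time may depend on the step size.
\<close>

lemma rk_order_moving_start:
  assumes order: "rk_order A w p" and f: "smooth_rhs d f" and y: "solves_ivp d f t0 y0 T y"
    and "t0 < T" and "k < d"
    and \<theta>: "(\<theta> \<longlongrightarrow> t0) (at_right 0)" "\<forall>\<^sub>F h in at_right 0. \<theta> h \<ge> t0"
  shows "(\<lambda>h. y (\<theta> h + h) k - rk_step A w f (\<theta> h) (y (\<theta> h)) h k) \<in> O[at_right 0](\<lambda>h. h ^ (p + 1))"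
proof -
  obtain \<gamma> K \<tau> where *: "\<tau> > 0" "\<forall>j. continuous_on {t0..t0 + \<tau>} (\<gamma> j)"
    "\<forall>t\<in>{t0..t0 + \<tau>}. \<forall>j<p+1. \<gamma> j t = 0"
    "\<forall>t\<in>{t0..t0 + \<tau>}. \<forall>h\<in>{0..\<tau>}.
       \<bar>y (t + h) k - rk_step A w f t (y t) h k - (\<Sum>j<p+1. \<gamma> j t * h ^ j)\<bar> \<le> K * \<bar>h\<bar> ^ (p+1)"
    by (rule local_error_expansion[OF order f y \<open>t0 < T\<close> \<open>k < d\<close> order_refl])
  have "\<forall>\<^sub>F h in at_right 0. \<theta> h < t0 + \<tau>"
    using order_tendstoD(2)[OF \<theta>(1)] *(1) by simp
  hence "\<forall>\<^sub>F h in at_right 0. norm (y (\<theta> h + h) k - rk_step A w f (\<theta> h) (y (\<theta> h)) h k) \<le>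
     (\<bar>K\<bar> + 1) * norm (h ^ (p + 1))"
    using \<theta>(2) eventually_at_right_real[OF *(1)]
  proof eventually_elim
    case (elim h)
    hence "(\<Sum>j<p+1. \<gamma> j (\<theta> h) * h ^ j) = 0"
      by (intro sum.neutral) (use *(3) in auto)
    moreover have "\<theta> h \<in> {t0..t0 + \<tau>}" "h \<in> {0..\<tau>}" using elim by auto
    note *(4)[rule_format, OF this]
    ultimately have "norm (y (\<theta> h + h) k - rk_step A w f (\<theta> h) (y (\<theta> h)) h k) \<le> K * \<bar>h\<bar> ^ (p+1)"
      by simp
    also have "\<dots> \<le> (\<bar>K\<bar> + 1) * \<bar>h\<bar> ^ (p + 1)" by (intro mult_right_mono) auto
    finally show ?case by (simp add: power_abs abs_mult)
  qed
  thus ?thesis by (intro landau_o.bigI[of "\<bar>K\<bar> + 1"]) auto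
qed

text \<open>
  A bound for the steps that start at \<open>t0 + h\<close> transfers to those that start at \<open>t0\<close>: the leading coefficient is
  continuous in the starting time, and it tends to \<open>0\<close> along \<open>t0 + h\<close>.
\<close>

lemma local_error_order_by_continuity:
  assumes order: "rk_order A w p" and f: "smooth_rhs d f" and y: "solves_ivp d f t0 y0 T y"
    and "t0 < T" and "k < d"
    and shifted: "(\<lambda>h. y (t0 + h + h) k - rk_step A w f (t0 + h) (y (t0 + h)) h k)
       \<in> O[at_right 0](\<lambda>h. h ^ (p + 2))"
  shows "(\<lambda>h. y (t0 + h) k - rk_step A w f t0 (y t0) h k) \<in> O[at_right 0](\<lambda>h. h ^ (p + 2))"
proof -
  obtain \<gamma> K \<tau> where *: "\<tau> > 0" "\<forall>j. continuous_on {t0..t0 + \<tau>} (\<gamma> j)"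
    "\<forall>t\<in>{t0..t0 + \<tau>}. \<forall>j<p+1. \<gamma> j t = 0"
    "\<forall>t\<in>{t0..t0 + \<tau>}. \<forall>h\<in>{0..\<tau>}.
       \<bar>y (t + h) k - rk_step A w f t (y t) h k - (\<Sum>j<p+2. \<gamma> j t * h ^ j)\<bar> \<le> K * \<bar>h\<bar> ^ (p+2)"
    by (rule local_error_expansion[OF order f y \<open>t0 < T\<close> \<open>k < d\<close>, of "p + 2"]) simp
  define \<phi> where "\<phi> t h = y (t + h) k - rk_step A w f t (y t) h k" for t h
  have expand: "(\<lambda>h. \<phi> (\<theta> h) h - \<gamma> (p + 1) (\<theta> h) * h ^ (p + 1)) \<in> O[at_right 0](\<lambda>h. h ^ (p + 2))"
    if \<theta>: "\<forall>\<^sub>F h in at_right 0. \<theta> h \<in> {t0..t0 + \<tau>}" for \<theta>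
  proof -
    have "\<forall>\<^sub>F h in at_right 0. norm (\<phi> (\<theta> h) h - \<gamma> (p + 1) (\<theta> h) * h ^ (p + 1)) \<le>
       (\<bar>K\<bar> + 1) * norm (h ^ (p + 2))"
      using \<theta> eventually_at_right_real[OF *(1)]
    proof eventually_elim
      case (elim h)
      have "(\<Sum>j<p+2. \<gamma> j (\<theta> h) * h ^ j) = (\<Sum>j<p+1. \<gamma> j (\<theta> h) * h ^ j) + \<gamma> (p + 1) (\<theta> h) * h ^ (p + 1)"
        by (simp add: numeral_2_eq_2)
      also have "(\<Sum>j<p+1. \<gamma> j (\<theta> h) * h ^ j) = 0"
        by (intro sum.neutral ballI) (use elim *(3) in auto)
      finally have sum: "(\<Sum>j<p+2. \<gamma> j (\<theta> h) * h ^ j) = \<gamma> (p + 1) (\<theta> h) * h ^ (p + 1)" by simp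
      have "\<theta> h \<in> {t0..t0 + \<tau>}" "h \<in> {0..\<tau>}" using elim by auto
      from *(4)[rule_format, OF this]
      have "norm (\<phi> (\<theta> h) h - \<gamma> (p + 1) (\<theta> h) * h ^ (p + 1)) \<le> K * \<bar>h\<bar> ^ (p+2)"
        unfolding sum \<phi>_def real_norm_def .
      also have "\<dots> \<le> (\<bar>K\<bar> + 1) * \<bar>h\<bar> ^ (p + 2)" by (intro mult_right_mono) auto
      finally show ?case by (simp add: power_abs abs_mult)
    qed
    thus ?thesis by (intro landau_o.bigI[of "\<bar>K\<bar> + 1"]) auto
  qed
  have near: "\<forall>\<^sub>F h in at_right 0. t0 + h \<in> {t0..t0 + \<tau>}"
    using eventually_at_right_real[OF *(1)] by eventually_elim auto
  have "(\<lambda>h. \<phi> (t0 + h) h) \<in> O[at_right 0](\<lambda>h. h ^ (p + 2))"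
    using shifted unfolding \<phi>_def .
  from sum_in_bigo(2)[OF this expand[OF near]]
  have "(\<lambda>h. \<gamma> (p + 1) (t0 + h) * h ^ (p + 1)) \<in> O[at_right 0](\<lambda>h. h * h ^ (p + 1))"
    by (simp add: mult.assoc)
  hence "(\<lambda>h. \<gamma> (p + 1) (t0 + h)) \<in> O[at_right 0](\<lambda>h. h)"
    by (subst (asm) landau_o.big.mult_cancel_right) (auto simp: eventually_at_filter)
  moreover have "(\<lambda>h::real. h) \<in> o[at_right 0](\<lambda>_. 1)"
    by (intro smalloI_tendsto) (auto intro!: tendsto_eq_intros)
  ultimately have "(\<lambda>h. \<gamma> (p + 1) (t0 + h)) \<in> o[at_right 0](\<lambda>_. 1)"
    using landau_o.big_small_trans by blast
  hence lim0: "((\<lambda>h. \<gamma> (p + 1) (t0 + h)) \<longlongrightarrow> 0) (at_right 0)"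
    using smalloD_tendsto by fastforce
  have "((\<lambda>h. \<gamma> (p + 1) (t0 + h)) \<longlongrightarrow> \<gamma> (p + 1) t0) (at_right 0)"
  proof (rule continuous_on_tendsto_compose[OF *(2)[rule_format]])
    show "((\<lambda>h. t0 + h) \<longlongrightarrow> t0) (at_right 0)" by (auto intro!: tendsto_eq_intros)
  qed (use near *(1) in auto)
  with lim0 have "\<gamma> (p + 1) t0 = 0"
    using tendsto_unique trivial_limit_at_right_real by blast
  thus ?thesis using expand[of "\<lambda>_. t0"] *(1) unfolding \<phi>_def by simp
qed

section \<open>Perturbation of a single step\<close>

definition vec_bigo :: "nat \<Rightarrow> (real \<Rightarrow> nat \<Rightarrow> real) \<Rightarrow> nat \<Rightarrow> bool" where
  "vec_bigo d u q \<longleftrightarrow> (\<forall>k<d. (\<lambda>h. u h k) \<in> O[at_right 0](\<lambda>h. h ^ q))"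

lemma vec_bigo_add: "vec_bigo d u q \<Longrightarrow> vec_bigo d v q \<Longrightarrow> vec_bigo d (\<lambda>h k. u h k + v h k) q"
  unfolding vec_bigo_def by (auto intro: sum_in_bigo)

lemma vec_bigo_diff: "vec_bigo d u q \<Longrightarrow> vec_bigo d v q \<Longrightarrow> vec_bigo d (\<lambda>h k. u h k - v h k) q"
  unfolding vec_bigo_def by (auto intro: sum_in_bigo)

lemma vec_bigo_cmult: "vec_bigo d u q \<Longrightarrow> vec_bigo d (\<lambda>h k. c * u h k) q"
  unfolding vec_bigo_def by auto

lemma vec_bigo_hmult: "vec_bigo d u q \<Longrightarrow> vec_bigo d (\<lambda>h k. h * u h k) (Suc q)"
  unfolding vec_bigo_def power_Suc by (auto intro!: landau_o.big.mult)

lemma vec_bigo_sum: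
  "(\<And>i. i \<in> I \<Longrightarrow> vec_bigo d (u i) q) \<Longrightarrow> vec_bigo d (\<lambda>h k. \<Sum>i\<in>I. u i h k) q"
  unfolding vec_bigo_def by (auto intro!: big_sum_in_bigo)

lemma vec_bigo_zero: "vec_bigo d (\<lambda>h k. 0) q"
  unfolding vec_bigo_def by auto

lemma vec_bigo_const: "vec_bigo d (\<lambda>h k. c k) 0"
  unfolding vec_bigo_def by auto

lemma vec_bigo_mono: "vec_bigo d u n \<Longrightarrow> m \<le> n \<Longrightarrow> vec_bigo d u m"
  unfolding vec_bigo_def using bigo_power_trans by blast

lemma vec_bigo_cong: "vec_bigo d u q \<Longrightarrow> (\<And>h k. k < d \<Longrightarrow> u h k = v h k) \<Longrightarrow> vec_bigo d v q"
  unfolding vec_bigo_def by auto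

lemma vec_bigo_trans:
  "vec_bigo d (\<lambda>h k. u h k - v h k) q \<Longrightarrow> vec_bigo d (\<lambda>h k. v h k - w h k) q \<Longrightarrow>
     vec_bigo d (\<lambda>h k. u h k - w h k) q"
  by (drule (1) vec_bigo_add) simp

lemma vec_bigo_sym: "vec_bigo d (\<lambda>h k. u h k - v h k) q \<Longrightarrow> vec_bigo d (\<lambda>h k. v h k - u h k) q"
  by (drule vec_bigo_cmult[where c = "-1"]) simp

definition near :: "nat \<Rightarrow> real \<Rightarrow> (nat \<Rightarrow> real) \<Rightarrow> (real \<Rightarrow> real) \<Rightarrow> (real \<Rightarrow> nat \<Rightarrow> real) \<Rightarrow> bool" where
  "near d t0 y0 \<tau> u \<longleftrightarrow> (\<lambda>h. \<tau> h - t0) \<in> O[at_right 0](\<lambda>h. h) \<and> vec_bigo d (\<lambda>h k. u h k - y0 k) 1"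

lemma near_base: "near d t0 y0 (\<lambda>_. t0) (\<lambda>_. y0)"
  by (simp add: near_def vec_bigo_zero)

lemma near_shift:
  assumes "near d t0 y0 \<tau> u" "vec_bigo d v 0"
  shows "near d t0 y0 (\<lambda>h. \<tau> h + c * h) (\<lambda>h k. u h k + h * v h k)"
  unfolding near_def
proof
  have "(\<lambda>h. (\<tau> h - t0) + c * h) \<in> O[at_right 0](\<lambda>h. h)"
    using assms(1) by (intro sum_in_bigo(1)) (auto simp: near_def)
  thus "(\<lambda>h. \<tau> h + c * h - t0) \<in> O[at_right 0](\<lambda>h. h)" by (simp add: algebra_simps)
  have "vec_bigo d (\<lambda>h k. (u h k - y0 k) + h * v h k) 1"
    using vec_bigo_add[of d "\<lambda>h k. u h k - y0 k" 1 "\<lambda>h k. h * v h k"] vec_bigo_hmult[OF assms(2)] assms(1)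
    by (simp add: near_def)
  thus "vec_bigo d (\<lambda>h k. u h k + h * v h k - y0 k) 1" by (simp add: algebra_simps)
qed

lemma near_perturb:
  assumes "near d t0 y0 \<tau> u" "vec_bigo d (\<lambda>h k. v h k - u h k) 1"
  shows "near d t0 y0 \<tau> v"
  using assms vec_bigo_trans[OF assms(2), of "\<lambda>_. y0"] unfolding near_def by simp

lemma bigo_imp_tendsto:
  fixes u :: "real \<Rightarrow> real"
  assumes "(\<lambda>h. u h - l) \<in> O[at_right 0](\<lambda>h. h)"
  shows "(u \<longlongrightarrow> l) (at_right 0)"
proof -
  have "(\<lambda>h::real. h) \<in> o[at_right 0](\<lambda>_. 1)"
    by (intro smalloI_tendsto) (auto intro!: tendsto_eq_intros)
  with assms have "(\<lambda>h. u h - l) \<in> o[at_right 0](\<lambda>_. 1)" using landau_o.big_small_trans by blast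
  thus ?thesis using smalloD_tendsto LIM_zero_cancel by fastforce
qed

lemma rhs_diff:
  assumes f: "smooth_rhs d f" and "near d t0 y0 \<tau> u" "near d t0 y0 \<sigma> v"
    and "(\<lambda>h. \<tau> h - \<sigma> h) \<in> O[at_right 0](\<lambda>h. h ^ q)" "vec_bigo d (\<lambda>h k. u h k - v h k) q"
  shows "vec_bigo d (\<lambda>h k. f (\<tau> h) (u h) k - f (\<sigma> h) (v h) k) q"
  unfolding vec_bigo_def
proof (intro allI impI)
  fix k assume "k < d"
  let ?g = "\<lambda>x. f (x 0) (\<lambda>i. x (Suc i)) k"
  have g: "C_diff (Suc d) (Suc 0) ?g" using f \<open>k < d\<close> unfolding smooth_rhs_def smooth_def by blast
  have "(\<lambda>h. ?g (case_nat (\<tau> h) (u h)) - ?g (case_nat (\<sigma> h) (v h))) \<in> O[at_right 0](\<lambda>h. h ^ q)"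
  proof (rule C_diff_diff_bigo[OF g])
    fix i assume i: "i < Suc d"
    show "((\<lambda>h. case_nat (\<tau> h) (u h) i) \<longlongrightarrow> case_nat t0 y0 i) (at_right 0)"
      using assms(2) i by (cases i) (auto simp: near_def vec_bigo_def intro!: bigo_imp_tendsto)
    show "((\<lambda>h. case_nat (\<sigma> h) (v h) i) \<longlongrightarrow> case_nat t0 y0 i) (at_right 0)"
      using assms(3) i by (cases i) (auto simp: near_def vec_bigo_def intro!: bigo_imp_tendsto)
    show "(\<lambda>h. case_nat (\<tau> h) (u h) i - case_nat (\<sigma> h) (v h) i) \<in> O[at_right 0](\<lambda>h. h ^ q)"
      using assms(4,5) i by (cases i) (auto simp: vec_bigo_def)
  qed
  thus "(\<lambda>h. f (\<tau> h) (u h) k - f (\<sigma> h) (v h) k) \<in> O[at_right 0](\<lambda>h. h ^ q)" by simp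
qed

text \<open>
  \<open>Jt\<close> and \<open>J\<close> are the partial derivatives of \<open>f\<close> in the time and in the state at \<open>(t0, y0)\<close>.
\<close>

lemma rhs_linearisation:
  assumes f: "smooth_rhs d f"
  obtains Jt J where "\<forall>\<tau> \<sigma> u v q. near d t0 y0 \<tau> u \<longrightarrow> near d t0 y0 \<sigma> v \<longrightarrow>
     (\<lambda>h. \<tau> h - \<sigma> h) \<in> O[at_right 0](\<lambda>h. h ^ q) \<longrightarrow> vec_bigo d (\<lambda>h k. u h k - v h k) q \<longrightarrow>
     vec_bigo d (\<lambda>h k. f (\<tau> h) (u h) k - f (\<sigma> h) (v h) k -
        (Jt k * (\<tau> h - \<sigma> h) + (\<Sum>l<d. J k l * (u h l - v h l)))) (Suc q)"
proof -
  define lin where "lin k j \<longleftrightarrow> (\<forall>\<tau> \<sigma> u v q. near d t0 y0 \<tau> u \<longrightarrow> near d t0 y0 \<sigma> v \<longrightarrow>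
     (\<lambda>h. \<tau> h - \<sigma> h) \<in> O[at_right 0](\<lambda>h. h ^ q) \<longrightarrow> vec_bigo d (\<lambda>h k. u h k - v h k) q \<longrightarrow>
     (\<lambda>h. f (\<tau> h) (u h) k - f (\<sigma> h) (v h) k -
        (j 0 * (\<tau> h - \<sigma> h) + (\<Sum>l<d. j (Suc l) * (u h l - v h l)))) \<in> O[at_right 0](\<lambda>h. h ^ Suc q))" for k :: nat and j :: "nat \<Rightarrow> real"
  have "\<exists>j. lin k j" if "k < d" for k
  proof -
    let ?g = "\<lambda>x. f (x 0) (\<lambda>i. x (Suc i)) k"
    have g: "C_diff (Suc d) (Suc (Suc 0)) ?g" using f \<open>k < d\<close> unfolding smooth_rhs_def smooth_def by blast
    obtain j where j: "\<forall>x x' \<phi> \<psi> F.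
      (\<forall>i<Suc d. (\<lambda>h. x h i - case_nat t0 y0 i) \<in> O[F](\<psi>)) \<longrightarrow>
      (\<forall>i<Suc d. (\<lambda>h. x' h i - case_nat t0 y0 i) \<in> O[F](\<psi>)) \<longrightarrow>
      (\<forall>i<Suc d. (\<lambda>h. x h i - x' h i) \<in> O[F](\<phi>)) \<longrightarrow> (\<psi> \<longlongrightarrow> 0) F \<longrightarrow>
      (\<lambda>h::real. ?g (x h) - ?g (x' h) - (\<Sum>i<Suc d. j i * (x h i - x' h i))) \<in> O[F](\<lambda>h. \<psi> h * \<phi> h)"
      by (rule C_diff_linearisation_bigo[OF g])
    have "lin k j" unfolding lin_def
    proof (intro allI impI)
      fix \<tau> \<sigma> :: "real \<Rightarrow> real" and u v :: "real \<Rightarrow> nat \<Rightarrow> real" and q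
      assume *: "near d t0 y0 \<tau> u" "near d t0 y0 \<sigma> v"
        "(\<lambda>h. \<tau> h - \<sigma> h) \<in> O[at_right 0](\<lambda>h. h ^ q)" "vec_bigo d (\<lambda>h k. u h k - v h k) q"
      have "(\<lambda>h. ?g (case_nat (\<tau> h) (u h)) - ?g (case_nat (\<sigma> h) (v h)) -
          (\<Sum>i<Suc d. j i * (case_nat (\<tau> h) (u h) i - case_nat (\<sigma> h) (v h) i))) \<in> O[at_right 0](\<lambda>h. h * h ^ q)"
      proof (rule j[rule_format])
        fix i assume i: "i < Suc d"
        show "(\<lambda>h. case_nat (\<tau> h) (u h) i - case_nat t0 y0 i) \<in> O[at_right 0](\<lambda>h. h)"
          using *(1) i by (cases i) (auto simp: near_def vec_bigo_def)
        show "(\<lambda>h. case_nat (\<sigma> h) (v h) i - case_nat t0 y0 i) \<in> O[at_right 0](\<lambda>h. h)"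
          using *(2) i by (cases i) (auto simp: near_def vec_bigo_def)
        show "(\<lambda>h. case_nat (\<tau> h) (u h) i - case_nat (\<sigma> h) (v h) i) \<in> O[at_right 0](\<lambda>h. h ^ q)"
          using *(3,4) i by (cases i) (auto simp: vec_bigo_def)
      qed (auto intro!: tendsto_eq_intros)
      thus "(\<lambda>h. f (\<tau> h) (u h) k - f (\<sigma> h) (v h) k -
        (j 0 * (\<tau> h - \<sigma> h) + (\<Sum>l<d. j (Suc l) * (u h l - v h l)))) \<in> O[at_right 0](\<lambda>h. h ^ Suc q)"
        unfolding sum.lessThan_Suc_shift by simp
    qed
    thus ?thesis by blast
  qed
  hence "\<forall>k. \<exists>j. k < d \<longrightarrow> lin k j" by blast
  then obtain j where j: "\<forall>k. k < d \<longrightarrow> lin k (j k)" by (rule choice[THEN exE])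
  show ?thesis
  proof (rule that[of "\<lambda>k. j k 0" "\<lambda>k l. j k (Suc l)"], intro allI impI)
    fix \<tau> \<sigma> :: "real \<Rightarrow> real" and u v :: "real \<Rightarrow> nat \<Rightarrow> real" and q
    assume *: "near d t0 y0 \<tau> u" "near d t0 y0 \<sigma> v"
      "(\<lambda>h. \<tau> h - \<sigma> h) \<in> O[at_right 0](\<lambda>h. h ^ q)" "vec_bigo d (\<lambda>h k. u h k - v h k) q"
    show "vec_bigo d (\<lambda>h k. f (\<tau> h) (u h) k - f (\<sigma> h) (v h) k -
        (j k 0 * (\<tau> h - \<sigma> h) + (\<Sum>l<d. j k (Suc l) * (u h l - v h l)))) (Suc q)"
      unfolding vec_bigo_def
    proof (intro allI impI)
      fix k assume "k < d"
      hence "lin k (j k)" using j by blast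
      from this[unfolded lin_def, rule_format, OF *]
      show "(\<lambda>h. f (\<tau> h) (u h) k - f (\<sigma> h) (v h) k -
        (j k 0 * (\<tau> h - \<sigma> h) + (\<Sum>l<d. j k (Suc l) * (u h l - v h l)))) \<in> O[at_right 0](\<lambda>h. h ^ Suc q)" .
    qed
  qed
qed

lemma rhs_bounded:
  assumes f: "smooth_rhs d f" and "near d t0 y0 \<tau> u"
  shows "vec_bigo d (\<lambda>h. f (\<tau> h) (u h)) 0"
proof -
  have "vec_bigo d (\<lambda>h k. f (\<tau> h) (u h) k - f t0 y0 k) 1"
    by (rule rhs_diff[OF f assms(2) near_base]) (use assms(2) in \<open>auto simp: near_def\<close>)
  from vec_bigo_add[OF vec_bigo_mono[OF this] vec_bigo_const[of d "f t0 y0"]]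
  show ?thesis by simp
qed

text \<open>
  The stages and the update of one step whose first stage is the prescribed vector \<open>g\<close>. Taking
  \<open>g = f t y\<close> gives a plain Runge--Kutta step if the first node is \<open>0\<close>.
\<close>

fun restart_stage ::
  "real mat \<Rightarrow> (real \<Rightarrow> (nat \<Rightarrow> real) \<Rightarrow> (nat \<Rightarrow> real)) \<Rightarrow> real \<Rightarrow> (nat \<Rightarrow> real) \<Rightarrow> (nat \<Rightarrow> real) \<Rightarrow> real
    \<Rightarrow> nat \<Rightarrow> (nat \<Rightarrow> real)" where
  "restart_stage A f t y g h i =
     (if i = 0 then g
      else f (t + nodes A $ i * h)
        (\<lambda>k. y k + h * (\<Sum>j<i. A $$ (i, j) * restart_stage A f t y g h j k)))"

declare restart_stage.simps [simp del]

definition restart_step ::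
  "real mat \<Rightarrow> real vec \<Rightarrow> (real \<Rightarrow> (nat \<Rightarrow> real) \<Rightarrow> (nat \<Rightarrow> real)) \<Rightarrow> real \<Rightarrow> (nat \<Rightarrow> real) \<Rightarrow> (nat \<Rightarrow> real)
    \<Rightarrow> real \<Rightarrow> (nat \<Rightarrow> real)" where
  "restart_step A w f t y g h =
     (\<lambda>k. y k + h * (\<Sum>i<dim_vec w. w $ i * restart_stage A f t y g h i k))"

lemma restart_stage_0: "restart_stage A f t y g h 0 = g"
  by (simp add: restart_stage.simps)

lemma rk_stage_eq_restart_stage:
  assumes "nodes A $ 0 = 0"
  shows "rk_stage A f t y h i = restart_stage A f t y (f t y) h i"
proof (induction i rule: less_induct)
  case (less i)
  show ?case
    by (subst rk_stage.simps, subst restart_stage.simps) (use less assms in auto)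
qed

lemma rk_step_eq_restart_step:
  assumes "nodes A $ 0 = 0"
  shows "rk_step A w f t y h = restart_step A w f t y (f t y) h"
  unfolding rk_step_def restart_step_def rk_stage_eq_restart_stage[OF assms] ..

lemma stage_bounded:
  assumes f: "smooth_rhs d f" and "near d t0 y0 \<tau> y" and g: "vec_bigo d g 0"
  shows "vec_bigo d (\<lambda>h. restart_stage A f (\<tau> h) (y h) (g h) h i) 0"
proof (induction i rule: less_induct)
  case (less i)
  show ?case
  proof (cases "i = 0")
    case False
    have "vec_bigo d (\<lambda>h k. \<Sum>j<i. A $$ (i, j) * restart_stage A f (\<tau> h) (y h) (g h) h j k) 0"
      by (intro vec_bigo_sum vec_bigo_cmult less.IH) auto
    from rhs_bounded[OF f near_shift[OF assms(2) this]] show ?thesis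
      unfolding restart_stage.simps[of A f _ _ _ _ i] using False by simp
  qed (simp add: restart_stage_0 g)
qed

lemma stage_argument_near:
  assumes f: "smooth_rhs d f" and "near d t0 y0 \<tau> y" and g: "vec_bigo d g 0"
  shows "near d t0 y0 (\<lambda>h. \<tau> h + c * h)
     (\<lambda>h k. y h k + h * (\<Sum>j\<in>M. w j * restart_stage A f (\<tau> h) (y h) (g h) h j k))"
  by (intro near_shift assms(2) vec_bigo_sum vec_bigo_cmult stage_bounded[OF f assms(2) g])

text \<open>
  The first stage enters the later ones only with a factor \<open>h\<close>, so the hypothesis on \<open>g - g'\<close> carries this factor
  and a first stage that is worse by one power of \<open>h\<close> does no harm.
\<close>

lemma stage_diff:
  assumes f: "smooth_rhs d f" and y: "near d t0 y0 \<tau> y" and y': "near d t0 y0 \<tau> y'"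
    and g: "vec_bigo d g 0" and g': "vec_bigo d g' 0"
    and dy: "vec_bigo d (\<lambda>h k. y h k - y' h k) q" and dg: "vec_bigo d (\<lambda>h k. h * (g h k - g' h k)) q"
    and "i > 0"
  shows "vec_bigo d (\<lambda>h k. restart_stage A f (\<tau> h) (y h) (g h) h i k
           - restart_stage A f (\<tau> h) (y' h) (g' h) h i k) q"
  using \<open>i > 0\<close>
proof (induction i rule: less_induct)
  case (less i)
  let ?F = "\<lambda>h. restart_stage A f (\<tau> h) (y h) (g h) h" and ?F' = "\<lambda>h. restart_stage A f (\<tau> h) (y' h) (g' h) h"
  have "vec_bigo d (\<lambda>h k. h * (?F h j k - ?F' h j k)) q" if "j < i" for j
  proof (cases "j = 0")
    case False
    with less.IH[OF that] show ?thesis by (intro vec_bigo_mono[OF vec_bigo_hmult]) auto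
  qed (simp add: restart_stage_0 dg)
  hence "vec_bigo d (\<lambda>h k. (y h k - y' h k) + (\<Sum>j<i. A $$ (i, j) * (h * (?F h j k - ?F' h j k)))) q"
    by (intro vec_bigo_add dy vec_bigo_sum vec_bigo_cmult) auto
  hence *: "vec_bigo d (\<lambda>h k. (y h k + h * (\<Sum>j<i. A $$ (i, j) * ?F h j k)) -
      (y' h k + h * (\<Sum>j<i. A $$ (i, j) * ?F' h j k))) q"
    by (rule vec_bigo_cong) (simp add: sum_distrib_left right_diff_distrib sum_subtractf mult_ac)
  from rhs_diff[OF f stage_argument_near[OF f y g] stage_argument_near[OF f y' g'] _ this] less.prems
  show ?case unfolding restart_stage.simps[of A f _ _ _ _ i] by simp
qed

lemma restart_step_diff_expand:
  "restart_step A w f t y g h k - restart_step A w f t y' g' h k - (y k - y' k) =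
     (\<Sum>i<dim_vec w. w $ i * (h * (restart_stage A f t y g h i k - restart_stage A f t y' g' h i k)))"
  by (simp add: restart_step_def sum_distrib_left right_diff_distrib sum_subtractf mult_ac)

text \<open>
  A perturbation of the starting value is carried over unchanged up to one further power of \<open>h\<close>. The argument that
  compares composed methods needs this precise form, because there the perturbation itself is the unknown.
\<close>

lemma restart_step_diff:
  assumes f: "smooth_rhs d f" and y: "near d t0 y0 \<tau> y" and y': "near d t0 y0 \<tau> y'"
    and g: "vec_bigo d g 0" and g': "vec_bigo d g' 0"
    and dy: "vec_bigo d (\<lambda>h k. y h k - y' h k) q" and dg: "vec_bigo d (\<lambda>h k. g h k - g' h k) q"
  shows "vec_bigo d (\<lambda>h k. restart_step A w f (\<tau> h) (y h) (g h) h k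
     - restart_step A w f (\<tau> h) (y' h) (g' h) h k - (y h k - y' h k)) (Suc q)"
  unfolding restart_step_diff_expand
proof (intro vec_bigo_sum vec_bigo_cmult vec_bigo_hmult)
  fix i
  show "vec_bigo d (\<lambda>h k. restart_stage A f (\<tau> h) (y h) (g h) h i k
           - restart_stage A f (\<tau> h) (y' h) (g' h) h i k) q"
  proof (cases "i = 0")
    case False
    thus ?thesis
      by (intro stage_diff[OF f y y' g g' dy] vec_bigo_mono[OF vec_bigo_hmult[OF dg]]) auto
  qed (simp add: restart_stage_0 dg)
qed

text \<open>
  The coefficient conditions under which an error in the first stage enters the update with weights \<open>w\<close> with a
  factor \<open>h\<^sup>m\<close>.
\<close>

definition first_stage_influence :: "real mat \<Rightarrow> real vec \<Rightarrow> nat \<Rightarrow> bool" where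
  "first_stage_influence A w m \<longleftrightarrow> m = 1 \<or> (m = 2 \<and> w $ 0 = 0) \<or>
     (m = 3 \<and> w $ 0 = 0 \<and> (\<Sum>i<dim_vec w. w $ i * A $$ (i, 0)) = 0)"

text \<open>
  The later stages depend on the first one through \<open>h a\<^bsub>i1\<^esub> g\<close>, to first order with the fixed Jacobian \<open>J\<close>. So the update
  with weights \<open>w\<close> depends on \<open>g\<close> through \<open>h w\<^sub>1 g + h\<^sup>2 (w\<^sup>T A)\<^sub>1 J g\<close>, up to terms of size \<open>h\<^sup>3 g\<close>.
\<close>

lemma restart_step_first_stage_diff:
  assumes f: "smooth_rhs d f" and y: "near d t0 y0 \<tau> y"
    and g: "vec_bigo d g 0" and g': "vec_bigo d g' 0"
    and dg: "vec_bigo d (\<lambda>h k. g h k - g' h k) q" and m: "first_stage_influence A w m"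
  shows "vec_bigo d (\<lambda>h k. restart_step A w f (\<tau> h) (y h) (g h) h k
     - restart_step A w f (\<tau> h) (y h) (g' h) h k) (m + q)"
proof -
  let ?F = "\<lambda>h. restart_stage A f (\<tau> h) (y h) (g h) h" and ?F' = "\<lambda>h. restart_stage A f (\<tau> h) (y h) (g' h) h"
  have expand: "restart_step A w f (\<tau> h) (y h) (g h) h k - restart_step A w f (\<tau> h) (y h) (g' h) h k =
     (\<Sum>i<dim_vec w. w $ i * (h * (?F h i k - ?F' h i k)))" for h k
    using restart_step_diff_expand[of A w f "\<tau> h" "y h" "g h" h k "y h" "g' h"] by simp
  have dy: "vec_bigo d (\<lambda>h k. y h k - y h k) n" for n by (simp add: vec_bigo_zero)
  have dF: "vec_bigo d (\<lambda>h k. ?F h i k - ?F' h i k) (Suc q)" if "i > 0" for i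
    by (rule stage_diff[OF f y y g g' dy vec_bigo_hmult[OF dg] that])
  have m2: "vec_bigo d (\<lambda>h k. w $ i * (h * (?F h i k - ?F' h i k))) (2 + q)" if "w $ 0 = 0" for i
  proof (cases "i = 0")
    case False
    thus ?thesis using vec_bigo_cmult[OF vec_bigo_hmult[OF dF[of i]]] by simp
  qed (simp add: that vec_bigo_zero)
  consider "m = 1" | "m = 2" "w $ 0 = 0" | "m = 3" "w $ 0 = 0" "(\<Sum>i<dim_vec w. w $ i * A $$ (i, 0)) = 0"
    using m unfolding first_stage_influence_def by blast
  thus ?thesis
  proof cases
    case 1
    with restart_step_diff[OF f y y g g' dy dg] show ?thesis by simp
  next
    case 2
    show ?thesis unfolding expand \<open>m = 2\<close> by (intro vec_bigo_sum m2 2)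
  next
    case 3
    obtain Jt J where J: "\<forall>\<tau> \<sigma> u v q. near d t0 y0 \<tau> u \<longrightarrow> near d t0 y0 \<sigma> v \<longrightarrow>
     (\<lambda>h. \<tau> h - \<sigma> h) \<in> O[at_right 0](\<lambda>h. h ^ q) \<longrightarrow> vec_bigo d (\<lambda>h k. u h k - v h k) q \<longrightarrow>
     vec_bigo d (\<lambda>h k. f (\<tau> h) (u h) k - f (\<sigma> h) (v h) k -
        (Jt k * (\<tau> h - \<sigma> h) + (\<Sum>l<d. J k l * (u h l - v h l)))) (Suc q)"
      by (rule rhs_linearisation[OF f, of t0 y0])
    define e where "e h k = (\<Sum>l<d. J k l * (g h l - g' h l))" for h k
    have lin: "vec_bigo d (\<lambda>h k. ?F h i k - ?F' h i k - h * (A $$ (i, 0) * e h k)) (2 + q)"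
      if "i > 0" for i
    proof -
      define u where "u = (\<lambda>h k. y h k + h * (\<Sum>j<i. A $$ (i, j) * ?F h j k))"
      define u' where "u' = (\<lambda>h k. y h k + h * (\<Sum>j<i. A $$ (i, j) * ?F' h j k))"
      have near_u: "near d t0 y0 (\<lambda>h. \<tau> h + nodes A $ i * h) u"
           "near d t0 y0 (\<lambda>h. \<tau> h + nodes A $ i * h) u'"
        unfolding u_def u'_def by (intro stage_argument_near[OF f y] g g')+
      have split: "u h k - u' h k = h * (A $$ (i, 0) * (g h k - g' h k)) +
           (\<Sum>j\<in>{1..<i}. A $$ (i, j) * (h * (?F h j k - ?F' h j k)))" for h k
      proof -
        have "u h k - u' h k = (\<Sum>j<i. A $$ (i, j) * (h * (?F h j k - ?F' h j k)))"
          by (simp add: u_def u'_def sum_distrib_left right_diff_distrib sum_subtractf mult_ac)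
        also have "{..<i} = insert 0 {1..<i}" using that by auto
        finally show ?thesis by (simp add: restart_stage_0)
      qed
      have u2: "vec_bigo d (\<lambda>h k. u h k - u' h k - h * (A $$ (i, 0) * (g h k - g' h k))) (2 + q)"
      proof -
        have "vec_bigo d (\<lambda>h k. \<Sum>j\<in>{1..<i}. A $$ (i, j) * (h * (?F h j k - ?F' h j k))) (Suc (Suc q))"
          by (intro vec_bigo_sum vec_bigo_cmult vec_bigo_hmult dF) simp
        thus ?thesis unfolding split by simp
      qed
      have "vec_bigo d (\<lambda>h k. h * (A $$ (i, 0) * (g h k - g' h k))) (Suc q)"
        by (intro vec_bigo_hmult vec_bigo_cmult dg)
      from vec_bigo_add[OF vec_bigo_mono[OF u2] this]
      have du: "vec_bigo d (\<lambda>h k. u h k - u' h k) (Suc q)" by simp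
      have stage: "?F h i = f (\<tau> h + nodes A $ i * h) (u h)" "?F' h i = f (\<tau> h + nodes A $ i * h) (u' h)" for h
        using that restart_stage.simps[of A f "\<tau> h" "y h" "g h" h i]
          restart_stage.simps[of A f "\<tau> h" "y h" "g' h" h i] by (simp_all add: u_def u'_def)
      have a: "vec_bigo d (\<lambda>h k. ?F h i k - ?F' h i k - (\<Sum>l<d. J k l * (u h l - u' h l))) (2 + q)"
        using J[rule_format, OF near_u _ du] by (simp add: stage)
      have "vec_bigo d (\<lambda>h k. \<Sum>l<d. J k l *
          (u h l - u' h l - h * (A $$ (i, 0) * (g h l - g' h l)))) (2 + q)"
        using u2 unfolding vec_bigo_def by (auto intro!: big_sum_in_bigo)
      from vec_bigo_add[OF a this] show ?thesis
      proof (rule vec_bigo_cong)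
        fix h k
        have "(\<Sum>l<d. J k l * (u h l - u' h l - h * (A $$ (i, 0) * (g h l - g' h l)))) =
           (\<Sum>l<d. J k l * (u h l - u' h l) - h * A $$ (i, 0) * (J k l * (g h l - g' h l)))"
          by (intro sum.cong) (auto simp: algebra_simps)
        also have "\<dots> = (\<Sum>l<d. J k l * (u h l - u' h l)) - h * (A $$ (i, 0) * e h k)"
          by (simp add: sum_subtractf e_def mult.assoc flip: sum_distrib_left)
        finally show "?F h i k - ?F' h i k - (\<Sum>l<d. J k l * (u h l - u' h l)) +
           (\<Sum>l<d. J k l * (u h l - u' h l - h * (A $$ (i, 0) * (g h l - g' h l)))) =
           ?F h i k - ?F' h i k - h * (A $$ (i, 0) * e h k)" by simp
      qed
    qed
    have "vec_bigo d (\<lambda>h k. w $ i * (h * (?F h i k - ?F' h i k - h * (A $$ (i, 0) * e h k)))) (3 + q)" for i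
    proof (cases "i = 0")
      case False
      hence "i > 0" by simp
      from vec_bigo_cmult[OF vec_bigo_hmult[OF lin[OF this]]] show ?thesis by (simp add: numeral_3_eq_3)
    qed (simp add: \<open>w $ 0 = 0\<close> vec_bigo_zero)
    hence "vec_bigo d (\<lambda>h k. \<Sum>i<dim_vec w. w $ i * (h * (?F h i k - ?F' h i k - h * (A $$ (i, 0) * e h k)))) (3 + q)"
      by (intro vec_bigo_sum)
    moreover have "(\<Sum>i<dim_vec w. w $ i * (h * (?F h i k - ?F' h i k - h * (A $$ (i, 0) * e h k)))) =
        (\<Sum>i<dim_vec w. w $ i * (h * (?F h i k - ?F' h i k)))" for h k
    proof -
      have "(\<Sum>i<dim_vec w. w $ i * (h * (?F h i k - ?F' h i k - h * (A $$ (i, 0) * e h k)))) =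
        (\<Sum>i<dim_vec w. w $ i * (h * (?F h i k - ?F' h i k)) - w $ i * A $$ (i, 0) * (h * h * e h k))"
        by (intro sum.cong) (auto simp: algebra_simps)
      also have "\<dots> = (\<Sum>i<dim_vec w. w $ i * (h * (?F h i k - ?F' h i k))) -
          (\<Sum>i<dim_vec w. w $ i * A $$ (i, 0)) * (h * h * e h k)"
        by (simp only: sum_subtractf sum_distrib_right)
      finally show ?thesis using 3 by simp
    qed
    ultimately show ?thesis unfolding expand \<open>m = 3\<close> by simp
  qed
qed

section \<open>The composed method as a chain of steps\<close>

lemma sum_lessThan_blocks:
  fixes \<phi> :: "nat \<Rightarrow> 'a :: comm_monoid_add"
  shows "(\<Sum>J<k * s + i. \<phi> J) = (\<Sum>l<k. \<Sum>j<s. \<phi> (l * s + j)) + (\<Sum>j<i. \<phi> (k * s + j))"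
proof -
  have "(\<Sum>J<k * s + i. \<phi> J) = (\<Sum>J<k * s. \<phi> J) + (\<Sum>J=k * s..<k * s + i. \<phi> J)"
    using sum.atLeastLessThan_concat[of 0 "k * s" "k * s + i" \<phi>] by (simp add: lessThan_atLeast0)
  also have "(\<Sum>J=k * s..<k * s + i. \<phi> J) = (\<Sum>j<i. \<phi> (k * s + j))"
    using sum.shift_bounds_nat_ivl[of \<phi> 0 "k * s" i] by (simp add: lessThan_atLeast0 add.commute)
  also have "(\<Sum>J<k * s. \<phi> J) = (\<Sum>l<k. \<Sum>J=l * s..<l * s + s. \<phi> J)"
    by (simp add: sum.nat_group)
  also have "\<dots> = (\<Sum>l<k. \<Sum>j<s. \<phi> (l * s + j))"
  proof (rule sum.cong)
    show "(\<Sum>J=l * s..<l * s + s. \<phi> J) = (\<Sum>j<s. \<phi> (l * s + j))" for l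
      using sum.shift_bounds_nat_ivl[of \<phi> 0 "l * s" s] by (simp add: lessThan_atLeast0 add.commute)
  qed simp
  finally show ?thesis .
qed

text \<open>
  After \<open>n\<close> steps: the approximation and the value that the next step uses as its first stage.
\<close>

primrec reuse_chain ::
  "real mat \<Rightarrow> real vec \<Rightarrow> (real \<Rightarrow> (nat \<Rightarrow> real) \<Rightarrow> (nat \<Rightarrow> real)) \<Rightarrow> real \<Rightarrow> (nat \<Rightarrow> real) \<Rightarrow> real
    \<Rightarrow> nat \<Rightarrow> (nat \<Rightarrow> real) \<times> (nat \<Rightarrow> real)" where
  "reuse_chain A b f t0 y0 h 0 = (y0, f t0 y0)"
| "reuse_chain A b f t0 y0 h (Suc n) =
     (let (y, g) = reuse_chain A b f t0 y0 h n in
       (restart_step A b f (t0 + real n * h) y g h,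
        f (t0 + real (Suc n) * h) (restart_step A (last_row A) f (t0 + real n * h) y g h)))"

lemma fst_reuse_chain_Suc:
  "fst (reuse_chain A b f t0 y0 h (Suc n)) = restart_step A b f (t0 + real n * h)
     (fst (reuse_chain A b f t0 y0 h n)) (snd (reuse_chain A b f t0 y0 h n)) h"
  by (simp add: case_prod_unfold Let_def)

lemma snd_reuse_chain_Suc:
  "snd (reuse_chain A b f t0 y0 h (Suc n)) = f (t0 + real (Suc n) * h)
     (restart_step A (last_row A) f (t0 + real n * h)
       (fst (reuse_chain A b f t0 y0 h n)) (snd (reuse_chain A b f t0 y0 h n)) h)"
  by (simp add: case_prod_unfold Let_def)

lemma node_eq_row_sum:
  assumes "A \<in> carrier_mat r s" "i < r"
  shows "nodes A $ i = (\<Sum>j<s. A $$ (i, j))"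
  using assms by (auto simp: nodes_def mult_mat_vec_def scalar_prod_def lessThan_atLeast0)

lemma explicit_first_node:
  assumes "explicit_rk s A b" "s \<ge> 1"
  shows "nodes A $ 0 = 0"
proof -
  have "nodes A $ 0 = (\<Sum>j<s. A $$ (0, j))"
    using assms by (intro node_eq_row_sum[of A s s]) (auto simp: explicit_rk_def)
  also have "\<dots> = 0" using assms by (intro sum.neutral) (auto simp: explicit_rk_def)
  finally show ?thesis .
qed

text \<open>
  Stage \<open>k s + i\<close> of the composed method is stage \<open>i\<close> of the step number \<open>k\<close>: the blocks \<open>e b\<^sup>T\<close> add up the updates of the preceding
  steps. In the row \<open>i = 0\<close> the last of these updates has the weights \<open>a\<close> instead, which makes this stage a
  repetition of the last stage of step \<open>k - 1\<close>. The weights must sum to \<open>1\<close> for the nodes to be \<open>(k + c\<^sub>i) / n\<close>.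
\<close>

lemma composed_step_eq_reuse_chain:
  assumes rk: "explicit_rk s A b" and s: "s \<ge> 1" and cs: "nodes A $ (s - 1) = 1"
    and b: "(\<Sum>i<s. b $ i) = 1" and n: "n \<ge> 1"
  shows "rk_step (composed_A n A b) (composed_b n b) f t0 y0 (real n * h) = fst (reuse_chain A b f t0 y0 h n)"
proof -
  have dims: "A \<in> carrier_mat s s" "dim_row A = s" "dim_col A = s" "dim_vec b = s"
    using rk by (auto simp: explicit_rk_def)
  let ?A = "composed_A n A b" and ?a = "last_row A"
  let ?Y = "\<lambda>k. fst (reuse_chain A b f t0 y0 h k)" and ?G = "\<lambda>k. snd (reuse_chain A b f t0 y0 h k)"
  let ?F = "\<lambda>k i. restart_stage A f (t0 + real k * h) (?Y k) (?G k) h i"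
  let ?S = "\<lambda>J. rk_stage ?A f t0 y0 (real n * h) J"
  have a_dim: "dim_vec ?a = s" by (simp add: last_row_def dims)
  have a_nth: "?a $ j = A $$ (s - 1, j)" if "j < s" for j
    using that s by (simp add: last_row_def dims)
  have c0: "nodes A $ 0 = 0" by (rule explicit_first_node[OF rk s])
  have asum: "(\<Sum>j<s. ?a $ j) = 1"
    using cs node_eq_row_sum[OF dims(1), of "s - 1"] s a_nth by simp
  have idx: "k * s + i < n * s" if "k < n" "i < s" for k i
  proof -
    have "k * s + i < Suc k * s" using that by simp
    also have "\<dots> \<le> n * s" using that by (intro mult_right_mono) auto
    finally show ?thesis .
  qed
  \<comment> \<open>the blocks of the composed matrix without the factor \<open>1 / n\<close>\<close>
  define B where "B k l i j = (if l < k then if i = 0 \<and> k = Suc l then ?a $ j else b $ j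
      else if l = k then A $$ (i, j) else 0)" for k l i j
  have entry: "?A $$ (k * s + i, l * s + j) = B k l i j / real n"
    if "k < n" "i < s" "l < n" "j < s" for k i l j
  proof -
    have "?A $$ (k * s + i, l * s + j) = 1 / real n * composed_block A b k l $$ (i, j)"
      using idx[OF that(1,2)] idx[OF that(3,4)] that unfolding composed_A_def Let_def dims(4) by simp
    also have "composed_block A b k l $$ (i, j) = B k l i j"
      using that dims a_dim
      by (auto simp: composed_block_def B_def reuse_E_def reuse_M_def outer_prod_def)
    finally show ?thesis by simp
  qed
  have node: "nodes ?A $ (k * s + i) * (real n * h) = real k * h + nodes A $ i * h" if "k < n" "i < s" for k i
  proof -
    have row: "(\<Sum>j<s. B k l i j) = (if l < k then 1 else if l = k then nodes A $ i else 0)" for l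
    proof (cases "i = 0 \<and> k = Suc l")
      case True
      thus ?thesis using asum by (simp add: B_def)
    next
      case False
      hence "B k l i j = (if l < k then b $ j else if l = k then A $$ (i, j) else 0)" for j
        by (auto simp: B_def)
      thus ?thesis using that b node_eq_row_sum[OF dims(1), of i] by simp
    qed
    have "nodes ?A $ (k * s + i) = (\<Sum>J<n * s + 0. ?A $$ (k * s + i, J))"
      using idx[OF that] node_eq_row_sum[of ?A "n * s" "n * s" "k * s + i"]
      by (simp add: composed_A_def Let_def dims)
    also have "\<dots> = (\<Sum>l<n. \<Sum>j<s. ?A $$ (k * s + i, l * s + j))"
      unfolding sum_lessThan_blocks by simp
    also have "\<dots> = (\<Sum>l<n. (if l < k then 1 else if l = k then nodes A $ i else 0)) / real n"
    proof -
      have "(\<Sum>j<s. ?A $$ (k * s + i, l * s + j)) =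
          (if l < k then 1 else if l = k then nodes A $ i else 0) / real n" if "l < n" for l
      proof -
        have "(\<Sum>j<s. ?A $$ (k * s + i, l * s + j)) = (\<Sum>j<s. B k l i j / real n)"
          by (intro sum.cong) (use entry \<open>k < n\<close> \<open>i < s\<close> that in auto)
        thus ?thesis unfolding row[symmetric] by (simp add: sum_divide_distrib)
      qed
      thus ?thesis unfolding sum_divide_distrib by (intro sum.cong) auto
    qed
    also have "(\<Sum>l<n. (if l < k then 1 else if l = k then nodes A $ i else 0)) = real k + nodes A $ i"
    proof -
      have "(\<Sum>l<n. (if l < k then 1 else if l = k then nodes A $ i else 0)) =
          (\<Sum>l<n. (if l < k then 1 else 0) + (if l = k then nodes A $ i else 0))"
        by (intro sum.cong) auto
      also have "\<dots> = (\<Sum>l<n. (if l < k then 1 else 0)) + nodes A $ i"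
        using that by (simp add: sum.distrib)
      also have "(\<Sum>l<n. (if l < k then 1 else 0)) = (\<Sum>l<k. (1::real))"
        by (rule sum.mono_neutral_cong_right) (use that in auto)
      finally show ?thesis by simp
    qed
    finally show ?thesis using n by (simp add: field_simps)
  qed
  have Y: "?Y k x = y0 x + h * (\<Sum>l<k. \<Sum>j<s. b $ j * ?F l j x)" for k x
    by (induction k) (simp_all only: fst_reuse_chain_Suc, simp_all add: restart_step_def dims algebra_simps)
  have stage: "?S (k * s + i) = ?F k i" if "k < n" "i < s" for k i
    using that
  proof (induction "k * s + i" arbitrary: k i rule: less_induct)
    case less
    have "(\<Sum>J<k * s + i. ?A $$ (k * s + i, J) * ?S J x) =
       ((\<Sum>l<k. \<Sum>j<s. B k l i j * ?F l j x) + (\<Sum>j<i. A $$ (i, j) * ?F k j x)) / real n" for x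
    proof -
      have "?A $$ (k * s + i, l * s + j) * ?S (l * s + j) x = B k l i j * ?F l j x / real n"
        if "l < k" "j < s" for l j
      proof -
        have "l * s + j < Suc l * s" using that by simp
        also have "\<dots> \<le> k * s" using that by (intro mult_right_mono) auto
        finally have less_idx: "l * s + j < k * s + i" by simp
        have "?S (l * s + j) = ?F l j" by (rule less.hyps[OF less_idx]) (use that less.prems in auto)
        moreover have "?A $$ (k * s + i, l * s + j) = B k l i j / real n"
          by (rule entry) (use that less.prems in auto)
        ultimately show ?thesis by simp
      qed
      moreover have "?A $$ (k * s + i, k * s + j) * ?S (k * s + j) x = A $$ (i, j) * ?F k j x / real n"
        if "j < i" for j
      proof -
        have "?S (k * s + j) = ?F k j" by (rule less.hyps) (use that less.prems in auto)
        moreover have "?A $$ (k * s + i, k * s + j) = B k k i j / real n"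
          by (rule entry) (use that less.prems in auto)
        ultimately show ?thesis by (simp add: B_def)
      qed
      ultimately show ?thesis
        unfolding sum_lessThan_blocks[of "\<lambda>J. ?A $$ (k * s + i, J) * ?S J x" k s i]
          add_divide_distrib sum_divide_distrib
        by (intro arg_cong2[where f = "(+)"] sum.cong refl) auto
    qed
    hence sum: "real n * h * (\<Sum>J<k * s + i. ?A $$ (k * s + i, J) * ?S J x) =
        h * ((\<Sum>l<k. \<Sum>j<s. B k l i j * ?F l j x) + (\<Sum>j<i. A $$ (i, j) * ?F k j x))" for x
      using n by simp
    have S: "?S (k * s + i) = f (t0 + (real k * h + nodes A $ i * h))
       (\<lambda>x. y0 x + h * ((\<Sum>l<k. \<Sum>j<s. B k l i j * ?F l j x) + (\<Sum>j<i. A $$ (i, j) * ?F k j x)))"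
      unfolding rk_stage.simps[of ?A f t0 y0 "real n * h" "k * s + i"] sum node[OF less.prems] ..
    show ?case
    proof (cases "i = 0")
      case False
      hence "B k l i j = b $ j" if "l < k" for l j using that by (simp add: B_def)
      hence "?S (k * s + i) = f (t0 + real k * h + nodes A $ i * h)
         (\<lambda>x. ?Y k x + h * (\<Sum>j<i. A $$ (i, j) * ?F k j x))"
        unfolding S Y[of k] by (simp add: add.assoc distrib_left)
      thus ?thesis unfolding restart_stage.simps[of A f _ _ _ _ i] using False by simp
    next
      case i: True
      show ?thesis
      proof (cases k)
        case 0
        thus ?thesis using S i c0 by (simp add: restart_stage_0)
      next
        case (Suc m)
        have "(\<Sum>l<k. \<Sum>j<s. B k l i j * ?F l j x) =
           (\<Sum>l<m. \<Sum>j<s. b $ j * ?F l j x) + (\<Sum>j<s. ?a $ j * ?F m j x)" for x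
          by (simp add: Suc i B_def)
        hence "?S (k * s + i) = f (t0 + real k * h)
           (\<lambda>x. ?Y m x + h * (\<Sum>j<s. ?a $ j * ?F m j x))"
          unfolding S Y[of m] using i c0 by (simp add: add.assoc distrib_left)
        also have "\<dots> = ?G k"
          unfolding Suc snd_reuse_chain_Suc by (simp add: restart_step_def a_dim)
        finally show ?thesis by (simp add: i restart_stage_0)
      qed
    qed
  qed
  show ?thesis
  proof
    fix x
    have dim: "dim_vec (composed_b n b) = n * s" by (simp add: composed_b_def Let_def dims)
    have summand: "real n * (composed_b n b $ (l * s + j) * ?S (l * s + j) x) = b $ j * ?F l j x"
      if "l < n" "j < s" for l j
    proof -
      have "composed_b n b $ (l * s + j) = b $ j / real n"
        using idx[OF that] that by (simp add: composed_b_def Let_def dims)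
      thus ?thesis unfolding stage[OF that] using n by simp
    qed
    define X where "X = (\<Sum>J<n * s. composed_b n b $ J * ?S J x)"
    have "X = (\<Sum>l<n. \<Sum>j<s. composed_b n b $ (l * s + j) * ?S (l * s + j) x)"
      unfolding X_def using sum_lessThan_blocks[of "\<lambda>J. composed_b n b $ J * ?S J x" n s 0] by simp
    hence "real n * X = (\<Sum>l<n. \<Sum>j<s. real n * (composed_b n b $ (l * s + j) * ?S (l * s + j) x))"
      by (simp add: sum_distrib_left)
    also have "\<dots> = (\<Sum>l<n. \<Sum>j<s. b $ j * ?F l j x)"
    proof (rule sum.cong[OF refl], rule sum.cong[OF refl])
      fix l j assume "l \<in> {..<n}" "j \<in> {..<s}"
      thus "real n * (composed_b n b $ (l * s + j) * ?S (l * s + j) x) = b $ j * ?F l j x"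
        by (intro summand) auto
    qed
    finally have nX: "real n * X = (\<Sum>l<n. \<Sum>j<s. b $ j * ?F l j x)" .
    have "real n * h * X = h * (real n * X)" by simp
    hence "y0 x + real n * h * X = ?Y n x" unfolding Y[of n x] nX by (rule arg_cong)
    thus "rk_step ?A (composed_b n b) f t0 y0 (real n * h) x = ?Y n x"
      unfolding rk_step_def dim X_def .
  qed
qed

section \<open>Accuracy of the chain\<close>

lemma filterlim_mult_at_right_0:
  assumes "(c::real) > 0"
  shows "filterlim (\<lambda>h. c * h) (at_right 0) (at_right 0)"
  unfolding filterlim_at
proof
  show "\<forall>\<^sub>F h in at_right 0. c * h \<in> {0<..} \<and> c * h \<noteq> 0"
    using assms by (auto simp: eventually_at_filter)
  show "((\<lambda>h. c * h) \<longlongrightarrow> 0) (at_right 0)"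
    by (auto intro!: tendsto_eq_intros)
qed

lemma bigo_rescale:
  assumes "u \<in> O[at_right 0](\<lambda>h::real. h ^ q)" "c > 0"
  shows "(\<lambda>h. u (c * h)) \<in> O[at_right 0](\<lambda>h. h ^ q)"
proof -
  have "(\<lambda>h. u (c * h)) \<in> O[at_right 0](\<lambda>h. (c * h) ^ q)"
    by (rule landau_o.big.compose[OF assms(1) filterlim_mult_at_right_0[OF assms(2)]])
  thus ?thesis using assms(2) by (simp add: power_mult_distrib)
qed

lemma vec_bigo_rescale: "vec_bigo d u q \<Longrightarrow> c > 0 \<Longrightarrow> vec_bigo d (\<lambda>h. u (c * h)) q"
  unfolding vec_bigo_def using bigo_rescale[of "\<lambda>h. u h _"] by simp

lemma rk_stage_cong:
  assumes f: "smooth_rhs d f" and "\<And>k. k < d \<Longrightarrow> y k = y' k" and "k < d"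
  shows "rk_stage A f t y h i k = rk_stage A f t y' h i k"
  using \<open>k < d\<close>
proof (induction i arbitrary: k rule: less_induct)
  case (less i)
  let ?g = "\<lambda>x. f (x 0) (\<lambda>i. x (Suc i)) k"
  have "C_diff (Suc d) 0 ?g"
    using f less.prems unfolding smooth_rhs_def smooth_def by blast
  note dep = C_diff_depends[OF this, unfolded depends_on_first_def, rule_format]
  have f_cong: "f \<tau> u k = f \<tau> v k" if "\<And>i. i < d \<Longrightarrow> u i = v i" for \<tau> u v
  proof -
    have "?g (case_nat \<tau> u) = ?g (case_nat \<tau> v)"
      by (rule dep) (use that in \<open>auto split: nat.split\<close>)
    thus ?thesis by simp
  qed
  have arg: "y j + h * (\<Sum>l<i. A $$ (i, l) * rk_stage A f t y h l j) =
      y' j + h * (\<Sum>l<i. A $$ (i, l) * rk_stage A f t y' h l j)" if "j < d" for j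
    using assms(2)[OF that] less.IH[OF _ that] by simp
  show ?case unfolding rk_stage.simps[of A f _ _ _ i] by (rule f_cong) (rule arg)
qed

text \<open>
  The initial value of a problem may differ from the value \<open>y t0\<close> of its solution in the irrelevant coordinates
  from \<open>d\<close> on. This lets all later arguments start at \<open>y t0\<close>.
\<close>

lemma rk_orderI:
  assumes "\<And>d f t0 T y. smooth_rhs d f \<Longrightarrow> t0 < T \<Longrightarrow> solves_ivp d f t0 (y t0) T y \<Longrightarrow>
     vec_bigo d (\<lambda>h k. y (t0 + h) k - rk_step A b f t0 (y t0) h k) (p + 1)"
  shows "rk_order A b p"
  unfolding rk_order_def
proof (intro allI impI, elim conjE)
  fix d f t0 y0 T y k
  assume *: "smooth_rhs d f" "t0 < T" "solves_ivp d f t0 y0 T y" "k < d"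
  have init: "y t0 j = y0 j" if "j < d" for j using *(3) that by (simp add: solves_ivp_def)
  have "solves_ivp d f t0 (y t0) T y" using *(3) by (simp add: solves_ivp_def)
  from assms[OF *(1,2) this, unfolded vec_bigo_def, rule_format, OF *(4)]
  have "(\<lambda>h. y (t0 + h) k - rk_step A b f t0 (y t0) h k) \<in> O[at_right 0](\<lambda>h. h ^ (p + 1))" .
  moreover have "rk_step A b f t0 (y t0) h k = rk_step A b f t0 y0 h k" for h
  proof -
    have "rk_stage A f t0 (y t0) h i k = rk_stage A f t0 y0 h i k" for i
      by (rule rk_stage_cong[OF *(1) init *(4)])
    thus ?thesis unfolding rk_step_def init[OF *(4)] by simp
  qed
  ultimately show "(\<lambda>h. y (t0 + h) k - rk_step A b f t0 y0 h k) \<in> O[at_right 0](\<lambda>h. h ^ (p + 1))"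
    by simp
qed

lemma solution_near:
  assumes y: "solves_ivp d f t0 (y t0) T y" and "t0 < T" and "c \<ge> 0"
  shows "near d t0 (y t0) (\<lambda>h. t0 + c * h) (\<lambda>h. y (t0 + c * h))"
  unfolding near_def vec_bigo_def
proof (intro conjI allI impI)
  show "(\<lambda>h. t0 + c * h - t0) \<in> O[at_right 0](\<lambda>h. h)" by simp
  fix k assume "k < d"
  hence "((\<lambda>u. y u k) has_real_derivative f t0 (y t0) k) (at t0 within {t0..T})"
    using y \<open>t0 < T\<close> unfolding solves_ivp_def by auto
  hence lim: "((\<lambda>u. (y u k - y t0 k) / (u - t0)) \<longlongrightarrow> f t0 (y t0) k) (at_right t0)"
    using \<open>t0 < T\<close> by (simp add: has_field_derivative_iff at_within_Icc_at_right)
  show "(\<lambda>h. y (t0 + c * h) k - y t0 k) \<in> O[at_right 0](\<lambda>h. h ^ 1)"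
  proof (cases "c = 0")
    case False
    hence c: "c > 0" using \<open>c \<ge> 0\<close> by simp
    have "((\<lambda>h. (y (h + t0) k - y t0 k) / (h + t0 - t0)) \<longlongrightarrow> f t0 (y t0) k) (at_right 0)"
      using lim by (subst (asm) filterlim_at_right_to_0)
    hence "((\<lambda>h. (y (t0 + h) k - y t0 k) / h ^ 1) \<longlongrightarrow> f t0 (y t0) k) (at_right 0)"
      by (simp add: add.commute)
    hence "(\<lambda>h. y (t0 + h) k - y t0 k) \<in> O[at_right 0](\<lambda>h. h ^ 1)"
      by (intro bigoI_tendsto[where c = "f t0 (y t0) k"]) (auto simp: eventually_at_filter)
    from bigo_rescale[OF this c] show ?thesis .
  qed simp
qed

lemma plain_step_stable:
  assumes f: "smooth_rhs d f" and y: "near d t0 y0 \<tau> y" and y': "near d t0 y0 \<tau> y'"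
    and dy: "vec_bigo d (\<lambda>h k. y h k - y' h k) q"
  shows "vec_bigo d (\<lambda>h k. restart_step A w f (\<tau> h) (y h) (f (\<tau> h) (y h)) h k
     - restart_step A w f (\<tau> h) (y' h) (f (\<tau> h) (y' h)) h k) q"
proof -
  have "vec_bigo d (\<lambda>h k. f (\<tau> h) (y h) k - f (\<tau> h) (y' h) k) q"
    by (rule rhs_diff[OF f y y' _ dy]) simp
  from restart_step_diff[OF f y y' rhs_bounded[OF f y] rhs_bounded[OF f y'] dy this, of A w]
  have "vec_bigo d (\<lambda>h k. restart_step A w f (\<tau> h) (y h) (f (\<tau> h) (y h)) h k
     - restart_step A w f (\<tau> h) (y' h) (f (\<tau> h) (y' h)) h k - (y h k - y' h k)) q"
    by (rule vec_bigo_mono) simp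
  from vec_bigo_add[OF this dy] show ?thesis by simp
qed

lemma filterlim_start: "((\<lambda>h. t0 + c * h) \<longlongrightarrow> (t0::real)) (at_right 0)"
  by (auto intro!: tendsto_eq_intros)

lemma eventually_start: "c \<ge> 0 \<Longrightarrow> \<forall>\<^sub>F h in at_right 0. t0 + c * h \<ge> (t0::real)"
  by (auto simp: eventually_at_filter)

lemma step_error_along_solution:
  assumes order: "rk_order A w p" and c0: "nodes A $ 0 = 0" and f: "smooth_rhs d f"
    and y: "solves_ivp d f t0 (y t0) T y" and "t0 < T"
  shows "vec_bigo d (\<lambda>h k. restart_step A w f (t0 + real n * h) (y (t0 + real n * h))
     (f (t0 + real n * h) (y (t0 + real n * h))) h k - y (t0 + real (Suc n) * h) k) (p + 1)"
proof -
  have "vec_bigo d (\<lambda>h k. y (t0 + real n * h + h) k -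
      rk_step A w f (t0 + real n * h) (y (t0 + real n * h)) h k) (p + 1)"
    unfolding vec_bigo_def
    using rk_order_moving_start[OF order f y \<open>t0 < T\<close> _ filterlim_start eventually_start] by simp
  from vec_bigo_sym[OF this] show ?thesis
    unfolding rk_step_eq_restart_step[OF c0] by (simp add: algebra_simps)
qed

text \<open>
  Both bounds are proved together: the error of the reused value enters the next approximation with the factor \<open>h\<^sup>m\<close>, and the
  next reused value differs from \<open>f\<close> at the next approximation by what separates the update with weights \<open>a\<close> from the one with
  weights \<open>b\<close>; both of these are close to the solution.
\<close>

lemma reuse_chain_accuracy:
  assumes order: "rk_order A b q" and order_a: "rk_order A (last_row A) r'"
    and m: "first_stage_influence A b m" and r': "r' \<le> q" and e: "e \<le> q + 1" "e \<le> m + (r' + 1)" "r' < e"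
    and c0: "nodes A $ 0 = 0" and f: "smooth_rhs d f"
    and y: "solves_ivp d f t0 (y t0) T y" and "t0 < T"
  shows "vec_bigo d (\<lambda>h k. fst (reuse_chain A b f t0 (y t0) h n) k - y (t0 + real n * h) k) e"
    and "vec_bigo d (\<lambda>h k. snd (reuse_chain A b f t0 (y t0) h n) k -
           f (t0 + real n * h) (fst (reuse_chain A b f t0 (y t0) h n)) k) (r' + 1)"
proof (induction n)
  case 0
  show "vec_bigo d (\<lambda>h k. fst (reuse_chain A b f t0 (y t0) h 0) k - y (t0 + real 0 * h) k) e"
    by (simp add: vec_bigo_zero)
  show "vec_bigo d (\<lambda>h k. snd (reuse_chain A b f t0 (y t0) h 0) k -
           f (t0 + real 0 * h) (fst (reuse_chain A b f t0 (y t0) h 0)) k) (r' + 1)"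
    by (simp add: vec_bigo_zero)
next
  case (Suc n)
  define \<tau> where "\<tau> h = t0 + real n * h" for h
  define Y where "Y h = fst (reuse_chain A b f t0 (y t0) h n)" for h
  define G where "G h = snd (reuse_chain A b f t0 (y t0) h n)" for h
  define z where "z h = y (\<tau> h)" for h
  define z' where "z' h = y (t0 + real (Suc n) * h)" for h
  let ?P = "\<lambda>w h. restart_step A w f (\<tau> h) (Y h) (G h) h"
  let ?Q = "\<lambda>w h. restart_step A w f (\<tau> h) (Y h) (f (\<tau> h) (Y h)) h"
  let ?R = "\<lambda>w h. restart_step A w f (\<tau> h) (z h) (f (\<tau> h) (z h)) h"
  have dY: "vec_bigo d (\<lambda>h k. Y h k - z h k) e"
    using Suc(1) unfolding Y_def z_def \<tau>_def .
  have dG: "vec_bigo d (\<lambda>h k. G h k - f (\<tau> h) (Y h) k) (r' + 1)"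
    using Suc(2) unfolding Y_def G_def \<tau>_def .
  have z: "near d t0 (y t0) \<tau> z"
    using solution_near[OF y \<open>t0 < T\<close>, of "real n"] by (simp add: \<tau>_def[abs_def] z_def[abs_def])
  have Y: "near d t0 (y t0) \<tau> Y"
    by (rule near_perturb[OF z vec_bigo_mono[OF dY]]) (use e in simp)
  have fY: "vec_bigo d (\<lambda>h. f (\<tau> h) (Y h)) 0" by (rule rhs_bounded[OF f Y])
  have G: "vec_bigo d G 0"
    using vec_bigo_add[OF vec_bigo_mono[OF dG] fY] by simp
  have QR: "vec_bigo d (\<lambda>h k. ?Q w h k - ?R w h k) e" for w
    by (rule plain_step_stable[OF f Y z dY])
  have PQ: "vec_bigo d (\<lambda>h k. ?P b h k - ?Q b h k) e"
    by (rule vec_bigo_mono[OF restart_step_first_stage_diff[OF f Y G fY dG m]]) (use e in simp)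
  have Rz: "vec_bigo d (\<lambda>h k. ?R b h k - z' h k) e"
    using step_error_along_solution[OF order c0 f y \<open>t0 < T\<close>, of n] e(1)
    unfolding z_def z'_def \<tau>_def by (rule vec_bigo_mono)
  have *: "vec_bigo d (\<lambda>h k. ?P b h k - z' h k) e"
    by (rule vec_bigo_trans[OF PQ vec_bigo_trans[OF QR Rz]])
  thus "vec_bigo d (\<lambda>h k. fst (reuse_chain A b f t0 (y t0) h (Suc n)) k - y (t0 + real (Suc n) * h) k) e"
    unfolding fst_reuse_chain_Suc Y_def G_def z'_def \<tau>_def .
  let ?a = "last_row A"
  have PQ_a: "vec_bigo d (\<lambda>h k. ?P ?a h k - ?Q ?a h k) (r' + 1)"
    by (rule vec_bigo_mono[OF restart_step_first_stage_diff[OF f Y G fY dG, of A _ 1]])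
       (auto simp: first_stage_influence_def)
  have QR_a: "vec_bigo d (\<lambda>h k. ?Q ?a h k - ?R ?a h k) (r' + 1)"
    by (rule vec_bigo_mono[OF QR]) (use e in simp)
  have Rz_a: "vec_bigo d (\<lambda>h k. ?R ?a h k - z' h k) (r' + 1)"
    using step_error_along_solution[OF order_a c0 f y \<open>t0 < T\<close>, of n]
    unfolding z_def z'_def \<tau>_def .
  have **: "vec_bigo d (\<lambda>h k. ?P ?a h k - z' h k) (r' + 1)"
    by (rule vec_bigo_trans[OF PQ_a vec_bigo_trans[OF QR_a Rz_a]])
  have near': "near d t0 (y t0) (\<lambda>h. t0 + real (Suc n) * h) z'"
    using solution_near[OF y \<open>t0 < T\<close>, of "real (Suc n)"] by (simp add: z'_def[abs_def])
  have "vec_bigo d (\<lambda>h k. f (t0 + real (Suc n) * h) (?P ?a h) k - f (t0 + real (Suc n) * h) (?P b h) k) (r' + 1)"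
  proof (rule rhs_diff[OF f])
    show "near d t0 (y t0) (\<lambda>h. t0 + real (Suc n) * h) (?P ?a)"
      by (rule near_perturb[OF near' vec_bigo_mono[OF **]]) simp
    show "near d t0 (y t0) (\<lambda>h. t0 + real (Suc n) * h) (?P b)"
      by (rule near_perturb[OF near' vec_bigo_mono[OF *]]) (use e in simp)
    show "vec_bigo d (\<lambda>h k. ?P ?a h k - ?P b h k) (r' + 1)"
      by (rule vec_bigo_trans[OF ** vec_bigo_sym[OF vec_bigo_mono[OF *]]]) (use e in simp)
  qed simp
  thus "vec_bigo d (\<lambda>h k. snd (reuse_chain A b f t0 (y t0) h (Suc n)) k -
           f (t0 + real (Suc n) * h) (fst (reuse_chain A b f t0 (y t0) h (Suc n))) k) (r' + 1)"
    unfolding fst_reuse_chain_Suc snd_reuse_chain_Suc Y_def G_def \<tau>_def .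
qed

section \<open>Test problems and necessary conditions\<close>

lemma C_diff_constant: "C_diff d k (\<lambda>_. c)"
proof (induction k arbitrary: c)
  case (Suc k)
  from Suc[of 0] show ?case by (auto simp: depends_on_first_def intro!: exI[of _ "\<lambda>_. 0"])
qed (auto simp: depends_on_first_def)

lemma C_diff_coordinate:
  assumes "j < d"
  shows "C_diff d k (\<lambda>x. x j)"
proof (cases k)
  case 0
  thus ?thesis using assms by (simp add: depends_on_first_def)
next
  case (Suc n)
  have "\<exists>g'. C_diff d n g' \<and> (\<forall>x. ((\<lambda>u. (x(i := u)) j) has_real_derivative g' x) (at (x i)))" for i
    by (rule exI[of _ "\<lambda>_. if i = j then 1 else 0"], cases "i = j")
       (auto simp: C_diff_constant)
  thus ?thesis using assms unfolding Suc by (simp add: depends_on_first_def)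
qed

lemma C_diff_monomial:
  assumes "0 < d"
  shows "C_diff d k (\<lambda>x. c * x 0 ^ q)"
proof (induction k arbitrary: c q)
  case 0
  thus ?case using assms by (auto simp: depends_on_first_def intro!: continuous_intros)
next
  case (Suc k)
  have "\<exists>g'. C_diff d k g' \<and> (\<forall>x. ((\<lambda>u. c * (x(i := u)) 0 ^ q) has_real_derivative g' x) (at (x i)))" for i
  proof (cases "i = 0")
    case True
    show ?thesis
      by (rule exI[of _ "\<lambda>x. (c * real q) * x 0 ^ (q - 1)"])
         (use Suc.IH[of "c * real q" "q - 1"] True in \<open>auto intro!: derivative_eq_intros\<close>)
  next
    case False
    thus ?thesis by (intro exI[of _ "\<lambda>_. 0"]) (auto simp: C_diff_constant)
  qed
  thus ?case using assms by (auto simp: depends_on_first_def intro!: continuous_intros)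
qed

text \<open>
  The system \<open>y\<^sub>0' = t\<^sup>q\<close>, \<open>y\<^sub>1' = y\<^sub>0\<close>, \<open>y\<^sub>2' = y\<^sub>1\<close>, and so on. Started at \<open>0\<close>, its component \<open>k\<close> isolates the single order condition
  \<open>b\<^sup>T A\<^sup>k c\<^sup>q = q! / (q + 1 + k)!\<close>.
\<close>

definition tower_rhs :: "nat \<Rightarrow> real \<Rightarrow> (nat \<Rightarrow> real) \<Rightarrow> (nat \<Rightarrow> real)" where
  "tower_rhs q t x k = (case k of 0 \<Rightarrow> t ^ q | Suc j \<Rightarrow> x j)"

definition tower_solution :: "nat \<Rightarrow> real \<Rightarrow> nat \<Rightarrow> real" where
  "tower_solution q t k = fact q / fact (q + 1 + k) * t ^ (q + 1 + k)"

lemma smooth_tower: "smooth_rhs d (tower_rhs q)"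
  unfolding smooth_rhs_def smooth_def
proof (intro allI impI)
  fix k n assume "k < d"
  thus "C_diff (Suc d) n (\<lambda>x. tower_rhs q (x 0) (\<lambda>i. x (Suc i)) k)"
    using C_diff_monomial[of "Suc d" n 1 q] C_diff_coordinate[of k "Suc d" n]
    by (cases k) (simp_all add: tower_rhs_def)
qed

lemma tower_solution_0: "tower_solution q 0 = (\<lambda>_. 0)"
  by (auto simp: tower_solution_def)

lemma solves_tower: "solves_ivp d (tower_rhs q) 0 (tower_solution q 0) 1 (tower_solution q)"
  unfolding solves_ivp_def
proof (intro allI impI conjI ballI refl)
  fix k and t :: real
  have "((\<lambda>u. tower_solution q u k) has_real_derivative
      fact q / fact (q + 1 + k) * (real (q + 1 + k) * t ^ (q + 1 + k - Suc 0))) (at t within {0..1})"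
    unfolding tower_solution_def by (intro DERIV_cmult DERIV_pow)
  also have "fact q / fact (q + 1 + k) * (real (q + 1 + k) * t ^ (q + 1 + k - Suc 0)) =
      fact q / fact (q + k) * t ^ (q + k)"
    by (simp add: divide_simps)
  also have "\<dots> = tower_rhs q t (tower_solution q t) k"
    by (cases k) (simp_all add: tower_rhs_def tower_solution_def)
  finally show "((\<lambda>u. tower_solution q u k) has_real_derivative
      tower_rhs q t (tower_solution q t) k) (at t within {0..1})" .
qed

lemma tower_stage:
  shows "rk_stage A (tower_rhs q) 0 (\<lambda>_. 0) h i 0 = h ^ q * (nodes A $ i) ^ q"
    and "rk_stage A (tower_rhs q) 0 (\<lambda>_. 0) h i (Suc 0) =
       h ^ (q + 1) * (\<Sum>j<i. A $$ (i, j) * (nodes A $ j) ^ q)"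
proof -
  show *: "rk_stage A (tower_rhs q) 0 (\<lambda>_. 0) h i 0 = h ^ q * (nodes A $ i) ^ q" for i
    by (subst rk_stage.simps) (simp add: tower_rhs_def power_mult_distrib mult.commute)
  show "rk_stage A (tower_rhs q) 0 (\<lambda>_. 0) h i (Suc 0) =
       h ^ (q + 1) * (\<Sum>j<i. A $$ (i, j) * (nodes A $ j) ^ q)"
    by (subst rk_stage.simps) (simp add: tower_rhs_def * sum_distrib_left mult_ac)
qed

lemma tower_step:
  shows "rk_step A w (tower_rhs q) 0 (\<lambda>_. 0) h 0 = (\<Sum>i<dim_vec w. w $ i * (nodes A $ i) ^ q) * h ^ (q + 1)"
    and "rk_step A w (tower_rhs q) 0 (\<lambda>_. 0) h (Suc 0) =
       (\<Sum>i<dim_vec w. w $ i * (\<Sum>j<i. A $$ (i, j) * (nodes A $ j) ^ q)) * h ^ (q + 2)"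
  by (simp_all add: rk_step_def tower_stage sum_distrib_left sum_distrib_right mult_ac)

lemma monomial_bigo_zero:
  fixes c :: real
  assumes "(\<lambda>h. c * h ^ n) \<in> O[at_right 0](\<lambda>h. h ^ m)" "n < m"
  shows "c = 0"
proof -
  have "(\<Sum>j<m. (if j = n then c else 0) * h ^ j) = c * h ^ n" for h
  proof -
    have "(\<Sum>j<m. (if j = n then c else 0) * h ^ j) = (\<Sum>j<m. if j = n then c * h ^ n else 0)"
      by (intro sum.cong) auto
    thus ?thesis using assms(2) by simp
  qed
  with assms(1) have "(\<lambda>h. \<Sum>j<m. (if j = n then c else 0) * h ^ j) \<in> O[at_right 0](\<lambda>h. h ^ m)"
    by simp
  from poly_bigo_zero[OF this assms(2)] show ?thesis by simp
qed

lemma rk_orderD: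
  assumes "rk_order A b p" "smooth_rhs d f" "t0 < T" "solves_ivp d f t0 y0 T y"
  shows "vec_bigo d (\<lambda>h k. y (t0 + h) k - rk_step A b f t0 y0 h k) (p + 1)"
  using assms unfolding rk_order_def vec_bigo_def by simp

lemma order_conditions_necessary:
  assumes "rk_order A b p"
  shows "q + 1 \<le> p \<Longrightarrow> (\<Sum>i<dim_vec b. b $ i * (nodes A $ i) ^ q) = 1 / real (q + 1)"
    and "q + 2 \<le> p \<Longrightarrow> (\<Sum>i<dim_vec b. b $ i * (\<Sum>j<i. A $$ (i, j) * (nodes A $ j) ^ q)) =
       1 / (real (q + 1) * real (q + 2))"
proof -
  have "vec_bigo 2 (\<lambda>h k. tower_solution q (0 + h) k - rk_step A b (tower_rhs q) 0 (tower_solution q 0) h k) (p + 1)"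
    by (rule rk_orderD[OF assms smooth_tower _ solves_tower]) simp
  hence *: "(\<lambda>h. tower_solution q h k - rk_step A b (tower_rhs q) 0 (\<lambda>_. 0) h k) \<in> O[at_right 0](\<lambda>h. h ^ (p + 1))"
    if "k < 2" for k using that unfolding vec_bigo_def tower_solution_0 by simp
  {
    assume "q + 1 \<le> p"
    have "(\<lambda>h. (fact q / fact (q + 1) - (\<Sum>i<dim_vec b. b $ i * (nodes A $ i) ^ q)) * h ^ (q + 1))
         \<in> O[at_right 0](\<lambda>h. h ^ (p + 1))"
      using *[of 0] unfolding tower_step(1) by (simp add: tower_solution_def left_diff_distrib)
    from monomial_bigo_zero[OF this] \<open>q + 1 \<le> p\<close>
    have "(\<Sum>i<dim_vec b. b $ i * (nodes A $ i) ^ q) = fact q / fact (q + 1)" by simp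
    also have "\<dots> = 1 / real (q + 1)" by (simp add: divide_simps)
    finally show "(\<Sum>i<dim_vec b. b $ i * (nodes A $ i) ^ q) = 1 / real (q + 1)" .
  }
  {
    assume "q + 2 \<le> p"
    have "(\<lambda>h. (fact q / fact (q + 2) - (\<Sum>i<dim_vec b. b $ i * (\<Sum>j<i. A $$ (i, j) * (nodes A $ j) ^ q))) * h ^ (q + 2))
         \<in> O[at_right 0](\<lambda>h. h ^ (p + 1))"
      using *[of "Suc 0"] unfolding tower_step(2) by (simp add: tower_solution_def left_diff_distrib)
    from monomial_bigo_zero[OF this] \<open>q + 2 \<le> p\<close>
    have "(\<Sum>i<dim_vec b. b $ i * (\<Sum>j<i. A $$ (i, j) * (nodes A $ j) ^ q)) = fact q / fact (q + 2)" by simp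
    also have "\<dots> = 1 / (real (q + 1) * real (q + 2))"
      by (simp add: fact_reduce[of "q + 2"] fact_reduce[of "Suc q"] divide_simps)
    finally show "(\<Sum>i<dim_vec b. b $ i * (\<Sum>j<i. A $$ (i, j) * (nodes A $ j) ^ q)) =
       1 / (real (q + 1) * real (q + 2))" .
  }
qed

lemma weights_sum_of_order:
  assumes "rk_order A b p" "p \<ge> 1"
  shows "(\<Sum>i<dim_vec b. b $ i) = 1"
  using order_conditions_necessary(1)[OF assms(1), of 0] assms(2) by simp

text \<open>
  The system is linear in the state, so the effect of a changed first stage is exact: in component \<open>1\<close> it stays in the first stage,
  in component \<open>2\<close> it reaches the later stages through the first column of \<open>A\<close>.
\<close>

lemma tower_first_stage_diff:
  assumes "g 0 = g' 0"
  shows "restart_stage A (tower_rhs q) t y g h i 0 = restart_stage A (tower_rhs q) t y g' h i 0"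
    and "restart_stage A (tower_rhs q) t y g h i 1 - restart_stage A (tower_rhs q) t y g' h i 1 =
      (if i = 0 then g 1 - g' 1 else 0)"
    and "restart_stage A (tower_rhs q) t y g h i 2 - restart_stage A (tower_rhs q) t y g' h i 2 =
      (if i = 0 then g 2 - g' 2 else h * (A $$ (i, 0) * (g 1 - g' 1)))"
proof -
  let ?F = "restart_stage A (tower_rhs q) t y g h" and ?F' = "restart_stage A (tower_rhs q) t y g' h"
  have unfold_F: "?F i k = tower_rhs q (t + nodes A $ i * h) (\<lambda>k. y k + h * (\<Sum>j<i. A $$ (i, j) * ?F j k)) k"
     "?F' i k = tower_rhs q (t + nodes A $ i * h) (\<lambda>k. y k + h * (\<Sum>j<i. A $$ (i, j) * ?F' j k)) k"
    if "i \<noteq> 0" for i k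
    using that restart_stage.simps[of A "tower_rhs q" t y g h i]
      restart_stage.simps[of A "tower_rhs q" t y g' h i] by simp_all
  show 0: "?F i 0 = ?F' i 0" for i
    by (cases "i = 0") (simp_all add: restart_stage_0 assms unfold_F tower_rhs_def)
  show 1: "?F i 1 - ?F' i 1 = (if i = 0 then g 1 - g' 1 else 0)" for i
    by (cases "i = 0") (simp_all add: restart_stage_0 unfold_F tower_rhs_def 0)
  show "?F i 2 - ?F' i 2 = (if i = 0 then g 2 - g' 2 else h * (A $$ (i, 0) * (g 1 - g' 1)))"
  proof (cases "i = 0")
    case False
    hence "?F i 2 - ?F' i 2 = h * (\<Sum>j<i. A $$ (i, j) * (?F j 1 - ?F' j 1))"
      by (simp add: unfold_F tower_rhs_def numeral_2_eq_2 right_diff_distrib sum_subtractf)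
    also have "(\<Sum>j<i. A $$ (i, j) * (?F j 1 - ?F' j 1)) = (\<Sum>j<i. if j = 0 then A $$ (i, 0) * (g 1 - g' 1) else 0)"
      unfolding 1 by (intro sum.cong) auto
    also have "\<dots> = A $$ (i, 0) * (g 1 - g' 1)" using False by simp
    finally show ?thesis using False by simp
  qed (simp add: restart_stage_0)
qed

section \<open>Order with and without reuse\<close>

lemma reuse_order_sufficient:
  assumes rk: "explicit_rk s A b" "s \<ge> 1" "nodes A $ (s - 1) = 1"
    and order: "rk_order A b p" "p \<ge> 1" and order_a: "rk_order A (last_row A) r" "r \<le> p"
    and m: "first_stage_influence A b m" "p \<le> m + r"
  shows "rkrls_order A b p"
  unfolding rkrls_order_def
proof (intro allI impI)
  fix n :: nat assume n: "n \<ge> 2"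
  have c0: "nodes A $ 0 = 0" by (rule explicit_first_node[OF rk(1,2)])
  have "dim_vec b = s" using rk(1) by (simp add: explicit_rk_def)
  with weights_sum_of_order[OF order] have b: "(\<Sum>i<s. b $ i) = 1" by simp
  show "rk_order (composed_A n A b) (composed_b n b) p"
  proof (rule rk_orderI)
    fix d f and t0 T :: real and y
    assume f: "smooth_rhs d f" and T: "t0 < T" and y: "solves_ivp d f t0 (y t0) T y"
    have chain: "vec_bigo d (\<lambda>h k. fst (reuse_chain A b f t0 (y t0) h n) k - y (t0 + real n * h) k) (p + 1)"
      by (rule reuse_chain_accuracy(1)[OF order(1) order_a(1) m(1) order_a(2) _ _ _ c0 f y T])
         (use order_a m in auto)
    have inv: "1 / real n > 0" "real n * (1 / real n * h) = h" for h using n by auto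
    have "vec_bigo d (\<lambda>h k. fst (reuse_chain A b f t0 (y t0) (1 / real n * h) n) k - y (t0 + h) k) (p + 1)"
      using vec_bigo_rescale[OF chain inv(1)] unfolding inv(2) .
    moreover have "fst (reuse_chain A b f t0 (y t0) (1 / real n * h) n) =
        rk_step (composed_A n A b) (composed_b n b) f t0 (y t0) h" for h
      using composed_step_eq_reuse_chain[OF rk(1,2,3) b, of n f t0 "y t0" "1 / real n * h"] n
      unfolding inv(2) by simp
    ultimately show "vec_bigo d (\<lambda>h k. y (t0 + h) k -
        rk_step (composed_A n A b) (composed_b n b) f t0 (y t0) h k) (p + 1)"
      using vec_bigo_sym by simp
  qed
qed

text \<open>
  The composed method takes one step of size \<open>H = n h\<close>, so starting at \<open>t0 + c h\<close> means starting at \<open>t0 + (c / n) H\<close>.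
\<close>

lemma chain_error_of_composed_order:
  assumes rk: "explicit_rk s A b" "s \<ge> 1" "nodes A $ (s - 1) = 1" and b: "(\<Sum>i<s. b $ i) = 1"
    and order: "rk_order (composed_A n A b) (composed_b n b) p" and n: "n \<ge> 1"
    and f: "smooth_rhs d f" and y: "solves_ivp d f t0 (y t0) T y" and T: "t0 < T"
  shows "vec_bigo d (\<lambda>h k. fst (reuse_chain A b f (t0 + real c * h) (y (t0 + real c * h)) h n) k -
      y (t0 + real (c + n) * h) k) (p + 1)"
proof -
  define \<theta> where "\<theta> H = t0 + real c / real n * H" for H
  have "vec_bigo d (\<lambda>H k. y (\<theta> H + H) k -
      rk_step (composed_A n A b) (composed_b n b) f (\<theta> H) (y (\<theta> H)) H k) (p + 1)"
    unfolding vec_bigo_def \<theta>_def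
    by (intro allI impI rk_order_moving_start[OF order f y T _ filterlim_start eventually_start]) auto
  moreover have "real n > 0" using n by simp
  ultimately have *: "vec_bigo d (\<lambda>h k. y (\<theta> (real n * h) + real n * h) k -
      rk_step (composed_A n A b) (composed_b n b) f (\<theta> (real n * h)) (y (\<theta> (real n * h))) (real n * h) k) (p + 1)"
    by (rule vec_bigo_rescale)
  have \<theta>: "\<theta> (real n * h) = t0 + real c * h" for h using n by (simp add: \<theta>_def)
  have time: "t0 + real c * h + real n * h = t0 + real (c + n) * h" for h
    by (simp add: algebra_simps)
  show ?thesis
    using vec_bigo_sym[OF *] unfolding \<theta> time composed_step_eq_reuse_chain[OF rk b n] .
qed

text \<open>
  The order of the underlying method is raised from \<open>q\<close> to \<open>q + 1\<close>. Two numerical solutions reach \<open>t0 + 3h\<close> with error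
  \<open>O(h\<^bsup>q+2\<^esup>)\<close>: the chain \<open>Y\<close> from \<open>t0\<close>, and a chain of two steps from the exact value at \<open>t0 + h\<close>. Up to that order their last steps
  preserve the difference of their starting values at \<open>t0 + 2h\<close>, as the reused values differ too little to matter.
  So the values at \<open>t0 + 2h\<close> agree up to \<open>O(h\<^bsup>q+2\<^esup>)\<close>. One of them is \<open>Y\<close> after two steps, which is accurate; the other is
  the plain step from \<open>t0 + h\<close>, whose local error is thereby bounded.
\<close>

lemma rk_order_of_reuse_order:
  assumes rk: "explicit_rk s A b" "s \<ge> 1" "nodes A $ (s - 1) = 1"
    and order: "rk_order A b q" "q \<ge> 1" and order_a: "rk_order A (last_row A) r" "r \<le> q"
    and m: "first_stage_influence A b m" "q \<le> m + r"
    and reuse: "rkrls_order A b (Suc q)"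
  shows "rk_order A b (Suc q)"
proof (rule rk_orderI)
  fix d f and t0 T :: real and y
  assume f: "smooth_rhs d f" and T: "t0 < T" and y: "solves_ivp d f t0 (y t0) T y"
  have c0: "nodes A $ 0 = 0" by (rule explicit_first_node[OF rk(1,2)])
  have "dim_vec b = s" using rk(1) by (simp add: explicit_rk_def)
  with weights_sum_of_order[OF order] have b: "(\<Sum>i<s. b $ i) = 1" by simp
  have comp: "rk_order (composed_A 2 A b) (composed_b 2 b) (Suc q)"
    "rk_order (composed_A 3 A b) (composed_b 3 b) (Suc q)"
    using reuse unfolding rkrls_order_def by simp_all
  have m1: "m \<ge> 1" using m(1) by (auto simp: first_stage_influence_def)
  note chain = reuse_chain_accuracy[OF order(1) order_a(1) m(1) order_a(2) _ _ _ c0 f y T, of "q + 1"]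
  define t where "t n h = t0 + real n * h" for n and h
  define z where "z n h = y (t n h)" for n h
  define Y where "Y n h = fst (reuse_chain A b f t0 (y t0) h n)" for n h
  define G where "G n h = snd (reuse_chain A b f t0 (y t0) h n)" for n h
  let ?a = "last_row A"
  \<comment> \<open>result of the step from the exact value at \<open>t 1\<close>, and the value reused after that step\<close>
  define U where "U h = restart_step A b f (t 1 h) (z 1 h) (f (t 1 h) (z 1 h)) h" for h
  define V where "V h = f (t 2 h) (restart_step A ?a f (t 1 h) (z 1 h) (f (t 1 h) (z 1 h)) h)" for h
  \<comment> \<open>the order to which the two reused values at \<open>t 2\<close> agree: the starting values differ by \<open>O(h\<^bsup>q+1\<^esup>)\<close>, the first stages by \<open>O(h\<^bsup>r+1\<^esup>)\<close>,
    which costs only \<open>O(h\<^bsup>r+2\<^esup>)\<close> in the update\<close>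
  let ?p = "min (q + 1) (r + 2)"
  have near_z: "near d t0 (y t0) (t n) (z n)" for n
    using solution_near[OF y T, of "real n"] by (simp add: t_def[abs_def] z_def[abs_def])
  have dY: "vec_bigo d (\<lambda>h k. Y n h k - z n h k) (q + 1)" for n
    unfolding Y_def z_def t_def by (rule chain(1)) (use m order_a in auto)
  have dG: "vec_bigo d (\<lambda>h k. G n h k - f (t n h) (Y n h) k) (r + 1)" for n
    unfolding Y_def G_def t_def by (rule chain(2)) (use m order_a in auto)
  have near_Y: "near d t0 (y t0) (t n) (Y n)" for n
    by (rule near_perturb[OF near_z vec_bigo_mono[OF dY]]) simp
  have fY: "vec_bigo d (\<lambda>h. f (t n h) (Y n h)) 0" for n by (rule rhs_bounded[OF f near_Y])
  have G0: "vec_bigo d (G n) 0" for n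
    using vec_bigo_add[OF vec_bigo_mono[OF dG[of n]] fY[of n]] by simp
  have Y_Suc: "Y (Suc n) h = restart_step A b f (t n h) (Y n h) (G n h) h" for n h
    unfolding Y_def G_def t_def by (rule fst_reuse_chain_Suc)
  have G_Suc: "G (Suc n) h = f (t (Suc n) h) (restart_step A ?a f (t n h) (Y n h) (G n h) h)" for n h
    unfolding Y_def G_def t_def by (rule snd_reuse_chain_Suc)

  have U1: "vec_bigo d (\<lambda>h k. U h k - z 2 h k) (q + 1)"
    using step_error_along_solution[OF order(1) c0 f y T, of 1]
    unfolding U_def z_def t_def by (simp add: numeral_2_eq_2)
  have near_U: "near d t0 (y t0) (t 2) U"
    by (rule near_perturb[OF near_z vec_bigo_mono[OF U1]]) simp
  have two: "vec_bigo d (\<lambda>h k. restart_step A b f (t 2 h) (U h) (V h) h k - z 3 h k) (q + 2)"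
  proof -
    have time: "t0 + real 1 * h + real 1 * h = t0 + real 2 * h" "t0 + real 1 * h + real 0 * h = t0 + real 1 * h"
        "1 + 2 = (3::nat)" for h
      by simp_all
    have "vec_bigo d (\<lambda>h k. fst (reuse_chain A b f (t0 + real 1 * h) (y (t0 + real 1 * h)) h 2) k -
      y (t0 + real (1 + 2) * h) k) (Suc q + 1)"
      by (rule chain_error_of_composed_order[OF rk b comp(1) _ f y T]) simp
    thus ?thesis
      unfolding U_def V_def z_def t_def numeral_2_eq_2
        fst_reuse_chain_Suc snd_reuse_chain_Suc reuse_chain.simps(1) fst_conv snd_conv
      unfolding One_nat_def[symmetric] Suc_1 time by simp
  qed
  have Y2: "vec_bigo d (\<lambda>h k. Y 2 h k - z 2 h k) (q + 2)" and Y3: "vec_bigo d (\<lambda>h k. Y 3 h k - z 3 h k) (q + 2)"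
    using chain_error_of_composed_order[OF rk b comp(1) _ f y T, of 0]
      chain_error_of_composed_order[OF rk b comp(2) _ f y T, of 0]
    unfolding Y_def z_def t_def by simp_all

  have fz: "vec_bigo d (\<lambda>h. f (t 1 h) (z 1 h)) 0" by (rule rhs_bounded[OF f near_z])
  have Pa: "vec_bigo d (\<lambda>h k. restart_step A ?a f (t 1 h) (Y 1 h) (G 1 h) h k -
     restart_step A ?a f (t 1 h) (z 1 h) (f (t 1 h) (z 1 h)) h k) ?p"
  proof (rule vec_bigo_trans)
    show "vec_bigo d (\<lambda>h k. restart_step A ?a f (t 1 h) (Y 1 h) (G 1 h) h k -
        restart_step A ?a f (t 1 h) (Y 1 h) (f (t 1 h) (Y 1 h)) h k) ?p"
      by (rule vec_bigo_mono[OF restart_step_first_stage_diff[OF f near_Y G0 fY dG, of _ _ 1]])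
         (auto simp: first_stage_influence_def)
    show "vec_bigo d (\<lambda>h k. restart_step A ?a f (t 1 h) (Y 1 h) (f (t 1 h) (Y 1 h)) h k -
        restart_step A ?a f (t 1 h) (z 1 h) (f (t 1 h) (z 1 h)) h k) ?p"
      by (rule vec_bigo_mono[OF plain_step_stable[OF f near_Y near_z dY]]) simp
  qed
  have near_Pz: "near d t0 (y t0) (t 2) (\<lambda>h. restart_step A ?a f (t 1 h) (z 1 h) (f (t 1 h) (z 1 h)) h)"
  proof (rule near_perturb[OF near_z])
    show "vec_bigo d (\<lambda>h k. restart_step A ?a f (t 1 h) (z 1 h) (f (t 1 h) (z 1 h)) h k - z 2 h k) 1"
      using vec_bigo_mono[OF step_error_along_solution[OF order_a(1) c0 f y T, of 1], of 1]
      unfolding z_def t_def by (simp add: numeral_2_eq_2)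
  qed
  have near_PY: "near d t0 (y t0) (t 2) (\<lambda>h. restart_step A ?a f (t 1 h) (Y 1 h) (G 1 h) h)"
    by (rule near_perturb[OF near_Pz vec_bigo_mono[OF Pa]]) simp
  have GV: "vec_bigo d (\<lambda>h k. G 2 h k - V h k) ?p"
  proof -
    have "vec_bigo d (\<lambda>h k. f (t 2 h) (restart_step A ?a f (t 1 h) (Y 1 h) (G 1 h) h) k -
        f (t 2 h) (restart_step A ?a f (t 1 h) (z 1 h) (f (t 1 h) (z 1 h)) h) k) ?p"
      by (rule rhs_diff[OF f near_PY near_Pz _ Pa]) simp
    thus ?thesis using G_Suc[of 1] by (simp add: V_def numeral_2_eq_2)
  qed
  have V0: "vec_bigo d V 0" unfolding V_def by (rule rhs_bounded[OF f near_Pz])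
  have "vec_bigo d (\<lambda>h k. restart_step A b f (t 2 h) (Y 2 h) (G 2 h) h k -
      restart_step A b f (t 2 h) (Y 2 h) (V h) h k) (q + 2)"
    by (rule vec_bigo_mono[OF restart_step_first_stage_diff[OF f near_Y G0 V0 GV m(1)]])
       (use m1 m(2) in auto)
  moreover have "restart_step A b f (t 2 h) (Y 2 h) (G 2 h) h = Y 3 h" for h
    using Y_Suc[of 2 h] by (simp add: numeral_3_eq_3 numeral_2_eq_2)
  ultimately have YW: "vec_bigo d (\<lambda>h k. Y 3 h k - restart_step A b f (t 2 h) (Y 2 h) (V h) h k) (q + 2)"
    by simp
  have YU: "vec_bigo d (\<lambda>h k. Y 2 h k - U h k) (q + 1)"
    by (rule vec_bigo_trans[OF dY vec_bigo_sym[OF U1]])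
  have VV: "vec_bigo d (\<lambda>h k. V h k - V h k) (q + 1)" by (simp add: vec_bigo_zero)
  have W: "vec_bigo d (\<lambda>h k. restart_step A b f (t 2 h) (Y 2 h) (V h) h k
      - restart_step A b f (t 2 h) (U h) (V h) h k - (Y 2 h k - U h k)) (q + 2)"
    using restart_step_diff[OF f near_Y near_U V0 V0 YU VV, of A b] by simp
  have "vec_bigo d (\<lambda>h k. restart_step A b f (t 2 h) (Y 2 h) (V h) h k
      - restart_step A b f (t 2 h) (U h) (V h) h k) (q + 2)"
    by (rule vec_bigo_trans[OF vec_bigo_sym[OF YW] vec_bigo_trans[OF Y3 vec_bigo_sym[OF two]]])
  from vec_bigo_diff[OF this W] have "vec_bigo d (\<lambda>h k. Y 2 h k - U h k) (q + 2)" by simp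
  from vec_bigo_trans[OF vec_bigo_sym[OF Y2] this] have "vec_bigo d (\<lambda>h k. z 2 h k - U h k) (q + 2)" .
  hence shifted: "vec_bigo d (\<lambda>h k. y (t0 + h + h) k - rk_step A b f (t0 + h) (y (t0 + h)) h k) (q + 2)"
    unfolding U_def z_def t_def rk_step_eq_restart_step[OF c0] by (simp add: add.assoc)
  have "vec_bigo d (\<lambda>h k. y (t0 + h) k - rk_step A b f t0 (y t0) h k) (q + 2)"
    unfolding vec_bigo_def
    using local_error_order_by_continuity[OF order(1) f y T] shifted[unfolded vec_bigo_def] by blast
  thus "vec_bigo d (\<lambda>h k. y (t0 + h) k - rk_step A b f t0 (y t0) h k) (Suc q + 1)" by simp
qed

text \<open>
  If plain and reusing method both have order \<open>p\<close>, the reused value has no effect on the second step up to that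
  order. On a test problem this is a condition on the coefficients.
\<close>

lemma first_stage_error_negligible:
  assumes rk: "explicit_rk s A b" "s \<ge> 1" "nodes A $ (s - 1) = 1"
    and order: "rk_order A b p" "p \<ge> 1" and reuse: "rkrls_order A b p"
    and f: "smooth_rhs d f" and T: "t0 < T" and y: "solves_ivp d f t0 (y t0) T y"
  shows "vec_bigo d (\<lambda>h k. fst (reuse_chain A b f t0 (y t0) h 2) k -
     restart_step A b f (t0 + h) (fst (reuse_chain A b f t0 (y t0) h 1))
        (f (t0 + h) (fst (reuse_chain A b f t0 (y t0) h 1))) h k) (p + 1)"
proof -
  have c0: "nodes A $ 0 = 0" by (rule explicit_first_node[OF rk(1,2)])
  have "dim_vec b = s" using rk(1) by (simp add: explicit_rk_def)
  with weights_sum_of_order[OF order] have b: "(\<Sum>i<s. b $ i) = 1" by simp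
  have comp: "rk_order (composed_A 2 A b) (composed_b 2 b) p"
    using reuse unfolding rkrls_order_def by simp
  define \<tau> where "\<tau> h = t0 + h" for h
  define z where "z h = y (\<tau> h)" for h
  define Y where "Y h = fst (reuse_chain A b f t0 (y t0) h 1)" for h
  have near_z: "near d t0 (y t0) \<tau> z"
    using solution_near[OF y T, of 1] by (simp add: \<tau>_def[abs_def] z_def[abs_def])
  have Yz: "vec_bigo d (\<lambda>h k. Y h k - z h k) (p + 1)"
    using step_error_along_solution[OF order(1) c0 f y T, of 0]
    unfolding Y_def z_def \<tau>_def One_nat_def fst_reuse_chain_Suc by simp
  have near_Y: "near d t0 (y t0) \<tau> Y"
    by (rule near_perturb[OF near_z vec_bigo_mono[OF Yz]]) simp
  have Y2: "vec_bigo d (\<lambda>h k. fst (reuse_chain A b f t0 (y t0) h 2) k - y (t0 + 2 * h) k) (p + 1)"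
    using chain_error_of_composed_order[OF rk b comp _ f y T, of 0] by simp
  have z2: "vec_bigo d (\<lambda>h k. restart_step A b f (\<tau> h) (z h) (f (\<tau> h) (z h)) h k - y (t0 + 2 * h) k) (p + 1)"
    using step_error_along_solution[OF order(1) c0 f y T, of 1]
    unfolding z_def \<tau>_def by simp
  have "vec_bigo d (\<lambda>h k. fst (reuse_chain A b f t0 (y t0) h 2) k -
     restart_step A b f (\<tau> h) (Y h) (f (\<tau> h) (Y h)) h k) (p + 1)"
    by (rule vec_bigo_trans[OF Y2 vec_bigo_sym[OF vec_bigo_trans[OF
          plain_step_stable[OF f near_Y near_z Yz, of A b] z2]]])
  thus ?thesis unfolding Y_def \<tau>_def .
qed

text \<open>
  In the second step of the chain started at time \<open>0\<close>, the reused first stage exceeds the plain one by \<open>(u a - u b) h\<^bsup>q+1\<^esup>\<close> in component \<open>1\<close> and by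
  \<open>(v a - v b) h\<^bsup>q+2\<^esup>\<close> in component \<open>2\<close>. The resulting changes of the update are monomials in \<open>h\<close>, hence they
  are negligible only if their coefficients vanish.
\<close>

lemma reuse_order_tower_conditions:
  assumes rk: "explicit_rk s A b" "s \<ge> 1" "nodes A $ (s - 1) = 1"
    and order: "rk_order A b p" and reuse: "rkrls_order A b p" and q: "q \<ge> 1"
  defines "u \<equiv> \<lambda>w. \<Sum>i<s. w $ i * (nodes A $ i) ^ q"
    and "v \<equiv> \<lambda>w. \<Sum>i<s. w $ i * (\<Sum>j<i. A $$ (i, j) * (nodes A $ j) ^ q)"
  shows "q + 2 \<le> p \<Longrightarrow> b $ 0 * (u (last_row A) - u b) = 0"
    and "q + 3 \<le> p \<Longrightarrow> b $ 0 * (v (last_row A) - v b)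
       + (\<Sum>i<s. b $ i * A $$ (i, 0)) * (u (last_row A) - u b) = 0"
proof -
  let ?a = "last_row A" and ?f = "tower_rhs q"
  have c0: "nodes A $ 0 = 0" by (rule explicit_first_node[OF rk(1,2)])
  have dims: "dim_vec b = s" "dim_vec ?a = s" and A00: "A $$ (0, 0) = 0"
    using rk(1,2) by (auto simp: explicit_rk_def last_row_def)
  define P where "P w h = restart_step A w ?f 0 (\<lambda>_. 0) (?f 0 (\<lambda>_. 0)) h" for w h
  define G where "G h = ?f h (P ?a h)" for h
  define g where "g h = ?f h (P b h)" for h
  have P: "P w h 0 = u w * h ^ (q + 1)" "P w h 1 = v w * h ^ (q + 2)" if "dim_vec w = s" for w h
    using tower_step[of A w q h] that
    unfolding P_def u_def v_def rk_step_eq_restart_step[OF c0] by simp_all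
  have diff0: "G h 0 = g h 0" for h by (simp add: G_def g_def tower_rhs_def)
  have diff1: "G h 1 - g h 1 = (u ?a - u b) * h ^ (q + 1)" for h
    using P(1)[OF dims(1)] P(1)[OF dims(2)] by (simp add: G_def g_def tower_rhs_def left_diff_distrib)
  have diff2: "G h 2 - g h 2 = (v ?a - v b) * h ^ (q + 2)" for h
    using P(2)[OF dims(1)] P(2)[OF dims(2)]
    by (simp add: G_def g_def tower_rhs_def numeral_2_eq_2 left_diff_distrib)
  have split: "{..<s} = insert 0 {1..<s}" using rk(2) by auto
  have p: "vec_bigo 3 (\<lambda>h k. restart_step A b ?f h (P b h) (G h) h k -
      restart_step A b ?f h (P b h) (g h) h k) (p + 1)" if "p \<ge> 1"
  proof -
    have "vec_bigo 3 (\<lambda>h k. fst (reuse_chain A b ?f 0 (tower_solution q 0) h 2) k -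
       restart_step A b ?f (0 + h) (fst (reuse_chain A b ?f 0 (tower_solution q 0) h 1))
        (?f (0 + h) (fst (reuse_chain A b ?f 0 (tower_solution q 0) h 1))) h k) (p + 1)"
      by (rule first_stage_error_negligible[OF rk order that reuse smooth_tower _ solves_tower]) simp
    thus ?thesis
      unfolding numeral_2_eq_2 One_nat_def fst_reuse_chain_Suc snd_reuse_chain_Suc reuse_chain.simps(1)
        fst_conv snd_conv P_def G_def g_def tower_solution_0 by simp
  qed
  have step_diff: "restart_step A b ?f h (P b h) (G h) h k - restart_step A b ?f h (P b h) (g h) h k =
      h * (\<Sum>i<s. b $ i * (restart_stage A ?f h (P b h) (G h) h i k - restart_stage A ?f h (P b h) (g h) h i k))"
    for h k
    unfolding restart_step_def dims by (simp add: right_diff_distrib sum_subtractf)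
  note stage = tower_first_stage_diff[where g = "G _" and g' = "g _", OF diff0]
  {
    assume "q + 2 \<le> p"
    have "restart_step A b ?f h (P b h) (G h) h 1 - restart_step A b ?f h (P b h) (g h) h 1 =
       b $ 0 * (u ?a - u b) * h ^ (q + 2)" for h
      unfolding step_diff stage(2) diff1 split by simp
    moreover have "(\<lambda>h. restart_step A b ?f h (P b h) (G h) h 1 - restart_step A b ?f h (P b h) (g h) h 1)
       \<in> O[at_right 0](\<lambda>h. h ^ (p + 1))"
      using p \<open>q + 2 \<le> p\<close> unfolding vec_bigo_def by simp
    ultimately have "(\<lambda>h. b $ 0 * (u ?a - u b) * h ^ (q + 2)) \<in> O[at_right 0](\<lambda>h. h ^ (p + 1))"
      by (simp only:)
    from monomial_bigo_zero[OF this] \<open>q + 2 \<le> p\<close>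
    show "b $ 0 * (u ?a - u b) = 0" by simp
  }
  {
    assume "q + 3 \<le> p"
    have "restart_step A b ?f h (P b h) (G h) h 2 - restart_step A b ?f h (P b h) (g h) h 2 =
       (b $ 0 * (v ?a - v b) + (\<Sum>i<s. b $ i * A $$ (i, 0)) * (u ?a - u b)) * h ^ (q + 3)" for h
    proof -
      have "(\<Sum>i<s. b $ i * (restart_stage A ?f h (P b h) (G h) h i 2 - restart_stage A ?f h (P b h) (g h) h i 2)) =
         b $ 0 * ((v ?a - v b) * h ^ (q + 2)) +
         (\<Sum>i\<in>{1..<s}. b $ i * (h * (A $$ (i, 0) * ((u ?a - u b) * h ^ (q + 1)))))"
        unfolding stage(3) diff1 diff2 split by simp
      also have "(\<Sum>i\<in>{1..<s}. b $ i * (h * (A $$ (i, 0) * ((u ?a - u b) * h ^ (q + 1))))) =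
          (\<Sum>i\<in>{1..<s}. b $ i * A $$ (i, 0)) * ((u ?a - u b) * h ^ (q + 2))"
        unfolding sum_distrib_right by (intro sum.cong) (simp_all add: algebra_simps)
      also have "(\<Sum>i\<in>{1..<s}. b $ i * A $$ (i, 0)) = (\<Sum>i<s. b $ i * A $$ (i, 0))"
        unfolding split by (simp add: A00)
      finally show ?thesis unfolding step_diff by (simp only:) (simp add: algebra_simps numeral_3_eq_3)
    qed
    moreover have "(\<lambda>h. restart_step A b ?f h (P b h) (G h) h 2 - restart_step A b ?f h (P b h) (g h) h 2)
       \<in> O[at_right 0](\<lambda>h. h ^ (p + 1))"
      using p \<open>q + 3 \<le> p\<close> unfolding vec_bigo_def by simp
    ultimately have "(\<lambda>h. (b $ 0 * (v ?a - v b) + (\<Sum>i<s. b $ i * A $$ (i, 0)) * (u ?a - u b)) * h ^ (q + 3))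
       \<in> O[at_right 0](\<lambda>h. h ^ (p + 1))"
      by (simp only:)
    from monomial_bigo_zero[OF this] \<open>q + 3 \<le> p\<close>
    show "b $ 0 * (v ?a - v b) + (\<Sum>i<s. b $ i * A $$ (i, 0)) * (u ?a - u b) = 0" by simp
  }
qed

section \<open>Order conditions up to order three\<close>

text \<open>
  Each application gains one order in an expansion of the solution: an approximation of \<open>y\<close> is inserted into \<open>f\<close>, and the resulting
  approximation of \<open>y'\<close> is integrated.
\<close>

lemma solution_antiderivative_bigo:
  assumes y: "solves_ivp d f t0 (y t0) T y" and T: "t0 < T"
    and P: "\<And>k h. (P k has_real_derivative P' k h) (at h)" and P0: "\<And>k. P k 0 = y t0 k"
    and bigo: "vec_bigo d (\<lambda>h k. f (t0 + h) (y (t0 + h)) k - P' k h) q"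
  shows "vec_bigo d (\<lambda>h k. y (t0 + h) k - P k h) (Suc q)"
  unfolding vec_bigo_def
proof (intro allI impI)
  fix k assume k: "k < d"
  define e where "e h = y (t0 + h) k - P k h" for h
  have y': "((\<lambda>h. y (t0 + h) k) has_real_derivative f (t0 + x) (y (t0 + x)) k) (at x)"
    if "0 < x" "x < T - t0" for x
  proof -
    have "((\<lambda>u. y u k) has_real_derivative f (t0 + x) (y (t0 + x)) k) (at (t0 + x) within {t0..T})"
      using y k that unfolding solves_ivp_def by auto
    hence "((\<lambda>u. y u k) has_real_derivative f (t0 + x) (y (t0 + x)) k) (at (t0 + x))"
      using that at_within_Icc_at[of t0 "t0 + x" T] by simp
    hence "((\<lambda>u. y u k) has_real_derivative f (t0 + x) (y (t0 + x)) k) (at (x + t0))"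
      by (simp add: add.commute)
    from this[unfolded DERIV_shift] show ?thesis by (simp add: add.commute)
  qed
  obtain C where C: "C > 0" "\<forall>\<^sub>F h in at_right 0. norm (f (t0 + h) (y (t0 + h)) k - P' k h) \<le> C * norm (h ^ q)"
    using bigo k unfolding vec_bigo_def by (blast elim: landau_o.bigE)
  then obtain \<delta> where \<delta>: "\<delta> > 0" "\<And>h. 0 < h \<Longrightarrow> h < \<delta> \<Longrightarrow> norm (f (t0 + h) (y (t0 + h)) k - P' k h) \<le> C * norm (h ^ q)"
    unfolding eventually_at_right_field by auto
  define \<delta>' where "\<delta>' = min \<delta> (T - t0)"
  have \<delta>': "\<delta>' > 0" using \<delta>(1) T by (simp add: \<delta>'_def)
  have "norm (e h) \<le> C * norm (h ^ Suc q)" if h: "0 < h" "h < \<delta>'" for h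
  proof -
    have der: "(e has_real_derivative f (t0 + x) (y (t0 + x)) k - P' k x) (at x)" if "0 < x" "x < \<delta>'" for x
      unfolding e_def[abs_def] using that P by (intro DERIV_diff y') (auto simp: \<delta>'_def)
    have "continuous_on {0..h} e" unfolding e_def[abs_def]
    proof (intro continuous_on_diff)
      show "continuous_on {0..h} (\<lambda>h. y (t0 + h) k)"
        by (rule continuous_on_compose2[OF solution_continuous[OF y k]])
           (use h in \<open>auto intro!: continuous_intros simp: \<delta>'_def\<close>)
      show "continuous_on {0..h} (P k)"
        using P DERIV_isCont continuous_at_imp_continuous_on by blast
    qed
    moreover have "e differentiable (at x)" if "0 < x" "x < h" for x
      using der[of x] that h by (auto simp: real_differentiable_def)
    ultimately obtain l x where x: "0 < x" "x < h" "(e has_real_derivative l) (at x)" "e h - e 0 = (h - 0) * l"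
      using MVT[of 0 h e] h by blast
    have "l = f (t0 + x) (y (t0 + x)) k - P' k x"
      using DERIV_unique[OF x(3) der] x h by auto
    hence "norm l \<le> C * norm (x ^ q)" using \<delta>(2)[of x] x h by (auto simp: \<delta>'_def)
    also have "\<dots> \<le> C * norm (h ^ q)"
      using x C(1) by (intro mult_left_mono) (auto simp: norm_power power_abs intro!: power_mono)
    finally have "h * norm l \<le> h * (C * norm (h ^ q))" using h by (intro mult_left_mono) auto
    moreover have "norm (e h) = h * norm l" using x(4) h P0 by (simp add: e_def abs_mult)
    ultimately show ?thesis using h by (simp add: abs_mult mult_ac)
  qed
  hence "\<forall>\<^sub>F h in at_right 0. norm (e h) \<le> C * norm (h ^ Suc q)"
    unfolding eventually_at_right_field using \<delta>' by blast
  thus "(\<lambda>h. y (t0 + h) k - P k h) \<in> O[at_right 0](\<lambda>h. h ^ Suc q)"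
    unfolding e_def using C(1) by (intro landau_o.bigI) auto
qed

text \<open>
  The stages evaluate \<open>f\<close> at times \<open>t0 + c\<^sub>i h\<close> with \<open>c\<^sub>i\<close> of either sign, while the solution exists only to the right of \<open>t0\<close>. So the
  right-hand side is expanded along the quadratic Taylor polynomial of the solution, which is defined on both sides. The expansion is
  used for the exact solution and for all stages, therefore its coefficients need not be identified.
\<close>

lemma rhs_taylor_along_polynomial:
  assumes f: "smooth_rhs d f"
  obtains g0 g1 g2 where "\<And>c. vec_bigo d (\<lambda>h k. f (t0 + c * h)
      (\<lambda>k. y0 k + (c * h) * f0 k + (c * h) ^ 2 / 2 * y2 k) k -
      (g0 k + g1 k * (c * h) + g2 k * (c * h) ^ 2)) 3"
proof -
  define M where "M k x = f (t0 + x) (\<lambda>k. y0 k + x * f0 k + x ^ 2 / 2 * y2 k) k" for k and x :: real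
  have "\<exists>g K. \<forall>x\<in>{-1..1}. \<bar>M k x - (g 0 + g 1 * x + g (2::nat) * x ^ 2)\<bar> \<le> K * \<bar>x\<bar> ^ 3" if k: "k < d" for k
  proof -
    have const: "step_smooth {0} {-1..1} 3 (\<lambda>_ _. c)" for c by (rule step_smooth_const) simp
    have x: "step_smooth {0} {-1..1} 3 (\<lambda>_ x. x)" by (rule step_smooth_step)
    have "step_smooth {0} {-1..1} 3 (\<lambda>_. M k)"
      unfolding M_def
    proof (rule step_smooth_rhs[OF f k])
      show "step_smooth {0} {- 1..1} 3 (\<lambda>_ x. t0 + x)" by (rule step_smooth_add[OF const x])
      fix j
      have "step_smooth {0} {-1..1} 3 (\<lambda>_ x. y0 j + x * f0 j + (x * x) * (1 / 2 * y2 j))"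
        by (intro step_smooth_add step_smooth_mult const x)
      thus "step_smooth {0} {-1..1} 3 (\<lambda>_ x. y0 j + x * f0 j + x ^ 2 / 2 * y2 j)"
        by (simp add: power2_eq_square)
    qed
    from step_smooth_taylor[OF _ _ _ this] obtain \<gamma> K where
      "\<forall>x\<in>{-1..1}. \<bar>M k x - (\<Sum>j<3. \<gamma> j 0 * x ^ j)\<bar> \<le> K * \<bar>x\<bar> ^ 3" by auto
    thus ?thesis by (intro exI[of _ "\<lambda>j. \<gamma> j 0"] exI[of _ K]) (simp add: numeral_3_eq_3 numeral_2_eq_2)
  qed
  hence "\<forall>k. \<exists>g. k < d \<longrightarrow> (\<exists>K. \<forall>x\<in>{-1..1}. \<bar>M k x - (g 0 + g 1 * x + g (2::nat) * x ^ 2)\<bar> \<le> K * \<bar>x\<bar> ^ 3)"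
    by blast
  then obtain g where "\<forall>k. k < d \<longrightarrow> (\<exists>K. \<forall>x\<in>{-1..1}. \<bar>M k x - (g k 0 + g k 1 * x + g k (2::nat) * x ^ 2)\<bar> \<le> K * \<bar>x\<bar> ^ 3)"
    by (rule choice[THEN exE])
  hence g: "\<exists>K. \<forall>x\<in>{-1..1}. \<bar>M k x - (g k 0 + g k 1 * x + g k (2::nat) * x ^ 2)\<bar> \<le> K * \<bar>x\<bar> ^ 3" if "k < d" for k
    using that by blast
  show ?thesis
  proof (rule that[of "\<lambda>k. g k 0" "\<lambda>k. g k 1" "\<lambda>k. g k 2"], unfold vec_bigo_def, intro allI impI)
    fix c :: real and k assume "k < d"
    then obtain K where K: "\<forall>x\<in>{-1..1}. \<bar>M k x - (g k 0 + g k 1 * x + g k 2 * x ^ 2)\<bar> \<le> K * \<bar>x\<bar> ^ 3"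
      using g by blast
    have "\<forall>\<^sub>F h in at_right 0. \<bar>c * h\<bar> < 1"
    proof (rule order_tendstoD)
      show "((\<lambda>h. \<bar>c * h\<bar>) \<longlongrightarrow> 0) (at_right 0)" 
        by (intro tendsto_rabs_zero) (auto intro!: tendsto_eq_intros)
    qed simp
    hence "\<forall>\<^sub>F h in at_right 0. norm (M k (c * h) - (g k 0 + g k 1 * (c * h) + g k 2 * (c * h) ^ 2))
        \<le> (K * \<bar>c\<bar> ^ 3) * norm (h ^ 3)"
    proof eventually_elim
      case (elim h)
      hence "c * h \<in> {-1..1}" by auto
      from K[rule_format, OF this] show ?case by (simp add: abs_mult power_mult_distrib power_abs mult_ac)
    qed
    from bigoI[OF this]
    show "(\<lambda>h. f (t0 + c * h) (\<lambda>k. y0 k + (c * h) * f0 k + (c * h) ^ 2 / 2 * y2 k) k -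
      (g k 0 + g k 1 * (c * h) + g k 2 * (c * h) ^ 2)) \<in> O[at_right 0](\<lambda>h. h ^ 3)"
      unfolding M_def .
  qed
qed

text \<open>
  Solution and stages are expanded alternately, one order at a time. Up to \<open>O(h\<^sup>2)\<close>, stage \<open>i\<close> is \<open>f0 + h c\<^sub>i y2\<close>.
  One order further, its argument differs from the quadratic Taylor polynomial \<open>q2\<close> of the solution by
  \<open>h\<^sup>2 ((A c)\<^sub>i - c\<^sub>i\<^sup>2 / 2) y2\<close>, and this enters the stage through the Jacobian. The order conditions \<open>b\<^sup>T A c = 1/6\<close> and
  \<open>b\<^sup>T c\<^sup>2 = 1/3\<close> (with weights \<open>w\<close> here) make the contributions of that difference cancel.
\<close>

lemma local_error_of_order_conditions:
  assumes A: "A \<in> carrier_mat s s" "s \<ge> 1"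
    and lower: "\<And>i j. i < s \<Longrightarrow> j < s \<Longrightarrow> i \<le> j \<Longrightarrow> A $$ (i, j) = 0"
    and w: "dim_vec w = s" and w1: "(\<Sum>i<s. w $ i) = 1"
    and f: "smooth_rhs d f" and y: "solves_ivp d f t0 (y t0) T y" and T: "t0 < T"
  defines "c \<equiv> \<lambda>i. nodes A $ i"
  defines "err \<equiv> \<lambda>h k. y (t0 + h) k - rk_step A w f t0 (y t0) h k"
  shows "vec_bigo d err 2"
    and "(\<Sum>i<s. w $ i * c i) = 1 / 2 \<Longrightarrow> vec_bigo d err 3"
    and "(\<Sum>i<s. w $ i * c i) = 1 / 2 \<Longrightarrow> (\<Sum>i<s. w $ i * (c i)\<^sup>2) = 1 / 3 \<Longrightarrow>
         (\<Sum>i<s. w $ i * (\<Sum>j<i. A $$ (i, j) * c j)) = 1 / 6 \<Longrightarrow> vec_bigo d err 4"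
proof -
  define e where "e h = y (t0 + h)" for h
  define F where "F i h = rk_stage A f t0 (y t0) h i" for i h
  define X where "X i = (\<lambda>h k. y t0 k + h * (\<Sum>j<i. A $$ (i, j) * F j h k))" for i
  define f0 where "f0 = f t0 (y t0)"
  have row: "(\<Sum>j<i. A $$ (i, j)) = c i" if "i < s" for i
  proof -
    have "c i = (\<Sum>j<s. A $$ (i, j))" unfolding c_def by (rule node_eq_row_sum[OF A(1) that])
    also have "\<dots> = (\<Sum>j<i. A $$ (i, j))"
      by (rule sum.mono_neutral_right) (use that lower in auto)
    finally show ?thesis by simp
  qed
  have c0: "nodes A $ 0 = 0" using row[of 0] A(2) by (simp add: c_def)
  have F: "F i h = f (t0 + c i * h) (X i h)" for i h
    unfolding F_def X_def c_def by (rule rk_stage.simps)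
  have f0_bounded: "vec_bigo d (\<lambda>h. f0) 0" by (rule vec_bigo_const)
  have near_e: "near d t0 (y t0) (\<lambda>h. t0 + h) e"
    using solution_near[OF y T, of 1] by (simp add: e_def[abs_def])
  have near_X: "near d t0 (y t0) (\<lambda>h. t0 + c i * h) (X i)" for i
    unfolding X_def F_def rk_stage_eq_restart_stage[OF c0] using rhs_bounded[OF f near_base]
    by (intro stage_argument_near[OF f near_base]) auto
  have time: "(\<lambda>h. t0 + c i * h - t0) \<in> O[at_right 0](\<lambda>h. h ^ 1)" for i by simp
  have near1: "vec_bigo d (\<lambda>h k. u h k - y t0 k) 1" if "near d t0 (y t0) \<tau> u" for \<tau> u
    using that by (simp add: near_def)
  have err: "rk_step A w f t0 (y t0) h k = y t0 k + h * (\<Sum>i<s. w $ i * F i h k)" for h k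
    by (simp add: rk_step_def w F_def)

  have F1: "vec_bigo d (\<lambda>h k. F i h k - f0 k) 1" for i
    unfolding F f0_def by (rule rhs_diff[OF f near_X near_base time near1[OF near_X]])
  have E1: "vec_bigo d (\<lambda>h k. f (t0 + h) (e h) k - f0 k) 1"
    unfolding f0_def by (rule rhs_diff[OF f near_e near_base _ near1[OF near_e]]) simp
  have E2: "vec_bigo d (\<lambda>h k. e h k - (y t0 k + h * f0 k)) 2"
    unfolding e_def numeral_2_eq_2
    by (rule solution_antiderivative_bigo[OF y T, where P' = "\<lambda>k h. f0 k"])
       (use E1 in \<open>auto simp: e_def intro!: derivative_eq_intros\<close>)
  have step_split: "(\<Sum>i<s. w $ i * (F i h k - G i)) = (\<Sum>i<s. w $ i * F i h k) - (\<Sum>i<s. w $ i * G i)"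
    for h k G
    by (simp add: right_diff_distrib sum_subtractf)
  have "vec_bigo d (\<lambda>h k. h * (\<Sum>i<s. w $ i * (F i h k - f0 k))) 2"
    unfolding numeral_2_eq_2 using F1 by (intro vec_bigo_hmult vec_bigo_sum vec_bigo_cmult) simp
  from vec_bigo_diff[OF E2 this] show "vec_bigo d err 2"
    unfolding err_def err step_split e_def
    by (rule vec_bigo_cong) (simp add: w1 right_diff_distrib flip: sum_distrib_right)

  obtain Jt J where J: "\<forall>\<tau> \<sigma> u v q. near d t0 (y t0) \<tau> u \<longrightarrow> near d t0 (y t0) \<sigma> v \<longrightarrow>
     (\<lambda>h. \<tau> h - \<sigma> h) \<in> O[at_right 0](\<lambda>h. h ^ q) \<longrightarrow> vec_bigo d (\<lambda>h k. u h k - v h k) q \<longrightarrow>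
     vec_bigo d (\<lambda>h k. f (\<tau> h) (u h) k - f (\<sigma> h) (v h) k -
        (Jt k * (\<tau> h - \<sigma> h) + (\<Sum>l<d. J k l * (u h l - v h l)))) (Suc q)"
    by (rule rhs_linearisation[OF f, of t0 "y t0"])
  have J_bigo: "vec_bigo d (\<lambda>h k. \<Sum>l<d. J k l * u h l) q" if "vec_bigo d u q" for u q
    using that unfolding vec_bigo_def by (auto intro!: big_sum_in_bigo)
  \<comment> \<open>the second derivative of the solution at \<open>t0\<close>\<close>
  define y2 where "y2 k = Jt k + (\<Sum>l<d. J k l * f0 l)" for k
  have X2: "vec_bigo d (\<lambda>h k. X i h k - (y t0 k + h * (c i * f0 k))) 2" if "i < s" for i
  proof -
    have "vec_bigo d (\<lambda>h k. h * (\<Sum>j<i. A $$ (i, j) * (F j h k - f0 k))) 2"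
      unfolding numeral_2_eq_2 using F1 by (intro vec_bigo_hmult vec_bigo_sum vec_bigo_cmult) simp
    thus ?thesis
      by (rule vec_bigo_cong)
         (simp add: X_def right_diff_distrib sum_subtractf row[OF that] flip: sum_distrib_right)
  qed
  have lin: "vec_bigo d (\<lambda>h k. f (t0 + a * h) (u h) k - (f0 k + h * (a * y2 k))) 2"
    if u: "near d t0 (y t0) (\<lambda>h. t0 + a * h) u"
      and u2: "vec_bigo d (\<lambda>h k. u h k - (y t0 k + h * (a * f0 k))) 2" for a u
  proof -
    have "vec_bigo d (\<lambda>h k. f (t0 + a * h) (u h) k - f t0 (y t0) k -
        (Jt k * (t0 + a * h - t0) + (\<Sum>l<d. J k l * (u h l - y t0 l)))) (Suc 1)"
      by (rule J[rule_format, OF u near_base _ near1[OF u]]) simp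
    hence *: "vec_bigo d (\<lambda>h k. f (t0 + a * h) (u h) k - f t0 (y t0) k -
        (Jt k * (a * h) + (\<Sum>l<d. J k l * (u h l - y t0 l)))) 2"
      by (simp add: numeral_2_eq_2)
    show ?thesis
    proof (rule vec_bigo_cong[OF vec_bigo_add[OF * J_bigo[OF u2]]])
      fix h k
      have "(\<Sum>l<d. J k l * (u h l - (y t0 l + h * (a * f0 l)))) =
          (\<Sum>l<d. J k l * (u h l - y t0 l) - (h * a) * (J k l * f0 l))"
        by (intro sum.cong) (simp_all add: algebra_simps)
      also have "\<dots> = (\<Sum>l<d. J k l * (u h l - y t0 l)) - (h * a) * (\<Sum>l<d. J k l * f0 l)"
        by (simp only: sum_subtractf sum_distrib_left)
      finally show "f (t0 + a * h) (u h) k - f t0 (y t0) k -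
          (Jt k * (a * h) + (\<Sum>l<d. J k l * (u h l - y t0 l))) +
          (\<Sum>l<d. J k l * (u h l - (y t0 l + h * (a * f0 l)))) =
          f (t0 + a * h) (u h) k - (f0 k + h * (a * y2 k))"
        by (simp add: f0_def y2_def algebra_simps)
    qed
  qed
  have F2: "vec_bigo d (\<lambda>h k. F i h k - (f0 k + h * (c i * y2 k))) 2" if "i < s" for i
    unfolding F by (rule lin[OF near_X X2[OF that]])
  have E2': "vec_bigo d (\<lambda>h k. f (t0 + h) (e h) k - (f0 k + h * y2 k)) 2"
    using lin[of 1 e] near_e E2 by simp
  have E3: "vec_bigo d (\<lambda>h k. e h k - (y t0 k + h * f0 k + h ^ 2 / 2 * y2 k)) 3"
    unfolding e_def numeral_3_eq_3
    by (rule solution_antiderivative_bigo[OF y T, where P' = "\<lambda>k h. f0 k + h * y2 k"])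
       (use E2' in \<open>auto simp: e_def numeral_2_eq_2 intro!: derivative_eq_intros\<close>)
  {
    assume w2: "(\<Sum>i<s. w $ i * c i) = 1 / 2"
    have "vec_bigo d (\<lambda>h k. h * (\<Sum>i<s. w $ i * (F i h k - (f0 k + h * (c i * y2 k))))) 3"
      unfolding numeral_3_eq_3 using F2
      by (intro vec_bigo_hmult vec_bigo_sum vec_bigo_cmult) (simp add: numeral_2_eq_2)
    from vec_bigo_diff[OF E3 this] show "vec_bigo d err 3"
    proof (rule vec_bigo_cong)
      fix h k
      have "(\<Sum>i<s. w $ i * (f0 k + h * (c i * y2 k))) = (\<Sum>i<s. w $ i * f0 k + (w $ i * c i) * (h * y2 k))"
        by (intro sum.cong) (simp_all add: algebra_simps)
      also have "\<dots> = f0 k + 1 / 2 * (h * y2 k)"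
        unfolding sum.distrib sum_distrib_right[symmetric] w1 w2 by simp
      finally show "e h k - (y t0 k + h * f0 k + h ^ 2 / 2 * y2 k) -
          h * (\<Sum>i<s. w $ i * (F i h k - (f0 k + h * (c i * y2 k)))) = err h k"
        unfolding step_split err_def err e_def by (simp add: algebra_simps power2_eq_square)
    qed
  }

  define Ac where "Ac i = (\<Sum>j<i. A $$ (i, j) * c j)" for i
  define q2 where "q2 x k = y t0 k + x * f0 k + x ^ 2 / 2 * y2 k" for x k
  define Jy2 where "Jy2 k = (\<Sum>l<d. J k l * y2 l)" for k
  obtain g0 g1 g2 where g: "\<And>a. vec_bigo d (\<lambda>h k. f (t0 + a * h) (q2 (a * h)) k -
      (g0 k + g1 k * (a * h) + g2 k * (a * h) ^ 2)) 3"
    using rhs_taylor_along_polynomial[OF f, of t0 "y t0" f0 y2] unfolding q2_def[abs_def] by blast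
  have near_q2: "near d t0 (y t0) (\<lambda>h. t0 + a * h) (\<lambda>h. q2 (a * h))" for a
  proof -
    have "vec_bigo d (\<lambda>h k. h * (a\<^sup>2 / 2 * y2 k)) 1"
      unfolding One_nat_def by (rule vec_bigo_hmult[OF vec_bigo_const])
    hence "vec_bigo d (\<lambda>h k. a * f0 k + h * (a\<^sup>2 / 2 * y2 k)) 0"
      by (intro vec_bigo_add vec_bigo_const) (rule vec_bigo_mono, auto)
    from near_shift[OF near_base this, of t0 "y t0" a] show ?thesis
      by (simp add: q2_def[abs_def] algebra_simps power2_eq_square)
  qed
  have E3': "vec_bigo d (\<lambda>h k. e h k - q2 h k) 3" using E3 by (simp add: q2_def)
  have "vec_bigo d (\<lambda>h k. f (t0 + h) (e h) k - f (t0 + h) (q2 h) k) 3"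
    by (rule rhs_diff[OF f near_e _ _ E3']) (use near_q2[of 1] in auto)
  moreover have "vec_bigo d (\<lambda>h k. f (t0 + h) (q2 h) k - (g0 k + g1 k * h + g2 k * h ^ 2)) 3"
    using g[of 1] by simp
  ultimately have E4': "vec_bigo d (\<lambda>h k. f (t0 + h) (e h) k - (g0 k + g1 k * h + g2 k * h ^ 2)) 3"
    by (rule vec_bigo_trans)
  have E4: "vec_bigo d (\<lambda>h k. e h k - (y t0 k + g0 k * h + g1 k * h ^ 2 / 2 + g2 k * h ^ 3 / 3)) (Suc 3)"
    unfolding e_def
    by (rule solution_antiderivative_bigo[OF y T, where P' = "\<lambda>k h. g0 k + g1 k * h + g2 k * h ^ 2"])
       (use E4' in \<open>auto simp: e_def intro!: derivative_eq_intros\<close>)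
  have X3: "vec_bigo d (\<lambda>h k. X i h k - q2 (c i * h) k - h ^ 2 * ((Ac i - (c i)\<^sup>2 / 2) * y2 k)) 3" if "i < s" for i
  proof -
    have "vec_bigo d (\<lambda>h k. h * (\<Sum>j<i. A $$ (i, j) * (F j h k - (f0 k + h * (c j * y2 k))))) 3"
      unfolding numeral_3_eq_3 using F2 that
      by (intro vec_bigo_hmult vec_bigo_sum vec_bigo_cmult) (simp add: numeral_2_eq_2)
    thus ?thesis
    proof (rule vec_bigo_cong)
      fix h k
      have "(\<Sum>j<i. A $$ (i, j) * (F j h k - (f0 k + h * (c j * y2 k)))) =
          (\<Sum>j<i. A $$ (i, j) * F j h k - A $$ (i, j) * f0 k - (A $$ (i, j) * c j) * (h * y2 k))"
        by (intro sum.cong) (simp_all add: algebra_simps)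
      also have "\<dots> = (\<Sum>j<i. A $$ (i, j) * F j h k) - c i * f0 k - Ac i * (h * y2 k)"
        unfolding sum_subtractf sum_distrib_right[symmetric] row[OF that] Ac_def ..
      finally have sum: "(\<Sum>j<i. A $$ (i, j) * (F j h k - (f0 k + h * (c j * y2 k)))) =
          (\<Sum>j<i. A $$ (i, j) * F j h k) - c i * f0 k - Ac i * (h * y2 k)" .
      show "h * (\<Sum>j<i. A $$ (i, j) * (F j h k - (f0 k + h * (c j * y2 k)))) =
          X i h k - q2 (c i * h) k - h ^ 2 * ((Ac i - (c i)\<^sup>2 / 2) * y2 k)"
        unfolding sum by (simp add: X_def q2_def algebra_simps power2_eq_square)
    qed
  qed
  have F3: "vec_bigo d (\<lambda>h k. F i h k - (g0 k + g1 k * (c i * h) + g2 k * (c i * h) ^ 2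
      + h ^ 2 * ((Ac i - (c i)\<^sup>2 / 2) * Jy2 k))) 3" if "i < s" for i
  proof -
    have "vec_bigo d (\<lambda>h k. h * (h * ((Ac i - (c i)\<^sup>2 / 2) * y2 k))) 2"
      unfolding numeral_2_eq_2 by (rule vec_bigo_hmult[OF vec_bigo_hmult[OF vec_bigo_const]])
    from vec_bigo_add[OF vec_bigo_mono[OF X3[OF that], of 2] this]
    have dX: "vec_bigo d (\<lambda>h k. X i h k - q2 (c i * h) k) 2"
      by (simp add: power2_eq_square mult.assoc)
    have "vec_bigo d (\<lambda>h k. f (t0 + c i * h) (X i h) k - f (t0 + c i * h) (q2 (c i * h)) k -
        (Jt k * (t0 + c i * h - (t0 + c i * h)) + (\<Sum>l<d. J k l * (X i h l - q2 (c i * h) l)))) (Suc 2)"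
      by (rule J[rule_format, OF near_X near_q2 _ dX]) simp
    hence a: "vec_bigo d (\<lambda>h k. F i h k - f (t0 + c i * h) (q2 (c i * h)) k -
        (\<Sum>l<d. J k l * (X i h l - q2 (c i * h) l))) 3"
      by (simp add: F)
    from vec_bigo_add[OF vec_bigo_add[OF a g[of "c i"]] J_bigo[OF X3[OF that]]] show ?thesis
    proof (rule vec_bigo_cong)
      fix h k
      have "(\<Sum>l<d. J k l * (X i h l - q2 (c i * h) l - h ^ 2 * ((Ac i - (c i)\<^sup>2 / 2) * y2 l))) =
         (\<Sum>l<d. J k l * (X i h l - q2 (c i * h) l) - h ^ 2 * (Ac i - (c i)\<^sup>2 / 2) * (J k l * y2 l))"
        by (intro sum.cong) (simp_all add: algebra_simps)
      also have "\<dots> = (\<Sum>l<d. J k l * (X i h l - q2 (c i * h) l)) - h ^ 2 * (Ac i - (c i)\<^sup>2 / 2) * Jy2 k"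
        by (simp only: sum_subtractf sum_distrib_left Jy2_def)
      finally show "F i h k - f (t0 + c i * h) (q2 (c i * h)) k -
        (\<Sum>l<d. J k l * (X i h l - q2 (c i * h) l)) + (f (t0 + c i * h) (q2 (c i * h)) k -
      (g0 k + g1 k * (c i * h) + g2 k * (c i * h) ^ 2)) +
        (\<Sum>l<d. J k l * (X i h l - q2 (c i * h) l - h ^ 2 * ((Ac i - (c i)\<^sup>2 / 2) * y2 l))) =
        F i h k - (g0 k + g1 k * (c i * h) + g2 k * (c i * h) ^ 2 + h ^ 2 * ((Ac i - (c i)\<^sup>2 / 2) * Jy2 k))"
        by simp
    qed
  qed
  {
    assume w2: "(\<Sum>i<s. w $ i * c i) = 1 / 2" and w3: "(\<Sum>i<s. w $ i * (c i)\<^sup>2) = 1 / 3"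
      and w3': "(\<Sum>i<s. w $ i * (\<Sum>j<i. A $$ (i, j) * c j)) = 1 / 6"
    let ?G = "\<lambda>h k i. g0 k + g1 k * (c i * h) + g2 k * (c i * h) ^ 2 + h ^ 2 * ((Ac i - (c i)\<^sup>2 / 2) * Jy2 k)"
    have "vec_bigo d (\<lambda>h k. h * (\<Sum>i<s. w $ i * (F i h k - ?G h k i))) (Suc 3)"
      using F3 by (intro vec_bigo_hmult vec_bigo_sum vec_bigo_cmult) simp
    from vec_bigo_diff[OF E4 this] have "vec_bigo d err (Suc 3)"
    proof (rule vec_bigo_cong)
      fix h k
      have "(\<Sum>i<s. w $ i * ?G h k i) = (\<Sum>i<s. w $ i * g0 k + (w $ i * c i) * (g1 k * h)
          + (w $ i * (c i)\<^sup>2) * (g2 k * h ^ 2 - h ^ 2 / 2 * Jy2 k) + (w $ i * Ac i) * (h ^ 2 * Jy2 k))"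
        by (intro sum.cong) (simp_all add: algebra_simps power_mult_distrib)
      also have "\<dots> = g0 k + 1 / 2 * (g1 k * h) + 1 / 3 * (g2 k * h ^ 2 - h ^ 2 / 2 * Jy2 k) + 1 / 6 * (h ^ 2 * Jy2 k)"
        unfolding sum.distrib sum_distrib_right[symmetric] w1 w2 w3 w3'[folded Ac_def] by simp
      also have "\<dots> = g0 k + g1 k * h / 2 + g2 k * h ^ 2 / 3" by (simp add: field_simps)
      finally show "e h k - (y t0 k + g0 k * h + g1 k * h ^ 2 / 2 + g2 k * h ^ 3 / 3) -
          h * (\<Sum>i<s. w $ i * (F i h k - ?G h k i)) = err h k"
        unfolding step_split err_def err e_def by (simp add: algebra_simps power2_eq_square power3_eq_cube)
    qed
    thus "vec_bigo d err 4" by simp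
  }
qed

lemma order_conditions_sufficient:
  assumes A: "A \<in> carrier_mat s s" "s \<ge> 1"
    and lower: "\<And>i j. i < s \<Longrightarrow> j < s \<Longrightarrow> i \<le> j \<Longrightarrow> A $$ (i, j) = 0"
    and w: "dim_vec w = s" and w1: "(\<Sum>i<s. w $ i) = 1"
  shows "rk_order A w 1"
    and "(\<Sum>i<s. w $ i * nodes A $ i) = 1 / 2 \<Longrightarrow> rk_order A w 2"
    and "(\<Sum>i<s. w $ i * nodes A $ i) = 1 / 2 \<Longrightarrow> (\<Sum>i<s. w $ i * (nodes A $ i)\<^sup>2) = 1 / 3 \<Longrightarrow>
         (\<Sum>i<s. w $ i * (\<Sum>j<i. A $$ (i, j) * nodes A $ j)) = 1 / 6 \<Longrightarrow> rk_order A w 3"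
  using local_error_of_order_conditions[OF assms] by (intro rk_orderI; simp add: numeral_eq_Suc)+

section \<open>The equivalences\<close>

lemma rkrls_order_mono: "rkrls_order A b p \<Longrightarrow> q \<le> p \<Longrightarrow> rkrls_order A b q"
  unfolding rkrls_order_def using rk_order_mono by blast

text \<open>
  The weights of the composed method have the same sum as \<open>b\<close>; order \<open>1\<close> of a method says that this sum is \<open>1\<close>.
\<close>

lemma weights_sum_of_reuse_order:
  assumes "rkrls_order A b p" "p \<ge> 1"
  shows "(\<Sum>i<dim_vec b. b $ i) = 1"
proof -
  let ?s = "dim_vec b" and ?b = "composed_b 2 b"
  have "rk_order (composed_A 2 A b) ?b p" using assms(1) by (simp add: rkrls_order_def)
  from weights_sum_of_order[OF this assms(2)] have "(\<Sum>i<2 * ?s + 0. ?b $ i) = 1"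
    by (simp add: composed_b_def Let_def)
  also have "(\<Sum>i<2 * ?s + 0. ?b $ i) = (\<Sum>l<2. \<Sum>j<?s. ?b $ (l * ?s + j))"
    unfolding sum_lessThan_blocks by simp
  also have "\<dots> = (\<Sum>l<(2::nat). \<Sum>j<?s. 1 / 2 * b $ j)"
  proof (rule sum.cong[OF refl], rule sum.cong[OF refl])
    fix l j assume "l \<in> {..<2::nat}" "j \<in> {..<?s}"
    hence "l = 0 \<or> l = 1" "j < ?s" by auto
    thus "?b $ (l * ?s + j) = 1 / 2 * b $ j" by (auto simp: composed_b_def Let_def)
  qed
  also have "\<dots> = (\<Sum>j<?s. b $ j)" by (simp add: sum_divide_distrib[symmetric] numeral_2_eq_2)
  finally show ?thesis .
qed

theorem theorem4:
  fixes s :: nat and A :: "real mat" and b a c :: "real vec"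
  assumes "s \<ge> 1"
    and "explicit_rk s A b"
    and "c = nodes A"
    and "c $ (s - 1) = 1"
    and "a = last_row A"
  shows "(rkrls_order A b 1 \<longleftrightarrow> rk_order A b 1)
    \<and> (rkrls_order A b 2 \<longleftrightarrow> rk_order A b 2)
    \<and> (rkrls_order A b 3 \<longleftrightarrow> rk_order A b 3 \<and> (b $ 0 = 0 \<or> a \<bullet> c = 1 / 2))
    \<and> (rkrls_order A b 4 \<longleftrightarrow> rk_order A b 4 \<and>
          (((transpose_mat A *\<^sub>v b) $ 0 = 0 \<and> b $ 0 = 0)
           \<or> (a \<bullet> c = 1 / 2 \<and> b $ 0 = 0)
           \<or> (a \<bullet> c = 1 / 2 \<and> a \<bullet> (A *\<^sub>v c) = 1 / 6 \<and> a \<bullet> map_vec (\<lambda>x. x\<^sup>2) c = 1 / 3)))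
    \<and> (\<forall>p\<ge>5. rk_order A b p \<and> b $ 0 = 0 \<and> (transpose_mat A *\<^sub>v b) $ 0 = 0 \<and> a \<bullet> c = 1 / 2
          \<longrightarrow> rkrls_order A b 5)"
proof -
  have A: "A \<in> carrier_mat s s" and dims: "dim_row A = s" "dim_col A = s" "dim_vec b = s" "dim_vec a = s" "dim_vec c = s"
    and lower: "\<And>i j. i < s \<Longrightarrow> j < s \<Longrightarrow> i \<le> j \<Longrightarrow> A $$ (i, j) = 0"
    using assms(2) unfolding explicit_rk_def assms(3,5) by (auto simp: last_row_def nodes_def)
  note rk = assms(2,1) assms(4)[unfolded assms(3)]
  have asum: "(\<Sum>i<s. a $ i) = 1"
    using rk(3) node_eq_row_sum[OF A, of "s - 1"] assms(1) dims by (simp add: assms(5) last_row_def)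
  have ac: "a \<bullet> c = (\<Sum>i<s. a $ i * nodes A $ i)"
    by (simp add: scalar_prod_def dims assms(3) nodes_def lessThan_atLeast0)
  have ac2: "a \<bullet> map_vec (\<lambda>x. x\<^sup>2) c = (\<Sum>i<s. a $ i * (nodes A $ i)\<^sup>2)"
    by (simp add: scalar_prod_def dims assms(3) nodes_def lessThan_atLeast0)
  have aAc: "a \<bullet> (A *\<^sub>v c) = (\<Sum>i<s. a $ i * (\<Sum>j<i. A $$ (i, j) * nodes A $ j))"
  proof -
    have "(A *\<^sub>v c) $ i = (\<Sum>j<i. A $$ (i, j) * nodes A $ j)" if "i < s" for i
    proof -
      have "(A *\<^sub>v c) $ i = (\<Sum>j<s. A $$ (i, j) * nodes A $ j)"
        using that by (simp add: scalar_prod_def dims assms(3) nodes_def lessThan_atLeast0)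
      also have "\<dots> = (\<Sum>j<i. A $$ (i, j) * nodes A $ j)"
        by (rule sum.mono_neutral_right) (use that lower in auto)
      finally show ?thesis .
    qed
    thus ?thesis by (simp add: scalar_prod_def dims lessThan_atLeast0)
  qed
  have bA: "(transpose_mat A *\<^sub>v b) $ 0 = (\<Sum>i<s. b $ i * A $$ (i, 0))"
    using assms(1) by (simp add: scalar_prod_def dims lessThan_atLeast0 mult.commute)
  note a_order = order_conditions_sufficient[OF A assms(1) lower dims(4) asum, folded ac ac2 aAc]
  have a1: "rk_order A (last_row A) 1" using a_order(1) by (simp add: assms(5))
  have a2: "rk_order A (last_row A) 2" if "a \<bullet> c = 1 / 2" using a_order(2) that by (simp add: assms(5))
  have a3: "rk_order A (last_row A) 3"
    if "a \<bullet> c = 1 / 2" "a \<bullet> (A *\<^sub>v c) = 1 / 6" "a \<bullet> map_vec (\<lambda>x. x\<^sup>2) c = 1 / 3"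
    using a_order(3) that by (simp add: assms(5))
  have m1: "first_stage_influence A b 1" by (simp add: first_stage_influence_def)
  have m2: "first_stage_influence A b 2" if "b $ 0 = 0"
    using that by (simp add: first_stage_influence_def)
  have m3: "first_stage_influence A b 3" if "b $ 0 = 0" "(transpose_mat A *\<^sub>v b) $ 0 = 0"
    using that unfolding bA by (simp add: first_stage_influence_def dims)
  note sufficient = reuse_order_sufficient[OF rk] and necessary = rk_order_of_reuse_order[OF rk]

  have rk1: "rk_order A b 1" if "rkrls_order A b 1"
    using order_conditions_sufficient(1)[OF A assms(1) lower dims(3)]
      weights_sum_of_reuse_order[OF that] dims(3) by simp
  have rk2: "rk_order A b 2" if "rkrls_order A b 2"
  proof -
    have 1: "rkrls_order A b 1" using rkrls_order_mono[OF that] by simp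
    have 2: "rkrls_order A b (Suc 1)" using that by (simp add: numeral_2_eq_2)
    have "rk_order A b (Suc 1)" by (rule necessary[OF rk1[OF 1] _ a1 _ m1 _ 2]) auto
    thus ?thesis by (simp add: numeral_2_eq_2)
  qed
  have rk3: "rk_order A b 3" if "rkrls_order A b 3"
  proof -
    have 2: "rkrls_order A b 2" using rkrls_order_mono[OF that] by simp
    have 3: "rkrls_order A b (Suc 2)" using that by (simp add: numeral_3_eq_3 numeral_2_eq_2)
    have "rk_order A b (Suc 2)" by (rule necessary[OF rk2[OF 2] _ a1 _ m1 _ 3]) auto
    thus ?thesis by (simp add: numeral_3_eq_3 numeral_2_eq_2)
  qed
  have cond3: "b $ 0 = 0 \<or> a \<bullet> c = 1 / 2" if "rkrls_order A b 3"
  proof -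
    have "b $ 0 * (a \<bullet> c - (\<Sum>i<s. b $ i * nodes A $ i)) = 0"
      using reuse_order_tower_conditions(1)[OF rk rk3[OF that] that, of 1, folded assms(5)]
      by (simp add: ac)
    moreover have "(\<Sum>i<s. b $ i * nodes A $ i) = 1 / 2"
      using order_conditions_necessary(1)[OF rk3[OF that], of 1] by (simp add: dims)
    ultimately show ?thesis by simp
  qed
  have rk4: "rk_order A b 4" if "rkrls_order A b 4"
  proof -
    have 3: "rkrls_order A b 3" using rkrls_order_mono[OF that] by simp
    have 4: "rkrls_order A b (Suc 3)" using that by simp
    have "rk_order A b (Suc 3)"
    proof (cases "b $ 0 = 0")
      case True
      show ?thesis by (rule necessary[OF rk3[OF 3] _ a1 _ m2[OF True] _ 4]) auto
    next
      case False
      hence "a \<bullet> c = 1 / 2" using cond3[OF 3] by simp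
      from necessary[OF rk3[OF 3] _ a2[OF this] _ m1 _ 4] show ?thesis by simp
    qed
    thus ?thesis by simp
  qed
  have cond4: "((transpose_mat A *\<^sub>v b) $ 0 = 0 \<and> b $ 0 = 0) \<or> (a \<bullet> c = 1 / 2 \<and> b $ 0 = 0)
       \<or> (a \<bullet> c = 1 / 2 \<and> a \<bullet> (A *\<^sub>v c) = 1 / 6 \<and> a \<bullet> map_vec (\<lambda>x. x\<^sup>2) c = 1 / 3)"
    if "rkrls_order A b 4"
  proof -
    note b4 = order_conditions_necessary[OF rk4[OF that], unfolded dims(3)]
    note tower = reuse_order_tower_conditions[OF rk rk4[OF that] that, folded assms(5)]
    have bc: "(\<Sum>i<s. b $ i * nodes A $ i) = 1 / 2" using b4(1)[of 1] by simp
    have bc2: "(\<Sum>i<s. b $ i * (nodes A $ i)\<^sup>2) = 1 / 3" using b4(1)[of 2] by simp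
    have bAc: "(\<Sum>i<s. b $ i * (\<Sum>j<i. A $$ (i, j) * nodes A $ j)) = 1 / 6" using b4(2)[of 1] by simp
    have t1: "b $ 0 * (a \<bullet> c - 1 / 2) = 0"
      using tower(1)[of 1] by (simp only: power_one_right bc flip: ac)
    have t2: "b $ 0 * (a \<bullet> map_vec (\<lambda>x. x\<^sup>2) c - 1 / 3) = 0"
      using tower(1)[of 2] by (simp only: bc2 flip: ac2)
    have t3: "b $ 0 * (a \<bullet> (A *\<^sub>v c) - 1 / 6) + (transpose_mat A *\<^sub>v b) $ 0 * (a \<bullet> c - 1 / 2) = 0"
      using tower(2)[of 1] by (simp only: power_one_right bc bAc flip: ac aAc bA)
    show ?thesis
    proof (cases "b $ 0 = 0")
      case True
      thus ?thesis using t3 by auto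
    next
      case False
      hence half: "a \<bullet> c = 1 / 2" using t1 by simp
      hence "b $ 0 * (a \<bullet> (A *\<^sub>v c) - 1 / 6) = 0"
        using t3 by (simp only: diff_self mult_zero_right add_0_right)
      thus ?thesis using False half t2 by simp
    qed
  qed

  have suff1: "rkrls_order A b 1" if "rk_order A b 1"
    by (rule sufficient[OF that _ a1 _ m1]) simp_all
  have suff2: "rkrls_order A b 2" if "rk_order A b 2"
    by (rule sufficient[OF that _ a1 _ m1]) simp_all
  have suff3: "rkrls_order A b 3" if 3: "rk_order A b 3" and "b $ 0 = 0 \<or> a \<bullet> c = 1 / 2"
    using that(2)
  proof
    assume "b $ 0 = 0"
    show ?thesis by (rule sufficient[OF 3 _ a1 _ m2]) (simp_all add: \<open>b $ 0 = 0\<close>)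
  next
    assume "a \<bullet> c = 1 / 2"
    show ?thesis by (rule sufficient[OF 3 _ a2 _ m1]) (simp_all add: \<open>a \<bullet> c = 1 / 2\<close>)
  qed
  have suff4: "rkrls_order A b 4" if 4: "rk_order A b 4"
    and "((transpose_mat A *\<^sub>v b) $ 0 = 0 \<and> b $ 0 = 0) \<or> (a \<bullet> c = 1 / 2 \<and> b $ 0 = 0)
       \<or> (a \<bullet> c = 1 / 2 \<and> a \<bullet> (A *\<^sub>v c) = 1 / 6 \<and> a \<bullet> map_vec (\<lambda>x. x\<^sup>2) c = 1 / 3)"
    using that(2)
  proof (elim disjE conjE)
    assume b0: "(transpose_mat A *\<^sub>v b) $ 0 = 0" "b $ 0 = 0"
    show ?thesis by (rule sufficient[OF 4 _ a1 _ m3[OF b0(2,1)]]) simp_all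
  next
    assume "a \<bullet> c = 1 / 2" "b $ 0 = 0"
    show ?thesis by (rule sufficient[OF 4 _ a2[OF \<open>a \<bullet> c = 1 / 2\<close>] _ m2[OF \<open>b $ 0 = 0\<close>]]) simp_all
  next
    assume a: "a \<bullet> c = 1 / 2" "a \<bullet> (A *\<^sub>v c) = 1 / 6" "a \<bullet> map_vec (\<lambda>x. x\<^sup>2) c = 1 / 3"
    show ?thesis by (rule sufficient[OF 4 _ a3[OF a] _ m1]) simp_all
  qed
  have suff5: "\<forall>p\<ge>5. rk_order A b p \<and> b $ 0 = 0 \<and> (transpose_mat A *\<^sub>v b) $ 0 = 0 \<and> a \<bullet> c = 1 / 2
      \<longrightarrow> rkrls_order A b 5"
  proof (intro allI impI, elim conjE)
    fix p :: nat
    assume p: "p \<ge> 5" "rk_order A b p" and b0: "b $ 0 = 0" "(transpose_mat A *\<^sub>v b) $ 0 = 0"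
      and "a \<bullet> c = 1 / 2"
    show "rkrls_order A b 5"
      by (rule sufficient[OF rk_order_mono[OF p(2,1)] _ a2[OF \<open>a \<bullet> c = 1 / 2\<close>] _ m3[OF b0]]) simp_all
  qed
  show ?thesis
    by (intro conjI iffI suff5; (elim conjE)?; (rule rk1 rk2 rk3 rk4 cond3 cond4 suff1 suff2 suff3 suff4; assumption))
qed

end
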